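(* Let $\mathcal{H}$ be an infinite-dimensional separable Hilbert space over $\mathbb{K}$, $W=\mathcal{H}\oplus\mathcal{H}^*$, and let $\mathcal{B}(\mathcal{H})$ be the bounded operators and $\mathcal{B}_2(\mathcal{H})$ the Hilbert-Schmidt operators on $\mathcal{H}$. For $A\in\mathcal{B}(\mathcal{H})$ let $\star^A_\hbar$ be the star-product of exponential type on $\mathcal{F}_{HS}[[\hbar]]$ defined in the context. Let $A,B\in\mathcal{B}(\mathcal{H})$. The two deformation quantizations $(W,\mathcal{F}_{HS}[[\hbar]],\star^A_\hbar)$ and $(W,\mathcal{F}_{HS}[[\hbar]],\star^B_\hbar)$ are equivalent if and only if $A-B$ is a Hilbert-Schmidt operator. Consequently, the set of equivalence classes of $\{(W,\mathcal{F}_{HS}[[\hbar]],\star^A_\hbar)\}_{A\in\mathcal{B}(\mathcal{H})}$ is parameterized by $\mathcal{B}(\mathcal{H})/\mathcal{B}_2(\mathcal{H})$.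
   Context: $\mathbb{K}$ is $\mathbb{R}$ or $\mathbb{C}$. $C^\infty(W,\mathbb{K})$ is the space of $\mathbb{K}$-valued functions on $W$ that are smooth in the Fréchet sense (over $\mathbb{K}$); $D^{(r)}F(w)$ is the $r$-th Fréchet derivative. $D_1F$ and $D_2F$ are the partial derivatives along $\mathcal{H}$ and $\mathcal{H}^*$, so $D_1F(x,\eta)\in\mathcal{H}^*$ and, identifying $\mathcal{H}^{**}\simeq\mathcal{H}$, $D_2F(x,\eta)\in\mathcal{H}$. $\langle\cdot,\cdot\rangle:\mathcal{H}^*\times\mathcal{H}\to\mathbb{K}$ is the canonical pairing. The canonical Poisson bracket is $\{F,G\}=\langle D_1F,D_2G\rangle-\langle D_1G,D_2F\rangle$. Fix an orthonormal basis $\{e_i\}_{i\ge1}$ of $\mathcal{H}$ with dual basis $\{e_i^*\}_{i\ge1}$ of $\mathcal{H}^*$; $\partial_i$ is the derivative in the direction $(e_i,0)$, $\partial_{i^*}$ the derivative in the direction $(0,e_i^* )$, similarly for iterated derivatives, and $i^\sharp$ stands for either $i$ or $i^*$. $\mathcal{F}_{HS}$, the algebra of functions of Hilbert-Schmidt type, is the set of $F\in C^\infty(W,\mathbb{K})$ such that $\sum_{i_1,\dots,i_r\ge1}|\partial_{i_1^\sharp\cdots i_r^\sharp}F(x,\eta)|^2<\infty$ for all $r\ge1$, all $(x,\eta)\in W$ and all choices of $\sharp$'s (independent of the basis). For $F\in\mathcal{F}_{HS}$, $D^{(m)}F(w)$ is identified with an element of the $m$-th Hilbert tensor power $W^{\otimes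 m}$ (identifying $W^*\simeq\mathcal{H}^*\oplus\mathcal{H}$ with $W$). An $r$-differential operator on $(W,\mathcal{F}_{HS})$ is an $r$-linear map $\mathbf{A}:\mathcal{F}_{HS}^r\to\mathcal{F}_{HS}$ of the form $\mathbf{A}(F_1,\dots,F_r)(w)=\sum_{n_1,\dots,n_r\ge0}a^{(n_1,\dots,n_r)}(w).(D^{(n_1)}F_1(w),\dots,D^{(n_r)}F_r(w))$ (finitely many nonzero terms), where each $a^{(n_1,\dots,n_r)}(w)$ is a bounded $r$-linear form on $W^{\otimes n_1}\times\cdots\times W^{\otimes n_r}$ depending smoothly on $w\in W$. "Vanishing on constants" means vanishing when any argument is a constant function. Star-products of exponential type: for $A\in\mathcal{B}(\mathcal{H})$ and $\mathbb{I}$ the identity operator on $\mathcal{H}$, let $$C_1^A(F,G)=\langle D_1F,(A+\mathbb{I})D_2G\rangle+\langle D_1G,(A-\mathbb{I})D_2F\rangle ,$$ i.e. $C_1^A(F,G)(w)=b_A(DF(w),DG(w))$ with $b_A$ the bounded bilinear form on $W^*\simeq\mathcal{H}^*\oplus\mathcal{H}$ given by $b_A((\xi,y),(\xi',y'))=\langle\xi,(A+\mathbb{I})y'\rangle+\langle\xi',(A-\mathbb{I})y\rangle$. Let $C_r^A=(C_1^A)^r$ be its $r$-th power in the sense of constant-coefficient bidifferential operators: $C_r^A(F,G)(w)=b_A^{\otimes r}(D^{(r)}F(w),D^{(r)}G(w))$, where $b_A^{\otimes r}$ is the bounded bilinear form on $(W^* )^{\otimes r}$ determined by $b_A^{\otimes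 r}(u_1\otimes\cdots\otimes u_r,v_1\otimes\cdots\otimes v_r)=\prod_kb_A(u_k,v_k)$. Then $$F\star^A_\hbar G=FG+\sum_{r\ge1}\frac{\hbar^r}{r!}C_r^A(F,G),\qquad F,G\in\mathcal{F}_{HS},$$ extended $\mathbb{K}[[\hbar]]$-bilinearly to $\mathcal{F}_{HS}[[\hbar]]$. Two deformation quantizations $(W,\mathcal{F}_{HS}[[\hbar]],\star^1_\hbar)$ and $(W,\mathcal{F}_{HS}[[\hbar]],\star^2_\hbar)$ of $(W,\mathcal{F}_{HS},\{\cdot,\cdot\})$ are equivalent if there is a $\mathbb{K}[[\hbar]]$-linear map $T=\mathrm{Id}+\sum_{r\ge1}\hbar^rT_r$ on $\mathcal{F}_{HS}[[\hbar]]$, with each $T_r:\mathcal{F}_{HS}\to\mathcal{F}_{HS}$ a ($1$-)differential operator vanishing on constants, such that $T(F)\star^1_\hbar T(G)=T(F\star^2_\hbar G)$ for all $F,G\in\mathcal{F}_{HS}$.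
   Formalization: In the definition of F_HS the sums of squares of partial derivatives are required to be locally bounded in (x,η), not only finite at each point; with pointwise finiteness alone the products C_r^A(F,G) need not be continuous, so the star-products are not defined on F_HS[[ħ]]. *)

theory Defs
  imports
    "HOL-Analysis.Analysis"
    "HOL-Computational_Algebra.Formal_Power_Series"
begin

section \<open>The scalar field\<close>

text \<open>
  A type of this class is, as a normed algebra with conjugation, isometrically isomorphic to the
  reals (with the identity as conjugation) or to the complex numbers: the last axiom restricts the
  algebra, and the axioms on the conjugation pin down both the conjugation and the norm.
\<close>

class real_or_complex = real_normed_field + banach +
  fixes kconj :: "'a \<Rightarrow> 'a"
  assumes kconj_add: "kconj (x + y) = kconj x + kconj y"
    and kconj_mult: "kconj (x * y) = kconj x * kconj y"
    and mult_kconj: "x * kconj x = (norm x)\<^sup>2 *\<^sub>R 1"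
    and real_or_complex_cases:
      "(\<forall>x. \<exists>a. x = a *\<^sub>R 1) \<or>
       (\<exists>i. i * i = - 1 \<and> (\<forall>x. \<exists>a b. x = a *\<^sub>R 1 + b *\<^sub>R i))"

instantiation real :: real_or_complex
begin
definition kconj_real :: "real \<Rightarrow> real" where "kconj_real x = x"
instance
  by standard (auto simp: kconj_real_def power2_eq_square)
end

instantiation complex :: real_or_complex
begin
definition kconj_complex :: "complex \<Rightarrow> complex" where "kconj_complex = cnj"
instance
proof
  fix x y :: complex
  show "kconj (x + y) = kconj x + kconj y" "kconj (x * y) = kconj x * kconj y"
    by (simp_all add: kconj_complex_def)
  show "x * kconj x = (norm x)\<^sup>2 *\<^sub>R 1"
    using complex_norm_square[of x] by (simp add: kconj_complex_def scaleR_conv_of_real)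
  have "z = Re z *\<^sub>R 1 + Im z *\<^sub>R \<i>" for z
    by (simp add: complex_eq_iff)
  then show "(\<forall>z::complex. \<exists>a. z = a *\<^sub>R 1) \<or>
      (\<exists>i::complex. i * i = - 1 \<and> (\<forall>z. \<exists>a b. z = a *\<^sub>R 1 + b *\<^sub>R i))"
    using i_squared by blast
qed
end


section \<open>The Hilbert space, its dual, and the phase space\<close>

text \<open>
  The data: a Hilbert space on the type \<open>'h\<close> (scalar multiplication and inner product), its dual on
  the type \<open>'d\<close> (scalar multiplication and canonical pairing), and a sequence in \<open>'h\<close>.
  The phase space \<open>W\<close> is the type \<open>'h \<times> 'd\<close>, whose library norm is the Hilbert sum norm.
\<close>

record ('k, 'h, 'd) phase_data =
  scaleH :: "'k \<Rightarrow> 'h \<Rightarrow> 'h"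
  ip :: "'h \<Rightarrow> 'h \<Rightarrow> 'k"
  scaleD :: "'k \<Rightarrow> 'd \<Rightarrow> 'd"
  pairing :: "'d \<Rightarrow> 'h \<Rightarrow> 'k"
  basis :: "nat \<Rightarrow> 'h"

definition hilbert_space ::
  "('k::real_or_complex, 'h::banach, 'd::banach) phase_data \<Rightarrow> bool" where
  "hilbert_space S \<longleftrightarrow>
     vector_space (scaleH S) \<and>
     (\<forall>r x. scaleH S (of_real r) x = r *\<^sub>R x) \<and>
     (\<forall>x. Vector_Spaces.linear (scaleH S) (*) (ip S x)) \<and>
     (\<forall>x y. ip S y x = kconj (ip S x y)) \<and>
     (\<forall>x. ip S x x = of_real ((norm x)\<^sup>2))"

definition infinite_dimensional ::
  "('k::real_or_complex, 'h::banach, 'd::banach) phase_data \<Rightarrow> bool" where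
  "infinite_dimensional S \<longleftrightarrow> \<not> (\<exists>X. finite X \<and> module.span (scaleH S) X = UNIV)"

definition separable :: "('k::real_or_complex, 'h::banach, 'd::banach) phase_data \<Rightarrow> bool" where
  "separable S \<longleftrightarrow> (\<exists>X :: 'h set. countable X \<and> closure X = UNIV)"

text \<open>
  The dual space cannot be a type depending on \<open>scaleH S\<close>, so \<open>'d\<close> is any type identified with it:
  \<open>pairing S\<close> is a linear isometric bijection from \<open>'d\<close> onto the bounded \<open>'k\<close>-linear functionals
  on \<open>'h\<close> with the operator norm.
\<close>

definition dual_space :: "('k::real_or_complex, 'h::banach, 'd::banach) phase_data \<Rightarrow> bool" where
  "dual_space S \<longleftrightarrow>
     vector_space (scaleD S) \<and>
     (\<forall>r \<eta>. scaleD S (of_real r) \<eta> = r *\<^sub>R \<eta>) \<and>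
     (\<forall>\<eta>. bounded_linear (pairing S \<eta>) \<and> Vector_Spaces.linear (scaleH S) (*) (pairing S \<eta>)) \<and>
     (\<forall>x. Vector_Spaces.linear (scaleD S) (*) (\<lambda>\<eta>. pairing S \<eta> x)) \<and>
     (\<forall>\<eta>. norm \<eta> = onorm (pairing S \<eta>)) \<and>
     (\<forall>f. bounded_linear f \<and> Vector_Spaces.linear (scaleH S) (*) f \<longrightarrow> (\<exists>\<eta>. pairing S \<eta> = f))"

definition orthonormal_basis ::
  "('k::real_or_complex, 'h::banach, 'd::banach) phase_data \<Rightarrow> bool" where
  "orthonormal_basis S \<longleftrightarrow>
     (\<forall>i j. ip S (basis S i) (basis S j) = (if i = j then 1 else 0)) \<and>
     closure (module.span (scaleH S) (range (basis S))) = UNIV"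

definition dual_basis ::
  "('k::real_or_complex, 'h::banach, 'd::banach) phase_data \<Rightarrow> nat \<Rightarrow> 'd" where
  "dual_basis S i = (THE \<eta>. \<forall>x. pairing S \<eta> x = ip S (basis S i) x)"

definition scaleW ::
  "('k::real_or_complex, 'h::banach, 'd::banach) phase_data \<Rightarrow> 'k \<Rightarrow> 'h \<times> 'd \<Rightarrow> 'h \<times> 'd" where
  "scaleW S c w = (scaleH S c (fst w), scaleD S c (snd w))"

text \<open>The flag is the choice of \<open>\<sharp>\<close>: it tells whether the index is starred.\<close>

definition basisW ::
  "('k::real_or_complex, 'h::banach, 'd::banach) phase_data \<Rightarrow> bool \<Rightarrow> nat \<Rightarrow> 'h \<times> 'd" where
  "basisW S starred i = (if starred then (0, dual_basis S i) else (basis S i, 0))"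


section \<open>Frechet derivatives and smoothness\<close>

text \<open>
  Multilinear forms on \<open>W\<close> are functions on lists of vectors. \<open>deriv_form F w [v\<^sub>1, ..., v\<^sub>n]\<close> is the
  value at \<open>(v\<^sub>1, ..., v\<^sub>n)\<close> of the \<open>n\<close>-th derivative of \<open>F\<close> at \<open>w\<close>.
\<close>

fun deriv_form ::
  "('w::real_normed_vector \<Rightarrow> 'k::real_normed_vector) \<Rightarrow> 'w \<Rightarrow> 'w list \<Rightarrow> 'k" where
  "deriv_form F w [] = F w"
| "deriv_form F w (v # vs) = frechet_derivative (\<lambda>x. deriv_form F x vs) (at w) v"

definition multilinear ::
  "('k::real_or_complex, 'h::banach, 'd::banach) phase_data \<Rightarrow> nat \<Rightarrow> (('h \<times> 'd) list \<Rightarrow> 'k) \<Rightarrow> bool"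
  where
  "multilinear S n t \<longleftrightarrow>
     (\<forall>us vs. length us + 1 + length vs = n \<longrightarrow>
        Vector_Spaces.linear (scaleW S) (*) (\<lambda>x. t (us @ x # vs)))"

text \<open>
  \<open>smooth_map S P N \<Phi>\<close>: \<open>\<Phi>\<close> is a map from \<open>W\<close> into the Banach space of those functions \<open>f\<close> on \<open>P\<close>
  for which there is a \<open>C\<close> with \<open>norm (f p) \<le> C * N p\<close> (normed by the least such \<open>C\<close>), and it is smooth
  in the Frechet sense over \<open>'k\<close>. For each \<open>n\<close>, the \<open>n\<close>-th derivative at every point is a bounded
  \<open>'k\<close>-multilinear map with values in that space, and the \<open>n\<close>-th derivative, as a map into these
  multilinear maps with the operator norm, is Frechet differentiable with derivative the
  \<open>(n+1)\<close>-st one.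
\<close>

definition smooth_map ::
  "('k::real_or_complex, 'h::banach, 'd::banach) phase_data \<Rightarrow> 'p set \<Rightarrow> ('p \<Rightarrow> real)
     \<Rightarrow> ('h \<times> 'd \<Rightarrow> 'p \<Rightarrow> 'k) \<Rightarrow> bool" where
  "smooth_map S P N \<Phi> \<longleftrightarrow>
     (\<forall>n w.
        (\<forall>p\<in>P. multilinear S n (deriv_form (\<lambda>x. \<Phi> x p) w)) \<and>
        (\<exists>C. \<forall>p\<in>P. \<forall>vs. length vs = n \<longrightarrow>
           norm (deriv_form (\<lambda>x. \<Phi> x p) w vs) \<le> C * N p * prod_list (map norm vs)) \<and>
        (\<forall>\<epsilon>>0. \<exists>\<delta>>0. \<forall>h. norm h < \<delta> \<longrightarrow>
           (\<forall>p\<in>P. \<forall>vs. length vs = n \<longrightarrow>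
              norm (deriv_form (\<lambda>x. \<Phi> x p) (w + h) vs - deriv_form (\<lambda>x. \<Phi> x p) w vs
                    - deriv_form (\<lambda>x. \<Phi> x p) w (h # vs))
                \<le> \<epsilon> * norm h * N p * prod_list (map norm vs))))"

definition smooth_functions ::
  "('k::real_or_complex, 'h::banach, 'd::banach) phase_data \<Rightarrow> ('h \<times> 'd \<Rightarrow> 'k) set" where
  "smooth_functions S = {F. smooth_map S {()} (\<lambda>_. 1) (\<lambda>w _. F w)}"

text \<open>\<open>nth_deriv n F w\<close> is the \<open>n\<close>-th derivative as an \<open>n\<close>-form; forms vanish on lists of wrong length.\<close>

definition nth_deriv ::
  "nat \<Rightarrow> ('w::real_normed_vector \<Rightarrow> 'k::real_normed_vector) \<Rightarrow> 'w \<Rightarrow> 'w list \<Rightarrow> 'k" where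
  "nth_deriv n F w vs = (if length vs = n then deriv_form F w vs else 0)"


section \<open>Functions of Hilbert-Schmidt type and Hilbert tensor powers\<close>

text \<open>
  Besides the finiteness of the sums at every point, their local boundedness in \<open>w\<close> is required. For
  a smooth \<open>F\<close> this is the same as smoothness of \<open>nth_deriv m F\<close> as a map into the \<open>m\<close>-th Hilbert tensor
  power, by Taylor's formula. It does not follow from finiteness at every point:
  for real scalars, with bump functions \<open>\<phi>\<^sub>n\<close> supported in \<open>[1/(n+1), 1/n]\<close>, disjoint finite sets \<open>B\<^sub>n\<close> of indices
  \<open>\<noteq> 0\<close> and \<open>h\<^sub>n\<close> tending to \<open>0\<close> fast, the function
  \<open>F(x,\<eta>) = \<Sum>\<^sub>n h\<^sub>n \<phi>\<^sub>n(x\<^sub>0) (\<Sum>i\<in>B\<^sub>n. x\<^sub>i \<eta>\<^sub>i)\<close> is smooth with finite sums everywhere, but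
  for large \<open>B\<^sub>n\<close> the second term of a star product, or the contraction of its second derivative with
  a Hilbert-Schmidt operator that is not of trace class, is discontinuous where \<open>x\<^sub>0 = 0\<close>. Without
  local boundedness the star products would not be internal.
\<close>

definition hs_functions ::
  "('k::real_or_complex, 'h::banach, 'd::banach) phase_data \<Rightarrow> ('h \<times> 'd \<Rightarrow> 'k) set" where
  "hs_functions S = {F \<in> smooth_functions S.
     \<forall>ss. ss \<noteq> [] \<longrightarrow>
       (\<forall>w. (\<lambda>is. (norm (deriv_form F w (map2 (basisW S) ss is)))\<^sup>2)
              summable_on {is. length is = length ss}) \<and>
       (\<forall>w. \<exists>\<rho>>0. \<exists>C. \<forall>w'\<in>ball w \<rho>.
              (\<Sum>\<^sub>\<infinity>is | length is = length ss.
                 (norm (deriv_form F w' (map2 (basisW S) ss is)))\<^sup>2) \<le> C)}"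

definition dualW ::
  "('k::real_or_complex, 'h::banach, 'd::banach) phase_data \<Rightarrow> ('h \<times> 'd \<Rightarrow> 'k) set" where
  "dualW S = {u. bounded_linear u \<and> Vector_Spaces.linear (scaleW S) (*) u}"

text \<open>
  The \<open>m\<close>-th Hilbert tensor power of the dual of \<open>W\<close> (which is identified with \<open>W\<close> by swapping the
  summands), realised as the space of bounded \<open>m\<close>-linear forms on \<open>W\<close> with finite Hilbert-Schmidt
  norm. Thus \<open>nth_deriv m F w\<close> itself is an element of it.
\<close>

definition tensor_power ::
  "('k::real_or_complex, 'h::banach, 'd::banach) phase_data \<Rightarrow> nat \<Rightarrow> (('h \<times> 'd) list \<Rightarrow> 'k) set" where
  "tensor_power S m = {t.
     (\<forall>vs. length vs \<noteq> m \<longrightarrow> t vs = 0) \<and>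
     multilinear S m t \<and>
     (\<exists>C. \<forall>vs. length vs = m \<longrightarrow> norm (t vs) \<le> C * prod_list (map norm vs)) \<and>
     (\<lambda>is. (norm (t (map (case_prod (basisW S)) is)))\<^sup>2) summable_on {is. length is = m}}"

definition tensor_norm ::
  "('k::real_or_complex, 'h::banach, 'd::banach) phase_data \<Rightarrow> nat \<Rightarrow> (('h \<times> 'd) list \<Rightarrow> 'k) \<Rightarrow> real" where
  "tensor_norm S m t =
     sqrt (\<Sum>\<^sub>\<infinity>is | length is = m. (norm (t (map (case_prod (basisW S)) is)))\<^sup>2)"

definition pure_tensor :: "('w \<Rightarrow> 'k::real_or_complex) list \<Rightarrow> 'w list \<Rightarrow> 'k" where
  "pure_tensor us ws =
     (if length ws = length us then \<Prod>k<length us. (us ! k) (ws ! k) else 0)"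

text \<open>Linearity of a form on a linear subspace \<open>V\<close> of a space of functions.\<close>

definition linear_form_on ::
  "('p \<Rightarrow> 'k::real_or_complex) set \<Rightarrow> (('p \<Rightarrow> 'k) \<Rightarrow> 'k) \<Rightarrow> bool" where
  "linear_form_on V f \<longleftrightarrow>
     (\<forall>s\<in>V. \<forall>t\<in>V. f (\<lambda>p. s p + t p) = f s + f t) \<and>
     (\<forall>c. \<forall>t\<in>V. f (\<lambda>p. c * t p) = c * f t)"


section \<open>Differential operators\<close>

definition differential_operator ::
  "('k::real_or_complex, 'h::banach, 'd::banach) phase_data
     \<Rightarrow> (('h \<times> 'd \<Rightarrow> 'k) \<Rightarrow> ('h \<times> 'd \<Rightarrow> 'k)) \<Rightarrow> bool" where
  "differential_operator S T \<longleftrightarrow>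
     (\<forall>F\<in>hs_functions S. T F \<in> hs_functions S) \<and>
     (\<exists>a N.
        (\<forall>n\<le>N. (\<forall>w. linear_form_on (tensor_power S n) (a n w)) \<and>
                smooth_map S (tensor_power S n) (tensor_norm S n) (a n)) \<and>
        (\<forall>F\<in>hs_functions S. \<forall>w. T F w = (\<Sum>n\<le>N. a n w (nth_deriv n F w))))"

definition vanishes_on_constants :: "(('w \<Rightarrow> 'k::zero) \<Rightarrow> ('w \<Rightarrow> 'k)) \<Rightarrow> bool" where
  "vanishes_on_constants T \<longleftrightarrow> (\<forall>c. T (\<lambda>_. c) = (\<lambda>_. 0))"


section \<open>Star products of exponential type\<close>

definition bounded_operators ::
  "('k::real_or_complex, 'h::banach, 'd::banach) phase_data \<Rightarrow> ('h \<Rightarrow>\<^sub>L 'h) set" where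
  "bounded_operators S = {A. \<forall>c x. blinfun_apply A (scaleH S c x) = scaleH S c (blinfun_apply A x)}"

definition hilbert_schmidt_operators ::
  "('k::real_or_complex, 'h::banach, 'd::banach) phase_data \<Rightarrow> ('h \<Rightarrow>\<^sub>L 'h) set" where
  "hilbert_schmidt_operators S =
     {A \<in> bounded_operators S. summable (\<lambda>i. (norm (blinfun_apply A (basis S i)))\<^sup>2)}"

text \<open>
  The two components of a functional \<open>u\<close> on \<open>W\<close>, in the dual of \<open>'h\<close> and (by reflexivity) in \<open>'h\<close>.
  For \<open>u = DF(w)\<close> they are the partial derivatives \<open>D\<^sub>1F(w)\<close> and \<open>D\<^sub>2F(w)\<close>.
\<close>

definition dual_part ::
  "('k::real_or_complex, 'h::banach, 'd::banach) phase_data \<Rightarrow> ('h \<times> 'd \<Rightarrow> 'k) \<Rightarrow> 'd" where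
  "dual_part S u = (THE \<xi>. \<forall>x. pairing S \<xi> x = u (x, 0))"

definition vector_part ::
  "('k::real_or_complex, 'h::banach, 'd::banach) phase_data \<Rightarrow> ('h \<times> 'd \<Rightarrow> 'k) \<Rightarrow> 'h" where
  "vector_part S u = (THE y. \<forall>\<eta>. pairing S \<eta> y = u (0, \<eta>))"

definition bform ::
  "('k::real_or_complex, 'h::banach, 'd::banach) phase_data \<Rightarrow> ('h \<Rightarrow>\<^sub>L 'h)
     \<Rightarrow> ('h \<times> 'd \<Rightarrow> 'k) \<Rightarrow> ('h \<times> 'd \<Rightarrow> 'k) \<Rightarrow> 'k" where
  "bform S A u v =
     pairing S (dual_part S u) (blinfun_apply (A + id_blinfun) (vector_part S v)) +
     pairing S (dual_part S v) (blinfun_apply (A - id_blinfun) (vector_part S u))"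

definition bounded_bilinear_form ::
  "('k::real_or_complex, 'h::banach, 'd::banach) phase_data \<Rightarrow> nat
     \<Rightarrow> ((('h \<times> 'd) list \<Rightarrow> 'k) \<Rightarrow> (('h \<times> 'd) list \<Rightarrow> 'k) \<Rightarrow> 'k) \<Rightarrow> bool" where
  "bounded_bilinear_form S r b \<longleftrightarrow>
     (\<forall>t\<in>tensor_power S r. linear_form_on (tensor_power S r) (\<lambda>s. b s t)) \<and>
     (\<forall>s\<in>tensor_power S r. linear_form_on (tensor_power S r) (\<lambda>t. b s t)) \<and>
     (\<exists>C. \<forall>s\<in>tensor_power S r. \<forall>t\<in>tensor_power S r.
        norm (b s t) \<le> C * tensor_norm S r s * tensor_norm S r t)"

text \<open>The value \<open>0\<close> outside the tensor power only serves to make the function unique.\<close>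

definition bform_power ::
  "('k::real_or_complex, 'h::banach, 'd::banach) phase_data \<Rightarrow> ('h \<Rightarrow>\<^sub>L 'h) \<Rightarrow> nat
     \<Rightarrow> (('h \<times> 'd) list \<Rightarrow> 'k) \<Rightarrow> (('h \<times> 'd) list \<Rightarrow> 'k) \<Rightarrow> 'k" where
  "bform_power S A r = (THE b.
     bounded_bilinear_form S r b \<and>
     (\<forall>us vs. length us = r \<and> length vs = r \<and> set us \<subseteq> dualW S \<and> set vs \<subseteq> dualW S \<longrightarrow>
        b (pure_tensor us) (pure_tensor vs) = (\<Prod>k<r. bform S A (us ! k) (vs ! k))) \<and>
     (\<forall>s t. s \<notin> tensor_power S r \<or> t \<notin> tensor_power S r \<longrightarrow> b s t = 0))"

definition cochain ::
  "('k::real_or_complex, 'h::banach, 'd::banach) phase_data \<Rightarrow> ('h \<Rightarrow>\<^sub>L 'h) \<Rightarrow> nat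
     \<Rightarrow> ('h \<times> 'd \<Rightarrow> 'k) \<Rightarrow> ('h \<times> 'd \<Rightarrow> 'k) \<Rightarrow> 'h \<times> 'd \<Rightarrow> 'k" where
  "cochain S A r F G w =
     (if r = 0 then F w * G w else bform_power S A r (nth_deriv r F w) (nth_deriv r G w))"

text \<open>Formal power series in \<open>\<hbar>\<close> whose coefficients are functions of Hilbert-Schmidt type.\<close>

definition hs_series ::
  "('k::real_or_complex, 'h::banach, 'd::banach) phase_data \<Rightarrow> ('h \<times> 'd \<Rightarrow> 'k) fps set" where
  "hs_series S = {f. \<forall>n. fps_nth f n \<in> hs_functions S}"

definition series_of :: "('w \<Rightarrow> 'k::zero) \<Rightarrow> ('w \<Rightarrow> 'k) fps" where
  "series_of F = Abs_fps (\<lambda>n. if n = 0 then F else (\<lambda>_. 0))"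

definition star ::
  "('k::real_or_complex, 'h::banach, 'd::banach) phase_data \<Rightarrow> ('h \<Rightarrow>\<^sub>L 'h)
     \<Rightarrow> ('h \<times> 'd \<Rightarrow> 'k) fps \<Rightarrow> ('h \<times> 'd \<Rightarrow> 'k) fps \<Rightarrow> ('h \<times> 'd \<Rightarrow> 'k) fps" where
  "star S A = (\<lambda>f\<in>hs_series S. \<lambda>g\<in>hs_series S. Abs_fps (\<lambda>n w.
     \<Sum>r\<le>n. \<Sum>i\<le>n - r. cochain S A r (fps_nth f i) (fps_nth g (n - r - i)) w / fact r))"


section \<open>Equivalence\<close>

text \<open>The action of \<open>Id + \<Sum>r\<ge>1. \<hbar>^r T\<^sub>r\<close> on formal power series; \<open>T 0\<close> is not used.\<close>

definition formal_operator ::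
  "(nat \<Rightarrow> ('w \<Rightarrow> 'k::comm_monoid_add) \<Rightarrow> ('w \<Rightarrow> 'k)) \<Rightarrow> ('w \<Rightarrow> 'k) fps \<Rightarrow> ('w \<Rightarrow> 'k) fps" where
  "formal_operator T f =
     Abs_fps (\<lambda>n w. fps_nth f n w + (\<Sum>r=1..n. T r (fps_nth f (n - r)) w))"

text \<open>The deformation quantizations compared here differ only in their products.\<close>

definition equivalent_products ::
  "('k::real_or_complex, 'h::banach, 'd::banach) phase_data
     \<Rightarrow> (('h \<times> 'd \<Rightarrow> 'k) fps \<Rightarrow> ('h \<times> 'd \<Rightarrow> 'k) fps \<Rightarrow> ('h \<times> 'd \<Rightarrow> 'k) fps)
     \<Rightarrow> (('h \<times> 'd \<Rightarrow> 'k) fps \<Rightarrow> ('h \<times> 'd \<Rightarrow> 'k) fps \<Rightarrow> ('h \<times> 'd \<Rightarrow> 'k) fps) \<Rightarrow> bool" where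
  "equivalent_products S star1 star2 \<longleftrightarrow>
     (\<exists>T. (\<forall>r\<ge>1. differential_operator S (T r) \<and> vanishes_on_constants (T r)) \<and>
          (\<forall>F\<in>hs_functions S. \<forall>G\<in>hs_functions S.
             star1 (formal_operator T (series_of F)) (formal_operator T (series_of G))
               = formal_operator T (star2 (series_of F) (series_of G))))"

definition star_products ::
  "('k::real_or_complex, 'h::banach, 'd::banach) phase_data
     \<Rightarrow> (('h \<times> 'd \<Rightarrow> 'k) fps \<Rightarrow> ('h \<times> 'd \<Rightarrow> 'k) fps \<Rightarrow> ('h \<times> 'd \<Rightarrow> 'k) fps) set" where
  "star_products S = star S ` bounded_operators S"

definition equivalence_rel ::
  "('k::real_or_complex, 'h::banach, 'd::banach) phase_data
     \<Rightarrow> (('h \<times> 'd \<Rightarrow> 'k) fps \<Rightarrow> ('h \<times> 'd \<Rightarrow> 'k) fps \<Rightarrow> ('h \<times> 'd \<Rightarrow> 'k) fps) rel" where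
  "equivalence_rel S = {(star1, star2). star1 \<in> star_products S \<and> star2 \<in> star_products S \<and>
     equivalent_products S star1 star2}"

definition hs_congruence ::
  "('k::real_or_complex, 'h::banach, 'd::banach) phase_data \<Rightarrow> ('h \<Rightarrow>\<^sub>L 'h) rel" where
  "hs_congruence S = {(A, B). A \<in> bounded_operators S \<and> B \<in> bounded_operators S \<and>
     A - B \<in> hilbert_schmidt_operators S}"

end

theory Submission
  imports Defs
begin

text \<open>
  Put \<open>D = A - B\<close>. If \<open>D\<close> is Hilbert-Schmidt, the operator \<open>lap D F = \<Sum>\<^sub>j \<partial>(D e\<^sub>j, 0) \<partial>(0, e\<^sub>j\<^sup>*) F\<close> acts on
  functions of Hilbert-Schmidt type, because it contracts the second derivative with a Hilbert-Schmidt
  tensor, and its failure to be a derivation is exactly the bidifferential operator with symbol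
  \<open>b\<^sub>A - b\<^sub>B\<close>. All these operators have constant coefficients and commute, hence
  \<open>T = exp (\<hbar> lap D)\<close> is an equivalence.
  Conversely, the coefficient of \<open>\<hbar>\<close> in an equivalence \<open>T\<close>, applied to products \<open>x\<^sub>i \<eta>\<^sub>j\<close> of coordinates at
  \<open>0\<close>, gives \<open>\<langle>e\<^sub>i\<^sup>*, D e\<^sub>j\<rangle> = a\<^sub>2(e\<^sub>i\<^sup>* \<or> e\<^sub>j)\<close>, where the second order part \<open>a\<^sub>2\<close> of \<open>T\<^sub>1\<close> is bounded in the
  Hilbert-Schmidt norm; so the matrix of \<open>D\<close> is square summable.
\<close>

section \<open>Orthonormal bases and duality\<close>

text \<open>Bounded A suffices for the products, while \<open>lap D\<close> needs D Hilbert-Schmidt;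
  the reason is where square summability comes from. A term of a product contracts slots of two
  different derivatives, so each argument supplies one square summable factor and the operator costs
  only its norm. \<open>lap D\<close> contracts two slots of one derivative, which supplies a single
  factor, and D has to supply the other. All sums over the basis are infinite, so every interchange
  of a sum with a derivative, with \<open>lap D\<close> or with another sum has to be justified. The
  tool is a local bound on Hilbert-Schmidt norms of every order, uniform over finite partial sums:
  it controls Taylor remainders uniformly and survives all operators in play. The difference of
  \<open>bform S A\<close> and \<open>bform S B\<close> is symmetric because the identity parts
  cancel; this is why it can be the failure of a second order operator to be a derivation. The power
  of \<open>bform S A\<close> is a definite description. It is identified with an iterated
  contraction, whose estimates come from peeling off one slot at a time and whose uniqueness comes
  from the density of basis tensors.\<close>

lemma has_sum_norm_le:
  fixes f :: "'a \<Rightarrow> 'b::real_normed_vector"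
  assumes "(f has_sum s) A" and "\<And>X. finite X \<Longrightarrow> X \<subseteq> A \<Longrightarrow> norm (sum f X) \<le> B"
  shows "norm s \<le> B"
proof (rule Lim_norm_ubound)
  show "(sum f \<longlongrightarrow> s) (finite_subsets_at_top A)"
    using assms(1) by (simp add: has_sum_def)
  show "eventually (\<lambda>X. norm (sum f X) \<le> B) (finite_subsets_at_top A)"
    by (rule eventually_finite_subsets_at_top_weakI) (use assms(2) in auto)
qed simp

lemma norm_sum_mult_le:
  fixes a b :: "'a \<Rightarrow> 'k::real_normed_field"
  shows "norm (\<Sum>i\<in>N. a i * b i) \<le> L2_set (\<lambda>i. norm (a i)) N * L2_set (\<lambda>i. norm (b i)) N"
proof -
  have "norm (\<Sum>i\<in>N. a i * b i) \<le> (\<Sum>i\<in>N. \<bar>norm (a i)\<bar> * \<bar>norm (b i)\<bar>)"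
    by (rule order_trans[OF norm_sum]) (simp add: norm_mult)
  also have "\<dots> \<le> L2_set (\<lambda>i. norm (a i)) N * L2_set (\<lambda>i. norm (b i)) N"
    by (rule L2_set_mult_ineq)
  finally show ?thesis .
qed

lemma L2_set_le_iff: "0 \<le> C \<Longrightarrow> L2_set f N \<le> C \<longleftrightarrow> (\<Sum>i\<in>N. (f i)\<^sup>2) \<le> C\<^sup>2"
  by (metis L2_set_def real_sqrt_le_iff real_sqrt_abs abs_of_nonneg)

text \<open>Closes the duality arguments below: a functional tested on the vector built from its own
  conjugated coefficients gives \<open>s \<le> C * sqrt s\<close> for the square sum s, which may
  vanish.\<close>

lemma le_square_of_le_mult_sqrt:
  assumes "0 \<le> s" "0 \<le> C" "s \<le> C * sqrt s"
  shows "s \<le> C\<^sup>2"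
proof (cases "s = 0")
  case False
  have "sqrt s * sqrt s \<le> C * sqrt s" using assms by simp
  then have "sqrt s \<le> C" by (rule mult_right_le_imp_le) (use False assms in simp)
  then show ?thesis by (rule sqrt_le_D)
qed (use assms in simp)

lemma vector_space_field: "vector_space ((*) :: 'a::field \<Rightarrow> 'a \<Rightarrow> 'a)"
  by unfold_locales (auto simp: algebra_simps)

lemma kconj_zero: "kconj (0::'a::real_or_complex) = 0"
  using kconj_add[of "0::'a" 0] by simp

lemma mult_kconj_of_real: "x * kconj x = of_real ((norm (x::'a::real_or_complex))\<^sup>2)"
  by (simp add: mult_kconj scaleR_conv_of_real)

lemma norm_kconj: "norm (kconj x) = norm (x::'a::real_or_complex)"
proof (cases "x = 0")
  case False
  have "norm x * norm (kconj x) = norm x * norm x"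
    using arg_cong[OF mult_kconj[of x], of norm] by (simp add: norm_mult power2_eq_square)
  then show ?thesis using False by simp
qed (simp add: kconj_zero)

lemma sum_bool_split:
  assumes "finite N"
  shows "sum f N = (\<Sum>i\<in>Pair False -` N. f (False, i)) + (\<Sum>i\<in>Pair True -` N. f (True, i))"
proof -
  have *: "N = Pair False ` (Pair False -` N) \<union> Pair True ` (Pair True -` N)" (is "_ = ?A \<union> ?B")
  proof (rule set_eqI)
    fix x :: "bool \<times> 'a"
    show "x \<in> N \<longleftrightarrow> x \<in> ?A \<union> ?B" by (cases x; cases "fst x") auto
  qed
  have fin: "finite (Pair b -` N)" for b
    by (rule finite_vimageI[OF assms]) (auto simp: inj_on_def)
  have "sum f N = sum f ?A + sum f ?B"
    by (subst *, rule sum.union_disjoint) (auto simp: fin simp del: image_vimage_eq)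
  also have "sum f ?A = (\<Sum>i\<in>Pair False -` N. f (False, i))"
    by (subst sum.reindex) (auto simp: inj_on_def)
  also have "sum f ?B = (\<Sum>i\<in>Pair True -` N. f (True, i))"
    by (subst sum.reindex) (auto simp: inj_on_def)
  finally show ?thesis .
qed

lemma has_sum_bool_split:
  fixes f :: "bool \<times> 'a \<Rightarrow> 'b::topological_comm_monoid_add"
  assumes "((\<lambda>i. f (False, i)) has_sum a) UNIV" "((\<lambda>i. f (True, i)) has_sum b) UNIV"
  shows "(f has_sum (a + b)) UNIV"
proof -
  have h: "(f has_sum s) (range (Pair c))" if "((\<lambda>i. f (c, i)) has_sum s) UNIV" for c s
    by (subst has_sum_reindex) (use that in \<open>auto simp: inj_on_def o_def\<close>)
  have "(f has_sum (a + b)) (range (Pair False) \<union> range (Pair True))"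
    by (rule has_sum_Un_disjoint[OF h h]) (use assms in auto)
  moreover have "range (Pair False) \<union> range (Pair True) = (UNIV :: (bool \<times> 'a) set)"
  proof (rule set_eqI)
    fix x :: "bool \<times> 'a"
    show "x \<in> range (Pair False) \<union> range (Pair True) \<longleftrightarrow> x \<in> UNIV"
      by (cases x; cases "fst x") auto
  qed
  ultimately show ?thesis by simp
qed

locale phase_space =
  fixes S :: "('k::real_or_complex, 'h::banach, 'd::banach) phase_data"
  assumes hilbert: "hilbert_space S" and dual: "dual_space S" and onb: "orthonormal_basis S"
begin

abbreviation e :: "nat \<Rightarrow> 'h" where "e \<equiv> basis S"
abbreviation de :: "nat \<Rightarrow> 'd" where "de \<equiv> dual_basis S"
abbreviation eW :: "bool \<times> nat \<Rightarrow> 'h \<times> 'd" where "eW \<equiv> case_prod (basisW S)"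

sublocale H: vector_space "scaleH S"
  using hilbert by (simp add: hilbert_space_def)

sublocale D: vector_space "scaleD S"
  using dual by (simp add: dual_space_def)

sublocale W: vector_space "scaleW S"
  by unfold_locales
    (auto simp: scaleW_def H.scale_right_distrib H.scale_left_distrib D.scale_right_distrib
      D.scale_left_distrib prod_eq_iff)

lemma scaleH_of_real: "scaleH S (of_real r) x = r *\<^sub>R x"
  using hilbert by (simp add: hilbert_space_def)

lemma scaleD_of_real: "scaleD S (of_real r) x = r *\<^sub>R x"
  using dual by (simp add: dual_space_def)

lemma scaleW_of_real: "scaleW S (of_real r) w = r *\<^sub>R w"
  by (simp add: scaleW_def scaleH_of_real scaleD_of_real prod_eq_iff)

lemma linear_ip: "Vector_Spaces.linear (scaleH S) (*) (ip S x)"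
  using hilbert by (simp add: hilbert_space_def)

lemma ip_commute: "ip S y x = kconj (ip S x y)"
  using hilbert unfolding hilbert_space_def by blast

lemma ip_self: "ip S x x = of_real ((norm x)\<^sup>2)"
  using hilbert unfolding hilbert_space_def by blast

lemma ip_add: "ip S x (y + z) = ip S x y + ip S x z"
  and ip_scale: "ip S x (scaleH S c y) = c * ip S x y"
  using linear_ip[of x] by (auto simp: Vector_Spaces.linear_iff)

lemma ip_add_left: "ip S (y + z) x = ip S y x + ip S z x"
  by (metis ip_add ip_commute kconj_add)

lemma ip_zero: "ip S x 0 = 0" "ip S 0 x = 0"
  using ip_add[of x 0 0] ip_add_left[of 0 0 x] by simp_all

lemma ip_diff: "ip S x (y - z) = ip S x y - ip S x z"
  by (metis ip_add add_diff_cancel_right' diff_add_cancel)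

lemma ip_sum: "ip S x (\<Sum>i\<in>N. f i) = (\<Sum>i\<in>N. ip S x (f i))"
  by (induction N rule: infinite_finite_induct) (auto simp: ip_add ip_zero)

lemma ip_basis: "ip S (e i) (e j) = (if i = j then 1 else 0)"
  using onb by (simp add: orthonormal_basis_def)

section \<open>Bessel's inequality, basis expansion and Parseval\<close>

lemma ip_basis_sum:
  "finite N \<Longrightarrow> ip S (e j) (\<Sum>i\<in>N. scaleH S (c i) (e i)) = (if j \<in> N then c j else 0)"
  by (simp add: ip_sum ip_scale ip_basis if_distrib[of "\<lambda>x. c _ * x"] cong: if_cong)

text \<open>Pythagoras. With \<open>r = 0\<close> it computes the norm of a combination; with r the
  residual of a projection it yields Bessel's inequality.\<close>

lemma norm_add_orthogonal:
  assumes "finite N" "\<And>i. i \<in> N \<Longrightarrow> ip S (e i) r = 0"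
  shows "(norm (r + (\<Sum>i\<in>N. scaleH S (b i) (e i))))\<^sup>2 = (norm r)\<^sup>2 + (\<Sum>i\<in>N. (norm (b i))\<^sup>2)"
proof -
  let ?l = "\<Sum>i\<in>N. scaleH S (b i) (e i)"
  have re: "ip S r (e i) = 0" if "i \<in> N" for i
    using assms(2)[OF that] ip_commute[of r "e i"] by (simp add: kconj_zero)
  have "ip S r ?l = 0"
    by (simp add: ip_sum ip_scale re)
  moreover from this have "ip S ?l r = 0"
    using ip_commute[of ?l r] by (simp add: kconj_zero)
  moreover have "ip S ?l ?l = of_real (\<Sum>i\<in>N. (norm (b i))\<^sup>2)"
  proof -
    have "ip S ?l ?l = (\<Sum>i\<in>N. b i * ip S ?l (e i))"
      by (simp add: ip_sum ip_scale)
    also have "\<dots> = (\<Sum>i\<in>N. b i * kconj (b i))"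
      by (rule sum.cong[OF refl]) (simp add: ip_commute[of ?l] ip_basis_sum[OF assms(1)])
    finally show ?thesis by (simp add: mult_kconj_of_real)
  qed
  ultimately have "of_real ((norm (r + ?l))\<^sup>2) = (of_real ((norm r)\<^sup>2 + (\<Sum>i\<in>N. (norm (b i))\<^sup>2)) :: 'k)"
    unfolding ip_self[symmetric] of_real_add by (simp add: ip_add ip_add_left)
  then show ?thesis by (simp only: of_real_eq_iff)
qed

lemma norm_basis_sum:
  "finite N \<Longrightarrow> (norm (\<Sum>i\<in>N. scaleH S (b i) (e i)))\<^sup>2 = (\<Sum>i\<in>N. (norm (b i))\<^sup>2)"
  using norm_add_orthogonal[of N 0 b] by (simp add: ip_zero)

lemma norm_diff_projection:
  assumes "finite N"
  shows "(norm x)\<^sup>2 = (norm (x - (\<Sum>i\<in>N. scaleH S (ip S (e i) x) (e i))))\<^sup>2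
    + (\<Sum>i\<in>N. (norm (ip S (e i) x))\<^sup>2)"
  using norm_add_orthogonal[OF assms, of "x - (\<Sum>i\<in>N. scaleH S (ip S (e i) x) (e i))" "\<lambda>i. ip S (e i) x"]
  by (simp add: ip_diff ip_basis_sum[OF assms])

lemma bessel_ineq: "finite N \<Longrightarrow> (\<Sum>i\<in>N. (norm (ip S (e i) x))\<^sup>2) \<le> (norm x)\<^sup>2"
  using norm_diff_projection[of N x] by simp

lemma norm_ip_basis_le: "norm (ip S (e i) x) \<le> norm x"
  by (rule power2_le_imp_le) (use bessel_ineq[of "{i}" x] in auto)

text \<open>On the span the partial sums are eventually constant. All finite sets above N are
  covered because the expansion is an unordered sum, a limit along finite sets.\<close>

lemma span_eventually_projection:
  assumes "y \<in> H.span (range e)"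
  shows "\<exists>N. finite N \<and> (\<forall>M. finite M \<longrightarrow> N \<subseteq> M \<longrightarrow> (\<Sum>i\<in>M. scaleH S (ip S (e i) y) (e i)) = y)"
  using assms
proof (induction rule: H.span_induct_alt)
  case base
  then show ?case by (intro exI[of _ "{}"]) (simp add: ip_zero)
next
  case (step c x y)
  obtain j where x: "x = e j" using step by blast
  obtain N where N: "finite N" "\<And>M. finite M \<Longrightarrow> N \<subseteq> M \<Longrightarrow> (\<Sum>i\<in>M. scaleH S (ip S (e i) y) (e i)) = y"
    using step by blast
  show ?case
  proof (intro exI[of _ "insert j N"] conjI allI impI)
    fix M assume M: "finite M" "insert j N \<subseteq> M"
    have "(\<Sum>i\<in>M. scaleH S (ip S (e i) (scaleH S c x + y)) (e i))
        = (\<Sum>i\<in>M. scaleH S (ip S (e i) (scaleH S c x)) (e i)) + (\<Sum>i\<in>M. scaleH S (ip S (e i) y) (e i))"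
      by (simp add: ip_add H.scale_left_distrib sum.distrib)
    also have "(\<Sum>i\<in>M. scaleH S (ip S (e i) y) (e i)) = y"
      using N(2)[of M] M by auto
    also have "(\<Sum>i\<in>M. scaleH S (ip S (e i) (scaleH S c x)) (e i)) = (\<Sum>i\<in>M. if i = j then scaleH S c x else 0)"
      by (rule sum.cong) (auto simp: x ip_scale ip_basis)
    also have "\<dots> = scaleH S c x" using M by simp
    finally show "(\<Sum>i\<in>M. scaleH S (ip S (e i) (scaleH S c x + y)) (e i)) = scaleH S c x + y" .
  qed (use N in auto)
qed

lemma basis_expansion: "((\<lambda>i. scaleH S (ip S (e i) x) (e i)) has_sum x) UNIV"
  unfolding has_sum_def tendsto_iff
proof (intro allI impI)
  fix \<epsilon> :: real assume "\<epsilon> > 0"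
  have "x \<in> closure (H.span (range e))"
    using onb by (simp add: orthonormal_basis_def)
  then obtain y where y: "y \<in> H.span (range e)" "dist y x < \<epsilon>"
    using \<open>\<epsilon> > 0\<close> closure_approachable by blast
  obtain N where N: "finite N" "\<And>M. finite M \<Longrightarrow> N \<subseteq> M \<Longrightarrow> (\<Sum>i\<in>M. scaleH S (ip S (e i) y) (e i)) = y"
    using span_eventually_projection[OF y(1)] by blast
  show "\<forall>\<^sub>F M in finite_subsets_at_top UNIV. dist (\<Sum>i\<in>M. scaleH S (ip S (e i) x) (e i)) x < \<epsilon>"
    unfolding eventually_finite_subsets_at_top
  proof (intro exI[of _ N] conjI allI impI)
    fix M assume M: "finite M \<and> N \<subseteq> M \<and> M \<subseteq> UNIV"
    \<comment> \<open>The projection fixes y, so x minus its projection equals x - y minus the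
      projection of x - y, and a residual is never longer than the vector.\<close>
    have "(\<Sum>i\<in>M. scaleH S (ip S (e i) (x - y)) (e i)) = (\<Sum>i\<in>M. scaleH S (ip S (e i) x) (e i)) - y"
      using N(2)[of M] M by (simp add: ip_diff H.scale_left_diff_distrib sum_subtractf)
    moreover have "(norm (x - y - (\<Sum>i\<in>M. scaleH S (ip S (e i) (x - y)) (e i))))\<^sup>2 \<le> (norm (x - y))\<^sup>2"
      using norm_diff_projection[of M "x - y"] M by (simp add: sum_nonneg)
    ultimately have "norm (x - (\<Sum>i\<in>M. scaleH S (ip S (e i) x) (e i))) \<le> norm (x - y)"
      by (intro power2_le_imp_le[of "norm (x - sum _ _)"]) (simp_all add: algebra_simps)
    then show "dist (\<Sum>i\<in>M. scaleH S (ip S (e i) x) (e i)) x < \<epsilon>"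
      using y(2) by (simp add: dist_norm norm_minus_commute)
  qed (use N in auto)
qed

lemma parseval: "((\<lambda>i. (norm (ip S (e i) x))\<^sup>2) has_sum (norm x)\<^sup>2) UNIV"
proof -
  have "((\<lambda>M. (norm (\<Sum>i\<in>M. scaleH S (ip S (e i) x) (e i)))\<^sup>2) \<longlongrightarrow> (norm x)\<^sup>2) (finite_subsets_at_top UNIV)"
    using basis_expansion[of x] unfolding has_sum_def by (intro tendsto_intros)
  then show ?thesis unfolding has_sum_def
    by (rule Lim_transform_eventually) (rule eventually_finite_subsets_at_top_weakI, simp add: norm_basis_sum)
qed

section \<open>The dual space and its basis\<close>

lemma pairing_linear: "bounded_linear (pairing S \<eta>)"
    "Vector_Spaces.linear (scaleH S) (*) (pairing S \<eta>)"
    "Vector_Spaces.linear (scaleD S) (*) (\<lambda>\<eta>. pairing S \<eta> x)"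
  using dual unfolding dual_space_def by blast+

lemma pairing_add: "pairing S \<eta> (x + y) = pairing S \<eta> x + pairing S \<eta> y"
  and pairing_scale: "pairing S \<eta> (scaleH S c x) = c * pairing S \<eta> x"
  and pairing_add_left: "pairing S (\<eta> + \<zeta>) x = pairing S \<eta> x + pairing S \<zeta> x"
  and pairing_scale_left: "pairing S (scaleD S c \<eta>) x = c * pairing S \<eta> x"
  using pairing_linear(2)[of \<eta>] pairing_linear(3)[of x] by (auto simp: Vector_Spaces.linear_iff)

lemma pairing_zero_left: "pairing S 0 x = 0"
  using pairing_add_left[of 0 0 x] by simp

lemma pairing_diff_left: "pairing S (\<eta> - \<zeta>) x = pairing S \<eta> x - pairing S \<zeta> x"
  by (metis pairing_add_left add_diff_cancel_right' diff_add_cancel)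

lemma pairing_sum_left: "pairing S (\<Sum>i\<in>N. f i) x = (\<Sum>i\<in>N. pairing S (f i) x)"
  by (induction N rule: infinite_finite_induct) (auto simp: pairing_add_left pairing_zero_left)

lemma pairing_sum: "pairing S \<eta> (\<Sum>i\<in>N. f i) = (\<Sum>i\<in>N. pairing S \<eta> (f i))"
  using bounded_linear.linear[OF pairing_linear(1)] by (rule linear_sum)

lemma norm_dual: "norm \<eta> = onorm (pairing S \<eta>)"
  using dual unfolding dual_space_def by blast

lemma norm_pairing_le: "norm (pairing S \<eta> x) \<le> norm \<eta> * norm x"
  using onorm[OF pairing_linear(1)] norm_dual by simp

lemma pairing_eqI: "(\<And>x. pairing S \<eta> x = pairing S \<zeta> x) \<Longrightarrow> \<eta> = \<zeta>"
proof -
  assume "\<And>x. pairing S \<eta> x = pairing S \<zeta> x"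
  then have "pairing S (\<eta> - \<zeta>) = (\<lambda>_. 0)" by (auto simp: pairing_diff_left)
  then have "norm (\<eta> - \<zeta>) = 0" by (simp only: norm_dual onorm_zero)
  then show ?thesis by simp
qed

lemma dual_surj:
  assumes "bounded_linear f" "Vector_Spaces.linear (scaleH S) (*) f"
  obtains \<eta> where "pairing S \<eta> = f"
  using dual assms unfolding dual_space_def by blast

lemma bounded_linearI_K:
  assumes "\<And>x y. f (x + y) = f x + (f y :: 'k)" "\<And>c x. f (scaleH S c x) = c * f x"
    and "\<And>x. norm (f x) \<le> norm x * C"
  shows "bounded_linear f"
proof (rule bounded_linear_intro)
  show "f (r *\<^sub>R x) = r *\<^sub>R f x" for r x
    using assms(2)[of "of_real r" x] by (simp add: scaleH_of_real scaleR_conv_of_real)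
qed (use assms in auto)

lemma bounded_linear_ip_basis: "bounded_linear (ip S (e i))"
  by (rule bounded_linearI_K[where C = 1]) (auto simp: ip_add ip_scale norm_ip_basis_le)

lemma pairing_dual_basis: "pairing S (de i) x = ip S (e i) x"
proof -
  obtain \<eta> where \<eta>: "pairing S \<eta> = ip S (e i)"
    using dual_surj[OF bounded_linear_ip_basis linear_ip] by blast
  have "\<forall>x. pairing S (de i) x = ip S (e i) x"
    unfolding dual_basis_def
  proof (rule theI)
    show "\<forall>x. pairing S \<eta> x = ip S (e i) x" by (simp add: \<eta>)
    show "\<zeta> = \<eta>" if "\<forall>x. pairing S \<zeta> x = ip S (e i) x" for \<zeta>
      using that \<eta> by (auto intro: pairing_eqI)
  qed
  then show ?thesis by blast
qed

lemma pairing_expansion: "((\<lambda>i. ip S (e i) x * pairing S \<eta> (e i)) has_sum pairing S \<eta> x) UNIV"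
  using has_sum_bounded_linear[OF pairing_linear(1) basis_expansion, of \<eta> x]
  by (simp add: o_def pairing_scale)

text \<open>The data give no inner product on the dual, so its Hilbert norm is recovered from values
  on the basis: by Cauchy-Schwarz the norm is at most the l2 norm of these values, and
  \<open>sum_pairing_basis_le\<close> is the converse.\<close>

lemma norm_dual_le:
  assumes "0 \<le> C" and "\<And>N. finite N \<Longrightarrow> (\<Sum>i\<in>N. (norm (pairing S \<eta> (e i)))\<^sup>2) \<le> C\<^sup>2"
  shows "norm \<eta> \<le> C"
  unfolding norm_dual
proof (rule onorm_bound)
  fix x
  have "norm (\<Sum>i\<in>N. ip S (e i) x * pairing S \<eta> (e i)) \<le> norm x * C" if "finite N" for N
  proof -
    have "L2_set (\<lambda>i. norm (ip S (e i) x)) N \<le> norm x"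
      using bessel_ineq[OF that] by (simp add: L2_set_le_iff)
    moreover have "L2_set (\<lambda>i. norm (pairing S \<eta> (e i))) N \<le> C"
      using assms that by (simp add: L2_set_le_iff)
    ultimately show ?thesis
      by (intro order_trans[OF norm_sum_mult_le] mult_mono) auto
  qed
  then show "norm (pairing S \<eta> x) \<le> C * norm x"
    using has_sum_norm_le[OF pairing_expansion] by (simp add: mult.commute)
qed (use assms in simp)

lemma sum_pairing_basis_le:
  assumes "finite N"
  shows "(\<Sum>i\<in>N. (norm (pairing S \<eta> (e i)))\<^sup>2) \<le> (norm \<eta>)\<^sup>2"
proof -
  define s where "s = (\<Sum>i\<in>N. (norm (pairing S \<eta> (e i)))\<^sup>2)"
  \<comment> \<open>The conjugated coefficients make the value at z the square sum itself, while the
    norm of z is only its root.\<close>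
  define z where "z = (\<Sum>i\<in>N. scaleH S (kconj (pairing S \<eta> (e i))) (e i))"
  have s0: "s \<ge> 0" by (simp add: s_def sum_nonneg)
  have "(norm z)\<^sup>2 = s" unfolding z_def s_def by (simp add: norm_basis_sum[OF assms] norm_kconj)
  then have z: "norm z = sqrt s" by (metis norm_ge_zero real_sqrt_unique)
  have "pairing S \<eta> z = of_real s"
    by (simp add: z_def s_def pairing_sum pairing_scale mult_kconj_of_real mult.commute)
  then have "s \<le> norm \<eta> * sqrt s"
    using norm_pairing_le[of \<eta> z] z s0 by simp
  then show ?thesis using s0 unfolding s_def[symmetric] by (intro le_square_of_le_mult_sqrt) auto
qed

lemma norm_dual_basis_sum:
  assumes "finite N"
  shows "(norm (\<Sum>i\<in>N. scaleD S (c i) (de i)))\<^sup>2 \<le> (\<Sum>i\<in>N. (norm (c i))\<^sup>2)"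
proof -
  have v: "pairing S (\<Sum>i\<in>N. scaleD S (c i) (de i)) (e j) = (if j \<in> N then c j else 0)" for j
    using assms by (simp add: pairing_sum_left pairing_scale_left pairing_dual_basis ip_basis
        if_distrib[of "\<lambda>x. c _ * x"] cong: if_cong)
  have "norm (\<Sum>i\<in>N. scaleD S (c i) (de i)) \<le> sqrt (\<Sum>i\<in>N. (norm (c i))\<^sup>2)"
  proof (rule norm_dual_le)
    fix M :: "nat set" assume M: "finite M"
    have "(\<Sum>i\<in>M. (norm (pairing S (\<Sum>i\<in>N. scaleD S (c i) (de i)) (e i)))\<^sup>2)
        = (\<Sum>i\<in>M. if i \<in> N then (norm (c i))\<^sup>2 else 0)"
      by (rule sum.cong) (auto simp: v)
    also have "\<dots> = (\<Sum>i\<in>M \<inter> N. (norm (c i))\<^sup>2)"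
      using M by (simp add: sum.inter_restrict)
    also have "\<dots> \<le> (\<Sum>i\<in>N. (norm (c i))\<^sup>2)"
      by (rule sum_mono2) (use assms in auto)
    finally show "(\<Sum>i\<in>M. (norm (pairing S (\<Sum>i\<in>N. scaleD S (c i) (de i)) (e i)))\<^sup>2)
        \<le> (sqrt (\<Sum>i\<in>N. (norm (c i))\<^sup>2))\<^sup>2" by (simp add: sum_nonneg)
  qed (simp add: sum_nonneg)
  from power_mono[OF this norm_ge_zero, of 2] show ?thesis by (simp add: sum_nonneg)
qed

lemma dual_basis_expansion: "((\<lambda>i. scaleD S (pairing S \<eta> (e i)) (de i)) has_sum \<eta>) UNIV"
  unfolding has_sum_def tendsto_iff
proof (intro allI impI)
  fix \<epsilon> :: real assume "\<epsilon> > 0"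
  let ?f = "\<lambda>i. (norm (pairing S \<eta> (e i)))\<^sup>2"
  define T where "T = infsum ?f UNIV"
  have sm: "?f summable_on UNIV"
    by (rule nonneg_bdd_above_summable_on) (auto intro!: bdd_aboveI[of _ "(norm \<eta>)\<^sup>2"] sum_pairing_basis_le)
  \<comment> \<open>The residual vanishes on the basis vectors in M and agrees with \<eta> on the
    others, so its norm is at most the root of the tail of the square sum. Halving \<epsilon> makes
    the final bound strict.\<close>
  obtain N where N: "finite N" "dist (sum ?f N) T \<le> (\<epsilon>/2)\<^sup>2"
    using has_sum_finite_approximation[OF has_sum_infsum[OF sm], of "(\<epsilon>/2)\<^sup>2"] \<open>\<epsilon> > 0\<close> by (auto simp: T_def)
  have le: "sum ?f P \<le> T" if "finite P" for P
    unfolding T_def by (rule finite_sum_le_infsum[OF sm]) (use that in auto)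
  show "\<forall>\<^sub>F M in finite_subsets_at_top UNIV. dist (\<Sum>i\<in>M. scaleD S (pairing S \<eta> (e i)) (de i)) \<eta> < \<epsilon>"
    unfolding eventually_finite_subsets_at_top
  proof (intro exI[of _ N] conjI allI impI)
    fix M assume M: "finite M \<and> N \<subseteq> M \<and> M \<subseteq> UNIV"
    have v: "pairing S (\<eta> - (\<Sum>i\<in>M. scaleD S (pairing S \<eta> (e i)) (de i))) (e j)
        = (if j \<in> M then 0 else pairing S \<eta> (e j))" for j
      using M by (simp add: pairing_diff_left pairing_sum_left pairing_scale_left pairing_dual_basis ip_basis
        if_distrib[of "\<lambda>x. _ * x"] cong: if_cong)
    have "norm (\<eta> - (\<Sum>i\<in>M. scaleD S (pairing S \<eta> (e i)) (de i))) \<le> \<epsilon>/2"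
    proof (rule norm_dual_le)
      fix P :: "nat set" assume P: "finite P"
      have "(\<Sum>i\<in>P. (norm (pairing S (\<eta> - (\<Sum>i\<in>M. scaleD S (pairing S \<eta> (e i)) (de i))) (e i)))\<^sup>2)
        = (\<Sum>i\<in>P. if i \<in> - M then ?f i else 0)"
        by (rule sum.cong) (auto simp: v)
      also have "\<dots> = sum ?f (P \<inter> - M)"
        using P by (simp add: sum.inter_restrict)
      also have "\<dots> = sum ?f ((P - M) \<union> N) - sum ?f N"
        using P N M by (subst sum.union_disjoint) (auto simp: Diff_eq)
      also have "\<dots> \<le> T - sum ?f N"
        using le[of "(P - M) \<union> N"] P N by simp
      also have "\<dots> \<le> (\<epsilon>/2)\<^sup>2" using N by (simp add: dist_real_def)
      finally show "(\<Sum>i\<in>P. (norm (pairing S (\<eta> - (\<Sum>i\<in>M. scaleD S (pairing S \<eta> (e i)) (de i))) (e i)))\<^sup>2) \<le> (\<epsilon>/2)\<^sup>2" .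
    qed (use \<open>\<epsilon> > 0\<close> in auto)
    then show "dist (\<Sum>i\<in>M. scaleD S (pairing S \<eta> (e i)) (de i)) \<eta> < \<epsilon>"
      using \<open>\<epsilon> > 0\<close> by (simp add: dist_norm norm_minus_commute)
  qed (use N in auto)
qed

section \<open>Functionals and coordinates on the phase space\<close>

lemma dualW_iff: "u \<in> dualW S \<longleftrightarrow>
    (\<forall>v w. u (v + w) = u v + u w) \<and> (\<forall>c w. u (scaleW S c w) = c * u w) \<and> (\<exists>C. \<forall>w. norm (u w) \<le> norm w * C)"
proof
  assume "u \<in> dualW S"
  then have "bounded_linear u" "Vector_Spaces.linear (scaleW S) (*) u" by (auto simp: dualW_def)
  then show "(\<forall>v w. u (v + w) = u v + u w) \<and> (\<forall>c w. u (scaleW S c w) = c * u w)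
      \<and> (\<exists>C. \<forall>w. norm (u w) \<le> norm w * C)"
    using bounded_linear.bounded[of u] by (auto simp: Vector_Spaces.linear_iff)
next
  assume *: "(\<forall>v w. u (v + w) = u v + u w) \<and> (\<forall>c w. u (scaleW S c w) = c * u w)
      \<and> (\<exists>C. \<forall>w. norm (u w) \<le> norm w * C)"
  then obtain C where C: "\<And>w. norm (u w) \<le> norm w * C" by blast
  have "bounded_linear u"
  proof (rule bounded_linear_intro[where K = C])
    show "u (r *\<^sub>R x) = r *\<^sub>R u x" for r x
      using * scaleW_of_real[of r x] by (metis scaleR_conv_of_real)
  qed (use * C in auto)
  moreover have "Vector_Spaces.linear (scaleW S) (*) u"
    using * W.vector_space_axioms vector_space_field by (auto simp: Vector_Spaces.linear_iff)
  ultimately show "u \<in> dualW S" by (auto simp: dualW_def)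
qed

lemma dualW_add: "u \<in> dualW S \<Longrightarrow> u (v + w) = u v + u w"
  by (simp only: dualW_iff)

lemma dualW_scale: "u \<in> dualW S \<Longrightarrow> u (scaleW S c w) = c * u w"
  by (simp only: dualW_iff)

lemma dualW_bounded: "u \<in> dualW S \<Longrightarrow> bounded_linear u"
  by (auto simp: dualW_def)

lemma dualW_sum: "u \<in> dualW S \<Longrightarrow> u (\<Sum>i\<in>N. f i) = (\<Sum>i\<in>N. u (f i))"
  using linear_sum[OF bounded_linear.linear[OF dualW_bounded]] .

definition coordW :: "bool \<times> nat \<Rightarrow> 'h \<times> 'd \<Rightarrow> 'k" where
  "coordW \<alpha> w = (if fst \<alpha> then pairing S (snd w) (e (snd \<alpha>)) else ip S (e (snd \<alpha>)) (fst w))"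

lemma coordW_eW: "coordW \<alpha> (eW \<beta>) = (if \<alpha> = \<beta> then 1 else 0)"
  by (cases \<alpha>; cases \<beta>) (auto simp: coordW_def basisW_def pairing_dual_basis ip_basis pairing_zero_left ip_zero)

lemma norm_fst_snd_sq: "(norm w)\<^sup>2 = (norm (fst w))\<^sup>2 + (norm (snd w))\<^sup>2"
  by (cases w) (simp add: norm_Pair)

lemma coordW_sq_le:
  assumes "finite N"
  shows "(\<Sum>\<alpha>\<in>N. (norm (coordW \<alpha> w))\<^sup>2) \<le> (norm w)\<^sup>2"
proof -
  have fin: "finite (Pair b -` N)" for b
    by (rule finite_vimageI[OF assms]) (auto simp: inj_on_def)
  show ?thesis
    unfolding sum_bool_split[OF assms] norm_fst_snd_sq
    using bessel_ineq[OF fin[of False], of "fst w"] sum_pairing_basis_le[OF fin[of True], of "snd w"]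
    by (simp add: coordW_def)
qed

lemma coordW_dualW: "coordW \<alpha> \<in> dualW S"
proof -
  have "norm (coordW \<alpha> w) \<le> norm w * 1" for w
    by (rule power2_le_imp_le) (use coordW_sq_le[of "{\<alpha>}" w] in auto)
  then have "\<exists>C. \<forall>w. norm (coordW \<alpha> w) \<le> norm w * C" by blast
  then show ?thesis
    unfolding dualW_iff
    by (simp add: coordW_def scaleW_def pairing_add_left pairing_scale_left ip_add ip_scale)
qed

lemma norm_eW_sum:
  assumes "finite N"
  shows "(norm (\<Sum>\<alpha>\<in>N. scaleW S (c \<alpha>) (eW \<alpha>)))\<^sup>2 \<le> (\<Sum>\<alpha>\<in>N. (norm (c \<alpha>))\<^sup>2)"
proof -
  have fin: "finite (Pair b -` N)" for b
    by (rule finite_vimageI[OF assms]) (auto simp: inj_on_def)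
  have 1: "(\<Sum>i\<in>Pair False -` N. scaleW S (c (False, i)) (eW (False, i)))
      = (\<Sum>i\<in>Pair False -` N. scaleH S (c (False, i)) (e i), 0)"
    using fin[of False] by (induction rule: finite_induct) (auto simp: scaleW_def basisW_def zero_prod_def)
  have 2: "(\<Sum>i\<in>Pair True -` N. scaleW S (c (True, i)) (eW (True, i)))
      = (0, \<Sum>i\<in>Pair True -` N. scaleD S (c (True, i)) (de i))"
    using fin[of True] by (induction rule: finite_induct) (auto simp: scaleW_def basisW_def zero_prod_def)
  show ?thesis
    unfolding sum_bool_split[OF assms] 1 2 norm_fst_snd_sq
    using norm_basis_sum[OF fin[of False], of "\<lambda>i. c (False, i)"]
      norm_dual_basis_sum[OF fin[of True], of "\<lambda>i. c (True, i)"] by simp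
qed

lemma eW_expansion: "((\<lambda>\<alpha>. scaleW S (coordW \<alpha> w) (eW \<alpha>)) has_sum w) UNIV"
proof -
  have "bounded_linear (\<lambda>x::'h. (x, 0::'d))" "bounded_linear (\<lambda>y::'d. (0::'h, y))"
    by (auto intro!: bounded_linear_Pair bounded_linear_ident bounded_linear_zero)
  then have "((\<lambda>i. scaleW S (coordW (False, i) w) (eW (False, i))) has_sum (fst w, 0)) UNIV"
    and "((\<lambda>i. scaleW S (coordW (True, i) w) (eW (True, i))) has_sum (0, snd w)) UNIV"
    using has_sum_bounded_linear[OF _ basis_expansion[of "fst w"], of "\<lambda>x. (x, 0::'d)"]
      has_sum_bounded_linear[OF _ dual_basis_expansion[of "snd w"], of "\<lambda>y. (0::'h, y)"]
    by (simp_all add: o_def coordW_def scaleW_def basisW_def)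
  from has_sum_bool_split[where f = "\<lambda>\<alpha>. scaleW S (coordW \<alpha> w) (eW \<alpha>)", OF this] show ?thesis by simp
qed

lemma dualW_expansion:
  assumes "u \<in> dualW S"
  shows "((\<lambda>\<alpha>. coordW \<alpha> w * u (eW \<alpha>)) has_sum u w) UNIV"
  using has_sum_bounded_linear[OF dualW_bounded[OF assms] eW_expansion, of w]
  by (simp add: o_def dualW_scale[OF assms])

text \<open>The squared Hilbert norm of the functional, by coordinates instead of
  \<open>onorm\<close>: a sum of these over several functionals is then a double sum, as
  \<open>front_double_sum_le\<close> needs.\<close>

definition nu :: "('h \<times> 'd \<Rightarrow> 'k) \<Rightarrow> real" where
  "nu u = (\<Sum>\<^sub>\<infinity>\<alpha>. (norm (u (eW \<alpha>)))\<^sup>2)"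

lemma nu_bound:
  assumes u: "u \<in> dualW S" and N: "finite N" and K: "\<And>w. norm (u w) \<le> norm w * K" and "0 \<le> K"
  shows "(\<Sum>\<alpha>\<in>N. (norm (u (eW \<alpha>)))\<^sup>2) \<le> K\<^sup>2"
proof -
  define s where "s = (\<Sum>\<alpha>\<in>N. (norm (u (eW \<alpha>)))\<^sup>2)"
  define z where "z = (\<Sum>\<alpha>\<in>N. scaleW S (kconj (u (eW \<alpha>))) (eW \<alpha>))"
  have s0: "s \<ge> 0" by (simp add: s_def sum_nonneg)
  have "(norm z)\<^sup>2 \<le> s" unfolding z_def s_def using norm_eW_sum[OF N, of "\<lambda>\<alpha>. kconj (u (eW \<alpha>))"] by (simp add: norm_kconj)
  then have z: "norm z \<le> sqrt s" by (rule real_le_rsqrt)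
  have "u z = of_real s"
    by (simp add: z_def s_def dualW_sum[OF u] dualW_scale[OF u] mult_kconj_of_real mult.commute)
  then have "s \<le> K * norm z"
    using K[of z] s0 by (simp add: mult.commute)
  also have "\<dots> \<le> K * sqrt s" by (rule mult_left_mono[OF z \<open>0 \<le> K\<close>])
  finally show ?thesis using s0 \<open>0 \<le> K\<close> unfolding s_def[symmetric] by (intro le_square_of_le_mult_sqrt)
qed

lemma nu_summable:
  assumes u: "u \<in> dualW S"
  shows "(\<lambda>\<alpha>. (norm (u (eW \<alpha>)))\<^sup>2) summable_on UNIV"
proof -
  obtain K where K: "0 \<le> K" "\<And>w. norm (u w) \<le> norm w * K"
    using bounded_linear.nonneg_bounded[OF dualW_bounded[OF u]] by blast
  show ?thesis
    by (rule nonneg_bdd_above_summable_on) (auto intro!: bdd_aboveI[of _ "K\<^sup>2"] nu_bound[OF u _ K(2) K(1)])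
qed

lemma nu_nonneg: "0 \<le> nu u"
  unfolding nu_def by (rule infsum_nonneg) simp

lemma nu_finite: "u \<in> dualW S \<Longrightarrow> finite N \<Longrightarrow> (\<Sum>\<alpha>\<in>N. (norm (u (eW \<alpha>)))\<^sup>2) \<le> nu u"
  unfolding nu_def by (rule finite_sum_le_infsum[OF nu_summable]) auto

lemma norm_dualW_le:
  assumes u: "u \<in> dualW S"
  shows "norm (u w) \<le> norm w * sqrt (nu u)"
proof (rule has_sum_norm_le[OF dualW_expansion[OF u]])
  fix N :: "(bool \<times> nat) set" assume N: "finite N"
  have "L2_set (\<lambda>\<alpha>. norm (coordW \<alpha> w)) N \<le> norm w"
    using coordW_sq_le[OF N] by (simp add: L2_set_le_iff)
  moreover have "L2_set (\<lambda>\<alpha>. norm (u (eW \<alpha>))) N \<le> sqrt (nu u)"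
    using nu_finite[OF u N] nu_nonneg by (simp add: L2_set_le_iff)
  ultimately show "norm (\<Sum>\<alpha>\<in>N. coordW \<alpha> w * u (eW \<alpha>)) \<le> norm w * sqrt (nu u)"
    by (intro order_trans[OF norm_sum_mult_le] mult_mono) auto
qed

text \<open>Such a p is the image of an orthonormal family under a map of norm at most K (a Bessel
  sequence). It is the one property of a family of vectors that the estimates use: contracting a
  slot with p costs the factor K.\<close>

definition bessel :: "('b \<Rightarrow> 'h \<times> 'd) \<Rightarrow> real \<Rightarrow> bool" where
  "bessel p K \<longleftrightarrow> 0 \<le> K \<and> (\<forall>u\<in>dualW S. \<forall>Y. finite Y \<longrightarrow> (\<Sum>b\<in>Y. (norm (u (p b)))\<^sup>2) \<le> K\<^sup>2 * nu u)"

lemma bessel_eW: "bessel eW 1"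
  by (auto simp: bessel_def nu_finite)

text \<open>Evaluation in one vector is contraction with a one-element family; this makes
  \<open>hs_le_front_vector\<close> an instance of \<open>hs_le_front\<close>.\<close>

lemma bessel_single: "bessel (\<lambda>_::unit. v) (norm v)"
  unfolding bessel_def
proof (intro conjI ballI allI impI)
  fix u Y assume u: "u \<in> dualW S"
  have "(norm (u v))\<^sup>2 \<le> (norm v)\<^sup>2 * nu u"
    using power_mono[OF norm_dualW_le[OF u, of v] norm_ge_zero, of 2] by (simp add: power_mult_distrib nu_nonneg)
  moreover have "Y = {} \<or> Y = {()}" by auto
  ultimately show "(\<Sum>b::unit\<in>Y. (norm (u v))\<^sup>2) \<le> (norm v)\<^sup>2 * nu u"
    by (auto simp: nu_nonneg)
qed simp

lemma dualW_fst_sum: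
  assumes "u \<in> dualW S"
  shows "u (\<Sum>j\<in>Y. scaleH S (c j) (f j), 0) = (\<Sum>j\<in>Y. c j * u (f j, 0))"
proof -
  have "(\<Sum>j\<in>Y. scaleH S (c j) (f j), 0) = (\<Sum>j\<in>Y. scaleW S (c j) (f j, 0))"
    by (simp add: scaleW_def prod_eq_iff fst_sum snd_sum)
  then show ?thesis by (simp add: dualW_sum dualW_scale assms)
qed

lemma operator_sum:
  assumes "X \<in> bounded_operators S"
  shows "X (\<Sum>j\<in>Y. scaleH S (c j) (f j)) = (\<Sum>j\<in>Y. scaleH S (c j) (X (f j)))"
  using assms by (simp add: blinfun.sum_right bounded_operators_def)

text \<open>X is moved onto the test vector z instead of taking an adjoint: the values
  \<open>u (X (e j), 0)\<close>, weighted by their conjugates, add up to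
  \<open>u (X z, 0)\<close>.\<close>

lemma bessel_operator:
  assumes X: "X \<in> bounded_operators S"
  shows "bessel (\<lambda>j. (X (e j), 0)) (norm X)"
  unfolding bessel_def
proof (intro conjI ballI allI impI)
  fix u and Y :: "nat set" assume u: "u \<in> dualW S" and Y: "finite Y"
  define s where "s = (\<Sum>j\<in>Y. (norm (u (X (e j), 0)))\<^sup>2)"
  define z where "z = (\<Sum>j\<in>Y. scaleH S (kconj (u (X (e j), 0))) (e j))"
  have s0: "s \<ge> 0" by (simp add: s_def sum_nonneg)
  have "(norm z)\<^sup>2 = s" unfolding z_def s_def by (simp add: norm_basis_sum[OF Y] norm_kconj)
  then have z: "norm z = sqrt s" by (metis norm_ge_zero real_sqrt_unique)
  have "u (X z, 0) = of_real s"
    by (simp add: z_def s_def operator_sum[OF X] dualW_fst_sum[OF u] mult_kconj_of_real mult.commute)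
  then have "s \<le> norm (X z) * sqrt (nu u)"
    using norm_dualW_le[OF u, of "(X z, 0)"] s0 by (simp add: norm_Pair)
  also have "\<dots> \<le> (norm X * sqrt s) * sqrt (nu u)"
    using norm_blinfun[of X z] z by (intro mult_right_mono) (auto simp: nu_nonneg)
  finally have "s \<le> (norm X * sqrt (nu u)) * sqrt s" by (simp add: mult_ac)
  then have "s \<le> (norm X * sqrt (nu u))\<^sup>2"
    using s0 by (intro le_square_of_le_mult_sqrt) (auto simp: nu_nonneg)
  then show "(\<Sum>j\<in>Y. (norm (u (X (e j), 0)))\<^sup>2) \<le> (norm X)\<^sup>2 * nu u"
    by (simp add: s_def power_mult_distrib nu_nonneg)
qed simp

lemma bessel_de: "bessel (\<lambda>j. (0, de j)) 1"
  unfolding bessel_def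
proof (intro conjI ballI allI impI)
  fix u and Y :: "nat set" assume u: "u \<in> dualW S" and Y: "finite Y"
  have "(\<Sum>j\<in>Y. (norm (u (0, de j)))\<^sup>2) = (\<Sum>\<alpha>\<in>Pair True ` Y. (norm (u (eW \<alpha>)))\<^sup>2)"
    by (subst sum.reindex) (auto simp: inj_on_def basisW_def)
  also have "\<dots> \<le> nu u" by (rule nu_finite[OF u]) (use Y in auto)
  finally show "(\<Sum>j\<in>Y. (norm (u (0, de j)))\<^sup>2) \<le> 1\<^sup>2 * nu u" by simp
qed simp

lemma bessel_bool:
  assumes "bessel p K" "bessel q L"
  shows "bessel (\<lambda>(b, j). if b then p j else q j) (K + L)"
  unfolding bessel_def
proof (intro conjI ballI allI impI)
  fix u and Y :: "(bool \<times> 'a) set" assume u: "u \<in> dualW S" and Y: "finite Y"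
  have fin: "finite (Pair b -` Y)" for b
    by (rule finite_vimageI[OF Y]) (auto simp: inj_on_def)
  have KL: "0 \<le> K" "0 \<le> L" using assms by (auto simp: bessel_def)
  have "(\<Sum>b\<in>Y. (norm (u (case b of (b, j) \<Rightarrow> if b then p j else q j)))\<^sup>2) \<le> L\<^sup>2 * nu u + K\<^sup>2 * nu u"
    unfolding sum_bool_split[OF Y] using assms u fin by (auto simp: bessel_def intro!: add_mono)
  also have "\<dots> = (K\<^sup>2 + L\<^sup>2) * nu u" by (simp add: algebra_simps)
  \<comment> \<open>The sharp constant is the root of \<open>K\<^sup>2 + L\<^sup>2\<close>; the
    larger K + L keeps roots out.\<close>
  also have "\<dots> \<le> (K + L)\<^sup>2 * nu u"
    by (rule mult_right_mono) (use KL in \<open>auto simp: power2_sum nu_nonneg\<close>)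
  finally show "(\<Sum>b\<in>Y. (norm (u (case b of (b, j) \<Rightarrow> if b then p j else q j)))\<^sup>2) \<le> (K + L)\<^sup>2 * nu u" .
qed (use assms in \<open>auto simp: bessel_def\<close>)

end

section \<open>Hilbert-Schmidt norms of multilinear forms\<close>

lemma has_sum_sum_fun:
  fixes f :: "'a \<Rightarrow> 'b \<Rightarrow> 'c::topological_comm_monoid_add"
  assumes "\<And>b. b \<in> Y \<Longrightarrow> (f b has_sum s b) A"
  shows "((\<lambda>a. \<Sum>b\<in>Y. f b a) has_sum (\<Sum>b\<in>Y. s b)) A"
  using assms by (induction Y rule: infinite_finite_induct) (auto intro: has_sum_add)

lemma sum_infsum_le_of_finite:
  fixes f :: "'a \<Rightarrow> 'b \<Rightarrow> real"
  assumes "finite Y" "\<And>b. b \<in> Y \<Longrightarrow> f b summable_on A"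
    and "\<And>X. finite X \<Longrightarrow> X \<subseteq> A \<Longrightarrow> (\<Sum>b\<in>Y. \<Sum>a\<in>X. f b a) \<le> C"
  shows "(\<Sum>b\<in>Y. infsum (f b) A) \<le> C"
proof -
  have "((\<lambda>a. \<Sum>b\<in>Y. f b a) has_sum (\<Sum>b\<in>Y. infsum (f b) A)) A"
    by (rule has_sum_sum_fun) (use assms in auto)
  then show ?thesis
    by (rule has_sum_le_finite_sums) (use assms(3) in \<open>auto simp: sum.swap[of _ Y]\<close>)
qed

context phase_space
begin

text \<open>A function of lists is a whole jet: its restriction to lists of length n is the form of
  order n. Only separate boundedness in each slot is asked; joint bounds come from Hilbert-Schmidt
  bounds by \<open>norm_le_of_hs_le\<close>.\<close>

definition mlf :: "(('h \<times> 'd) list \<Rightarrow> 'k) \<Rightarrow> bool" where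
  "mlf t \<longleftrightarrow> (\<forall>us vs. (\<lambda>x. t (us @ x # vs)) \<in> dualW S)"

text \<open>Stated by finite partial sums because an infinite sum without summability is 0 by
  convention, so that a bound on \<open>tensor_norm\<close> alone would say nothing.\<close>

definition hs_le :: "nat \<Rightarrow> (('h \<times> 'd) list \<Rightarrow> 'k) \<Rightarrow> real \<Rightarrow> bool" where
  "hs_le n t C \<longleftrightarrow> 0 \<le> C \<and> (\<forall>X. finite X \<longrightarrow> X \<subseteq> {is. length is = n} \<longrightarrow>
     (\<Sum>is\<in>X. (norm (t (map eW is)))\<^sup>2) \<le> C\<^sup>2)"

abbreviation sq :: "nat \<Rightarrow> (('h \<times> 'd) list \<Rightarrow> 'k) \<Rightarrow> bool" where
  "sq n t \<equiv> (\<lambda>is. (norm (t (map eW is)))\<^sup>2) summable_on {is. length is = n}"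

abbreviation tnorm :: "nat \<Rightarrow> (('h \<times> 'd) list \<Rightarrow> 'k) \<Rightarrow> real" where
  "tnorm \<equiv> tensor_norm S"

lemma tnorm_sq: "(tnorm n t)\<^sup>2 = (\<Sum>\<^sub>\<infinity>is | length is = n. (norm (t (map eW is)))\<^sup>2)"
  by (simp add: tensor_norm_def infsum_nonneg)

lemma tnorm_nonneg [simp]: "0 \<le> tnorm n t"
  by (simp add: tensor_norm_def infsum_nonneg)

lemma hs_le_iff: "hs_le n t C \<longleftrightarrow> sq n t \<and> tnorm n t \<le> C"
proof
  assume *: "hs_le n t C"
  then have C: "0 \<le> C" by (simp add: hs_le_def)
  have sq: "sq n t"
    by (rule nonneg_bdd_above_summable_on)
      (use * in \<open>auto simp: hs_le_def intro!: bdd_aboveI[of _ "C\<^sup>2"]\<close>)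
  have "(tnorm n t)\<^sup>2 \<le> C\<^sup>2"
    unfolding tnorm_sq by (rule infsum_le_finite_sums[OF sq]) (use * in \<open>auto simp: hs_le_def\<close>)
  then show "sq n t \<and> tnorm n t \<le> C"
    using sq power2_le_imp_le[OF _ C] by blast
next
  assume *: "sq n t \<and> tnorm n t \<le> C"
  then have C: "0 \<le> C" using tnorm_nonneg order_trans by blast
  have "(\<Sum>is\<in>X. (norm (t (map eW is)))\<^sup>2) \<le> C\<^sup>2" if "finite X" "X \<subseteq> {is. length is = n}" for X
  proof -
    have "(\<Sum>is\<in>X. (norm (t (map eW is)))\<^sup>2) \<le> (tnorm n t)\<^sup>2"
      unfolding tnorm_sq by (rule finite_sum_le_infsum) (use * that in auto)
    also have "\<dots> \<le> C\<^sup>2" by (rule power_mono) (use * in auto)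
    finally show ?thesis .
  qed
  then show "hs_le n t C" using C by (auto simp: hs_le_def)
qed

lemma hs_le_tnorm: "sq n t \<Longrightarrow> hs_le n t (tnorm n t)"
  by (simp add: hs_le_iff)

lemma hs_le_nonneg: "hs_le n t C \<Longrightarrow> 0 \<le> C"
  by (simp add: hs_le_def)

lemma hs_le_mono: "hs_le n t C \<Longrightarrow> C \<le> D \<Longrightarrow> hs_le n t D"
  by (auto simp: hs_le_iff)

lemma hs_le_L2: "hs_le n t C \<longleftrightarrow> 0 \<le> C \<and> (\<forall>X. finite X \<longrightarrow> X \<subseteq> {is. length is = n} \<longrightarrow>
    L2_set (\<lambda>is. norm (t (map eW is))) X \<le> C)"
  by (auto simp: hs_le_def L2_set_le_iff)

lemma hs_le_cong: "(\<And>vs. length vs = n \<Longrightarrow> s vs = t vs) \<Longrightarrow> hs_le n s C \<longleftrightarrow> hs_le n t C"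
proof -
  assume *: "\<And>vs. length vs = n \<Longrightarrow> s vs = t vs"
  have "(\<Sum>is\<in>X. (norm (s (map eW is)))\<^sup>2) = (\<Sum>is\<in>X. (norm (t (map eW is)))\<^sup>2)"
    if "X \<subseteq> {is. length is = n}" for X
    by (rule sum.cong) (use * that in auto)
  then show ?thesis by (auto simp: hs_le_def)
qed

lemma hs_le_zero: "hs_le n (\<lambda>_. 0) 0"
  by (simp add: hs_le_def)

lemma hs_le_add:
  assumes "hs_le n s C" "hs_le n t D"
  shows "hs_le n (\<lambda>vs. s vs + t vs) (C + D)"
  unfolding hs_le_L2
proof (intro conjI allI impI)
  fix X :: "(bool \<times> nat) list set" assume X: "finite X" "X \<subseteq> {is. length is = n}"
  have "L2_set (\<lambda>is. norm (s (map eW is) + t (map eW is))) X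
      \<le> L2_set (\<lambda>is. norm (s (map eW is)) + norm (t (map eW is))) X"
    by (rule L2_set_mono) (auto intro: norm_triangle_ineq)
  also have "\<dots> \<le> L2_set (\<lambda>is. norm (s (map eW is))) X + L2_set (\<lambda>is. norm (t (map eW is))) X"
    by (rule L2_set_triangle_ineq)
  also have "\<dots> \<le> C + D" using assms X by (auto simp: hs_le_L2 intro!: add_mono)
  finally show "L2_set (\<lambda>is. norm (s (map eW is) + t (map eW is))) X \<le> C + D" .
qed (use assms in \<open>auto simp: hs_le_def\<close>)

lemma hs_le_scale: "hs_le n t C \<Longrightarrow> hs_le n (\<lambda>vs. c * t vs) (norm c * C)"
  by (auto simp: hs_le_def norm_mult power_mult_distrib sum_distrib_left[symmetric] mult_left_mono)

lemma hs_le_sum: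
  assumes "finite Y" "\<And>b. b \<in> Y \<Longrightarrow> hs_le n (T b) (C b)"
  shows "hs_le n (\<lambda>vs. \<Sum>b\<in>Y. T b vs) (\<Sum>b\<in>Y. C b)"
  using assms by (induction Y rule: finite_induct) (auto simp: hs_le_zero intro!: hs_le_add)

text \<open>Lower semicontinuity of the Hilbert-Schmidt norm: for finitely many index lists the
  square sum is continuous in the values, so a bound on the partial sums passes to the
  limit.\<close>

lemma hs_le_has_sum:
  assumes "\<And>is. length is = n \<Longrightarrow> ((\<lambda>b. T b (map eW is)) has_sum t (map eW is)) A"
    and "\<And>Y. finite Y \<Longrightarrow> Y \<subseteq> A \<Longrightarrow> hs_le n (\<lambda>vs. \<Sum>b\<in>Y. T b vs) C"
  shows "hs_le n t C"
  unfolding hs_le_def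
proof (intro conjI allI impI)
  show "0 \<le> C" using assms(2)[of "{}"] by (auto simp: hs_le_def)
  fix X :: "(bool \<times> nat) list set" assume X: "finite X" "X \<subseteq> {is. length is = n}"
  show "(\<Sum>is\<in>X. (norm (t (map eW is)))\<^sup>2) \<le> C\<^sup>2"
  proof (rule tendsto_upperbound)
    show "((\<lambda>Y. \<Sum>is\<in>X. (norm (\<Sum>b\<in>Y. T b (map eW is)))\<^sup>2) \<longlongrightarrow> (\<Sum>is\<in>X. (norm (t (map eW is)))\<^sup>2))
        (finite_subsets_at_top A)"
      using assms(1) X(2) unfolding has_sum_def by (intro tendsto_intros) auto
    show "\<forall>\<^sub>F Y in finite_subsets_at_top A. (\<Sum>is\<in>X. (norm (\<Sum>b\<in>Y. T b (map eW is)))\<^sup>2) \<le> C\<^sup>2"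
      by (rule eventually_finite_subsets_at_top_weakI) (use assms(2) X in \<open>auto simp: hs_le_def\<close>)
  qed simp
qed

lemma mlf_front: "mlf t \<Longrightarrow> mlf (\<lambda>vs. t (v # vs))"
proof -
  assume "mlf t"
  then have "(\<lambda>x. t ((v # us) @ x # vs)) \<in> dualW S" for us vs
    unfolding mlf_def by blast
  then show ?thesis by (simp add: mlf_def)
qed

lemma mlf_slot: "mlf t \<Longrightarrow> (\<lambda>x. t (us @ x # vs)) \<in> dualW S"
  by (simp add: mlf_def)

lemma mlf_hd: "mlf t \<Longrightarrow> (\<lambda>x. t (x # vs)) \<in> dualW S"
  using mlf_slot[of t "[]"] by simp

text \<open>For a fixed remaining index list the Bessel property turns the sum over b into
  \<open>nu\<close> of the first slot; expanding \<open>nu\<close> in the basis restores a square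
  sum of order n + 1.\<close>

lemma front_double_sum_le:
  assumes t: "mlf t" and C: "hs_le (Suc n) t C" and p: "bessel p K"
    and X: "finite X" "X \<subseteq> {is. length is = n}" and Y: "finite Y"
  shows "(\<Sum>b\<in>Y. \<Sum>is\<in>X. (norm (t (p b # map eW is)))\<^sup>2) \<le> (K * C)\<^sup>2"
proof -
  have "(\<Sum>b\<in>Y. \<Sum>is\<in>X. (norm (t (p b # map eW is)))\<^sup>2)
      = (\<Sum>is\<in>X. \<Sum>b\<in>Y. (norm (t (p b # map eW is)))\<^sup>2)"
    by (rule sum.swap)
  also have "\<dots> \<le> (\<Sum>is\<in>X. K\<^sup>2 * nu (\<lambda>x. t (x # map eW is)))"
    by (rule sum_mono) (use p mlf_hd[OF t] Y in \<open>auto simp: bessel_def\<close>)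
  also have "\<dots> = K\<^sup>2 * (\<Sum>is\<in>X. nu (\<lambda>x. t (x # map eW is)))"
    by (simp add: sum_distrib_left)
  also have "(\<Sum>is\<in>X. nu (\<lambda>x. t (x # map eW is))) \<le> C\<^sup>2"
    unfolding nu_def
  proof (rule sum_infsum_le_of_finite[OF X(1)])
    show "(\<lambda>\<alpha>. (norm (t (eW \<alpha> # map eW is)))\<^sup>2) summable_on UNIV" for "is"
      using nu_summable[OF mlf_hd[OF t]] .
    fix Z :: "(bool \<times> nat) set" assume Z: "finite Z"
    have "(\<Sum>is\<in>X. \<Sum>\<alpha>\<in>Z. (norm (t (eW \<alpha> # map eW is)))\<^sup>2)
        = (\<Sum>(is, \<alpha>)\<in>X \<times> Z. (norm (t (eW \<alpha> # map eW is)))\<^sup>2)"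
      by (simp add: sum.cartesian_product)
    also have "\<dots> = (\<Sum>is\<in>(\<lambda>(is, \<alpha>). \<alpha> # is) ` (X \<times> Z). (norm (t (map eW is)))\<^sup>2)"
      by (subst sum.reindex) (auto simp: inj_on_def case_prod_unfold)
    also have "\<dots> \<le> C\<^sup>2"
      using C X Z unfolding hs_le_def by (elim conjE allE impE) auto
    finally show "(\<Sum>is\<in>X. \<Sum>\<alpha>\<in>Z. (norm (t (eW \<alpha> # map eW is)))\<^sup>2) \<le> C\<^sup>2" .
  qed
  finally show ?thesis by (simp add: power_mult_distrib mult_left_mono)
qed

lemma hs_le_front:
  assumes "mlf t" "hs_le (Suc n) t C" "bessel p K"
  shows "hs_le n (\<lambda>vs. t (p b # vs)) (K * C)"
  unfolding hs_le_def
  using front_double_sum_le[OF assms, of _ "{b}"] assms hs_le_nonneg[OF assms(2)]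
  by (auto simp: bessel_def)

lemma sum_tnorm_front_le:
  assumes t: "mlf t" and C: "hs_le (Suc n) t C" and p: "bessel p K" and Y: "finite Y"
  shows "(\<Sum>b\<in>Y. (tnorm n (\<lambda>vs. t (p b # vs)))\<^sup>2) \<le> (K * C)\<^sup>2"
  unfolding tnorm_sq
proof (rule sum_infsum_le_of_finite[OF Y])
  show "(\<lambda>is. (norm (t (p b # map eW is)))\<^sup>2) summable_on {is. length is = n}" for b
    using hs_le_front[OF t C p, of b] by (simp add: hs_le_iff)
qed (use front_double_sum_le[OF t C p _ _ Y] in auto)

lemma hs_le_front_vector:
  assumes "mlf t" "hs_le (Suc n) t C"
  shows "hs_le n (\<lambda>vs. t (v # vs)) (norm v * C)"
  using hs_le_front[OF assms bessel_single] .

lemma hs_le_Suc: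
  assumes "\<And>\<alpha>. hs_le n (\<lambda>vs. t (eW \<alpha> # vs)) (c \<alpha>)" and "0 \<le> C"
    and "\<And>Y. finite Y \<Longrightarrow> (\<Sum>\<alpha>\<in>Y. (c \<alpha>)\<^sup>2) \<le> C\<^sup>2"
  shows "hs_le (Suc n) t C"
  unfolding hs_le_def
proof (intro conjI allI impI)
  fix X :: "(bool \<times> nat) list set" assume X: "finite X" "X \<subseteq> {is. length is = Suc n}"
  \<comment> \<open>Enlarging X to the product of its sets of heads and tails separates the first
    index from the others.\<close>
  have "X \<subseteq> (\<lambda>(\<alpha>, is). \<alpha> # is) ` (hd ` X \<times> tl ` X)"
  proof
    fix x assume x: "x \<in> X"
    then have "x = hd x # tl x" using X by (cases x) auto
    then show "x \<in> (\<lambda>(\<alpha>, is). \<alpha> # is) ` (hd ` X \<times> tl ` X)"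
      using x by (intro image_eqI[of _ _ "(hd x, tl x)"]) auto
  qed
  then have "(\<Sum>is\<in>X. (norm (t (map eW is)))\<^sup>2)
      \<le> (\<Sum>is\<in>(\<lambda>(\<alpha>, is). \<alpha> # is) ` (hd ` X \<times> tl ` X). (norm (t (map eW is)))\<^sup>2)"
    by (intro sum_mono2) (use X in auto)
  also have "\<dots> = (\<Sum>(\<alpha>, is)\<in>hd ` X \<times> tl ` X. (norm (t (eW \<alpha> # map eW is)))\<^sup>2)"
    by (subst sum.reindex) (auto simp: inj_on_def case_prod_unfold)
  also have "\<dots> = (\<Sum>\<alpha>\<in>hd ` X. \<Sum>is\<in>tl ` X. (norm (t (eW \<alpha> # map eW is)))\<^sup>2)"
    by (simp add: sum.cartesian_product)
  also have "\<dots> \<le> (\<Sum>\<alpha>\<in>hd ` X. (c \<alpha>)\<^sup>2)"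
  proof (rule sum_mono)
    fix \<alpha>
    have "tl ` X \<subseteq> {is. length is = n}" using X(2) by auto
    then show "(\<Sum>is\<in>tl ` X. (norm (t (eW \<alpha> # map eW is)))\<^sup>2) \<le> (c \<alpha>)\<^sup>2"
      using assms(1)[of \<alpha>] X(1) by (auto simp: hs_le_def)
  qed
  also have "\<dots> \<le> C\<^sup>2" using assms(3) X(1) by simp
  finally show "(\<Sum>is\<in>X. (norm (t (map eW is)))\<^sup>2) \<le> C\<^sup>2" .
qed (rule assms(2))

lemma hs_le_0_iff: "hs_le 0 t C \<longleftrightarrow> norm (t []) \<le> C"
proof
  assume *: "hs_le 0 t C"
  have "0 \<le> C" by (rule hs_le_nonneg[OF *])
  moreover have "(\<Sum>is\<in>{[]}. (norm (t (map eW is)))\<^sup>2) \<le> C\<^sup>2"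
    using * unfolding hs_le_def by (elim conjE allE[where x = "{[]}"] impE) auto
  ultimately show "norm (t []) \<le> C" using power2_le_imp_le[of "norm (t [])" C] by simp
next
  assume *: "norm (t []) \<le> C"
  then have "0 \<le> C" using norm_ge_zero order_trans by blast
  have "(norm (t []))\<^sup>2 \<le> C\<^sup>2" using * by (rule power_mono) simp
  then have "(\<Sum>is\<in>X. (norm (t (map eW is)))\<^sup>2) \<le> C\<^sup>2"
    if X: "X \<subseteq> {is. length is = 0}" for X :: "(bool \<times> nat) list set"
  proof -
    have "X = {} \<or> X = {[]}" using X by auto
    then show ?thesis using \<open>(norm (t []))\<^sup>2 \<le> C\<^sup>2\<close> by auto
  qed
  then show "hs_le 0 t C"
    using \<open>0 \<le> C\<close> by (simp add: hs_le_def)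
qed

text \<open>The Hilbert-Schmidt norm dominates the norm as a multilinear map, since fixing the first
  slot at v costs only the norm of v.\<close>

lemma norm_le_of_hs_le:
  assumes "mlf t" "hs_le (length vs) t C"
  shows "norm (t vs) \<le> C * prod_list (map norm vs)"
  using assms
proof (induction vs arbitrary: t C)
  case (Cons v vs)
  then have "norm (t (v # vs)) \<le> (norm v * C) * prod_list (map norm vs)"
    using Cons.IH[of "\<lambda>vs. t (v # vs)" "norm v * C"] mlf_front hs_le_front_vector by simp
  then show ?case by (simp add: mult_ac)
qed (simp add: hs_le_0_iff)

definition hs_jet :: "(('h \<times> 'd) list \<Rightarrow> 'k) \<Rightarrow> bool" where
  "hs_jet t \<longleftrightarrow> mlf t \<and> (\<forall>n. sq n t)"

lemma hs_jet_le: "hs_jet t \<Longrightarrow> hs_le n t (tnorm n t)"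
  by (simp add: hs_jet_def hs_le_iff)

lemma hs_jetD: "hs_jet t \<Longrightarrow> mlf t"
  by (simp add: hs_jet_def)

lemma hs_jetI: "mlf t \<Longrightarrow> (\<And>n. \<exists>C. hs_le n t C) \<Longrightarrow> hs_jet t"
  unfolding hs_jet_def hs_le_iff by blast

lemma hs_jet_front: "hs_jet t \<Longrightarrow> hs_jet (\<lambda>vs. t (v # vs))"
proof (rule hs_jetI)
  assume t: "hs_jet t"
  show "mlf (\<lambda>vs. t (v # vs))" by (rule mlf_front[OF hs_jetD[OF t]])
  show "\<exists>C. hs_le n (\<lambda>vs. t (v # vs)) C" for n
    using hs_le_front_vector[OF hs_jetD[OF t] hs_jet_le[OF t]] by blast
qed

lemma tnorm_front_le:
  assumes t: "hs_jet t"
  shows "tnorm n (\<lambda>vs. t (v # vs)) \<le> norm v * tnorm (Suc n) t"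
  using hs_le_front_vector[OF hs_jetD[OF t] hs_jet_le[OF t]] by (simp add: hs_le_iff)

text \<open>A derivative of a product involves all lower orders of both factors, hence a norm of the
  jet up to order n. The l2 combination lets square sums over a family be split by order.\<close>

definition jnorm :: "nat \<Rightarrow> (('h \<times> 'd) list \<Rightarrow> 'k) \<Rightarrow> real" where
  "jnorm n t = L2_set (\<lambda>k. tnorm k t) {..n}"

lemma jnorm_nonneg [simp]: "0 \<le> jnorm n t"
  by (simp add: jnorm_def)

lemma jnorm_sq: "(jnorm n t)\<^sup>2 = (\<Sum>k\<le>n. (tnorm k t)\<^sup>2)"
  by (simp add: jnorm_def L2_set_def sum_nonneg)

lemma jnorm_mono: "m \<le> n \<Longrightarrow> jnorm m t \<le> jnorm n t"
  by (rule power2_le_imp_le) (auto simp: jnorm_sq intro: sum_mono2)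

lemma sum_jnorm_front_le:
  assumes t: "hs_jet t" and p: "bessel p K" and Y: "finite Y"
  shows "(\<Sum>b\<in>Y. (jnorm n (\<lambda>vs. t (p b # vs)))\<^sup>2) \<le> (K * jnorm (Suc n) t)\<^sup>2"
proof -
  have "(\<Sum>b\<in>Y. (jnorm n (\<lambda>vs. t (p b # vs)))\<^sup>2) = (\<Sum>k\<le>n. \<Sum>b\<in>Y. (tnorm k (\<lambda>vs. t (p b # vs)))\<^sup>2)"
    unfolding jnorm_sq by (rule sum.swap)
  also have "\<dots> \<le> (\<Sum>k\<le>n. (K * tnorm (Suc k) t)\<^sup>2)"
    by (rule sum_mono) (rule sum_tnorm_front_le[OF hs_jetD[OF t] hs_jet_le[OF t] p Y])
  also have "\<dots> = K\<^sup>2 * (\<Sum>k\<le>n. (tnorm (Suc k) t)\<^sup>2)"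
    by (simp add: power_mult_distrib sum_distrib_left)
  also have "\<dots> = K\<^sup>2 * (\<Sum>k\<in>Suc ` {..n}. (tnorm k t)\<^sup>2)"
    by (simp add: sum.reindex)
  also have "\<dots> \<le> K\<^sup>2 * (\<Sum>k\<le>Suc n. (tnorm k t)\<^sup>2)"
    by (intro mult_left_mono sum_mono2) auto
  finally show ?thesis by (simp add: power_mult_distrib jnorm_sq)
qed

text \<open>The jet of a product: the sum over all ways of distributing the listed vectors, in their
  order, over the two factors.\<close>

fun leibniz :: "(('h \<times> 'd) list \<Rightarrow> 'k) \<Rightarrow> (('h \<times> 'd) list \<Rightarrow> 'k) \<Rightarrow> ('h \<times> 'd) list \<Rightarrow> 'k" where
  "leibniz s t [] = s [] * t []"
| "leibniz s t (v # vs) = leibniz (\<lambda>us. s (v # us)) t vs + leibniz s (\<lambda>us. t (v # us)) vs"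

lemma dualW_add_fun: "u \<in> dualW S \<Longrightarrow> v \<in> dualW S \<Longrightarrow> (\<lambda>x. u x + v x) \<in> dualW S"
proof -
  assume u: "u \<in> dualW S" and v: "v \<in> dualW S"
  obtain C D where "\<And>w. norm (u w) \<le> norm w * C" "\<And>w. norm (v w) \<le> norm w * D"
    using u v unfolding dualW_iff by blast
  then have "norm (u w + v w) \<le> norm w * (C + D)" for w
    by (intro order_trans[OF norm_triangle_ineq]) (simp add: distrib_left add_mono)
  then have "\<exists>C. \<forall>w. norm (u w + v w) \<le> norm w * C" by blast
  then show ?thesis
    unfolding dualW_iff by (simp add: dualW_add[OF u] dualW_add[OF v] dualW_scale[OF u] dualW_scale[OF v] algebra_simps)
qed

lemma dualW_mult_fun: "u \<in> dualW S \<Longrightarrow> (\<lambda>x. c * u x) \<in> dualW S"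
proof -
  assume u: "u \<in> dualW S"
  obtain C where C: "\<And>w. norm (u w) \<le> norm w * C"
    using u unfolding dualW_iff by blast
  have "norm (c * u w) \<le> norm w * (norm c * C)" for w
    using mult_left_mono[OF C[of w] norm_ge_zero[of c]] by (simp add: norm_mult mult_ac)
  then have "\<exists>C. \<forall>w. norm (c * u w) \<le> norm w * C" by blast
  then show ?thesis
    unfolding dualW_iff by (simp add: dualW_add[OF u] dualW_scale[OF u] algebra_simps)
qed

lemma dualW_zero: "(\<lambda>_. 0) \<in> dualW S"
  by (auto simp: dualW_iff intro: exI[of _ 0])

lemma dualW_sum_fun: "(\<And>b. b \<in> Y \<Longrightarrow> u b \<in> dualW S) \<Longrightarrow> (\<lambda>x. \<Sum>b\<in>Y. u b x) \<in> dualW S"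
  by (induction Y rule: infinite_finite_induct) (auto intro: dualW_zero dualW_add_fun)

lemma mlf_zero: "mlf (\<lambda>_. 0)"
  by (simp add: mlf_def dualW_zero)

lemma mlf_add: "mlf s \<Longrightarrow> mlf t \<Longrightarrow> mlf (\<lambda>vs. s vs + t vs)"
  by (simp add: mlf_def dualW_add_fun)

lemma mlf_scale: "mlf t \<Longrightarrow> mlf (\<lambda>vs. c * t vs)"
  by (simp add: mlf_def dualW_mult_fun)

lemma mlf_sum: "(\<And>b. b \<in> Y \<Longrightarrow> mlf (T b)) \<Longrightarrow> mlf (\<lambda>vs. \<Sum>b\<in>Y. T b vs)"
  by (simp add: mlf_def dualW_sum_fun)

lemma hs_jet_zero: "hs_jet (\<lambda>_. 0)"
  by (intro hs_jetI mlf_zero) (use hs_le_zero in blast)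

lemma hs_jet_add: "hs_jet s \<Longrightarrow> hs_jet t \<Longrightarrow> hs_jet (\<lambda>vs. s vs + t vs)"
proof (rule hs_jetI)
  assume s: "hs_jet s" and t: "hs_jet t"
  show "mlf (\<lambda>vs. s vs + t vs)" by (rule mlf_add[OF hs_jetD[OF s] hs_jetD[OF t]])
  show "\<exists>C. hs_le n (\<lambda>vs. s vs + t vs) C" for n
    using hs_le_add[OF hs_jet_le[OF s] hs_jet_le[OF t]] by blast
qed

lemma hs_jet_scale: "hs_jet t \<Longrightarrow> hs_jet (\<lambda>vs. c * t vs)"
proof (rule hs_jetI)
  assume t: "hs_jet t"
  show "mlf (\<lambda>vs. c * t vs)" by (rule mlf_scale[OF hs_jetD[OF t]])
  show "\<exists>C. hs_le n (\<lambda>vs. c * t vs) C" for n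
    using hs_le_scale[OF hs_jet_le[OF t]] by blast
qed

lemma hs_jet_sum: "(\<And>b. b \<in> Y \<Longrightarrow> hs_jet (T b)) \<Longrightarrow> hs_jet (\<lambda>vs. \<Sum>b\<in>Y. T b vs)"
  by (induction Y rule: infinite_finite_induct) (auto intro: hs_jet_zero hs_jet_add)

text \<open>The variable x is a parameter of the form s and not a slot, because the recursion
  replaces s itself.\<close>

lemma leibniz_slot:
  assumes "\<And>us. (\<lambda>x. s x us) \<in> dualW S"
  shows "(\<lambda>x. leibniz (s x) t vs) \<in> dualW S"
  using assms
proof (induction vs arbitrary: s t)
  case Nil
  then show ?case using dualW_mult_fun[of "\<lambda>x. s x []" "t []"] by (simp add: mult.commute)
qed (auto intro!: dualW_add_fun)

lemma leibniz_commute: "leibniz s t vs = leibniz t s vs"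
  by (induction vs arbitrary: s t) (auto simp: algebra_simps)

lemma mlf_leibniz:
  assumes "mlf s" "mlf t"
  shows "mlf (leibniz s t)"
proof -
  have "(\<lambda>x. leibniz s t (us @ x # vs)) \<in> dualW S" for us vs
    using assms
  proof (induction us arbitrary: s t)
    case Nil
    have "(\<lambda>x. leibniz s (\<lambda>us. t (x # us)) vs) \<in> dualW S"
      using leibniz_slot[of "\<lambda>x us. t (x # us)" s vs] Nil
      by (simp add: leibniz_commute[of s] mlf_hd)
    moreover have "(\<lambda>x. leibniz (\<lambda>us. s (x # us)) t vs) \<in> dualW S"
      using leibniz_slot[of "\<lambda>x us. s (x # us)" t vs] Nil by (simp add: mlf_hd)
    ultimately show ?case by (simp add: dualW_add_fun)
  next
    case (Cons u us)
    then show ?case by (auto intro!: dualW_add_fun dest: mlf_front)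
  qed
  then show ?thesis by (simp add: mlf_def)
qed

text \<open>Each order costs a factor 4 in the squares: 2 from
  \<open>(a + b)\<^sup>2 \<le> 2 * (a\<^sup>2 + b\<^sup>2)\<close>, and 2 because either branch of
  the product rule contributes a full product of jet norms.\<close>

lemma hs_le_leibniz:
  assumes "hs_jet s" "hs_jet t"
  shows "hs_le n (leibniz s t) (2 ^ n * (jnorm n s * jnorm n t))"
  using assms
proof (induction n arbitrary: s t)
  case 0
  have "tnorm 0 u = norm (u [])" for u :: "('h \<times> 'd) list \<Rightarrow> 'k"
    by (simp add: tensor_norm_def)
  then show ?case by (simp add: hs_le_0_iff jnorm_def norm_mult)
next
  case (Suc n)
  let ?c = "\<lambda>\<alpha>. 2 ^ n * (jnorm n (\<lambda>us. s (eW \<alpha> # us)) * jnorm n t) + 2 ^ n * (jnorm n s * jnorm n (\<lambda>us. t (eW \<alpha> # us)))"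
  show ?case
  proof (rule hs_le_Suc)
    show "hs_le n (\<lambda>vs. leibniz s t (eW \<alpha> # vs)) (?c \<alpha>)" for \<alpha>
      using hs_le_add[OF Suc.IH[OF hs_jet_front[OF Suc.prems(1), of "eW \<alpha>"] Suc.prems(2)]
          Suc.IH[OF Suc.prems(1) hs_jet_front[OF Suc.prems(2), of "eW \<alpha>"]]] by simp
    fix Y :: "(bool \<times> nat) set" assume Y: "finite Y"
    let ?s = "\<lambda>\<alpha>. (jnorm n (\<lambda>us. s (eW \<alpha> # us)))\<^sup>2" and ?t = "\<lambda>\<alpha>. (jnorm n (\<lambda>us. t (eW \<alpha> # us)))\<^sup>2"
    let ?P = "(jnorm (Suc n) s)\<^sup>2" and ?Q = "(jnorm (Suc n) t)\<^sup>2"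
    have s: "sum ?s Y \<le> ?P" and t: "sum ?t Y \<le> ?Q"
      using sum_jnorm_front_le[OF Suc.prems(1) bessel_eW Y, of n] sum_jnorm_front_le[OF Suc.prems(2) bessel_eW Y, of n]
      by simp_all
    have PQ: "(jnorm n s)\<^sup>2 \<le> ?P" "(jnorm n t)\<^sup>2 \<le> ?Q"
      using jnorm_mono[of n "Suc n"] by (auto intro!: power_mono)
    have "(?c \<alpha>)\<^sup>2 \<le> 2 * (2 ^ n)\<^sup>2 * (?s \<alpha> * ?Q + ?P * ?t \<alpha>)" for \<alpha>
    proof -
      have q: "(a + b)\<^sup>2 \<le> 2 * (a\<^sup>2 + b\<^sup>2)" for a b :: real
        using sum_squares_bound[of a b] by (simp add: power2_sum)
      have "(?c \<alpha>)\<^sup>2 \<le> 2 * ((2 ^ n * (jnorm n (\<lambda>us. s (eW \<alpha> # us)) * jnorm n t))\<^sup>2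
          + (2 ^ n * (jnorm n s * jnorm n (\<lambda>us. t (eW \<alpha> # us))))\<^sup>2)"
        by (rule q)
      also have "\<dots> = 2 * (2 ^ n)\<^sup>2 * (?s \<alpha> * (jnorm n t)\<^sup>2 + (jnorm n s)\<^sup>2 * ?t \<alpha>)"
        by (simp add: power_mult_distrib distrib_left mult_ac)
      also have "\<dots> \<le> 2 * (2 ^ n)\<^sup>2 * (?s \<alpha> * ?Q + ?P * ?t \<alpha>)"
        using PQ by (intro mult_left_mono add_mono mult_right_mono) auto
      finally show ?thesis .
    qed
    then have "(\<Sum>\<alpha>\<in>Y. (?c \<alpha>)\<^sup>2) \<le> (\<Sum>\<alpha>\<in>Y. 2 * (2 ^ n)\<^sup>2 * (?s \<alpha> * ?Q + ?P * ?t \<alpha>))"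
      by (rule sum_mono)
    also have "\<dots> = 2 * (2 ^ n)\<^sup>2 * (sum ?s Y * ?Q + ?P * sum ?t Y)"
      by (simp only: sum_distrib_left[symmetric] sum_distrib_right[symmetric] sum.distrib)
    also have "\<dots> \<le> 2 * (2 ^ n)\<^sup>2 * (?P * ?Q + ?P * ?Q)"
      using s t by (intro mult_left_mono add_mono mult_right_mono) auto
    also have "\<dots> = (2 ^ Suc n * (jnorm (Suc n) s * jnorm (Suc n) t))\<^sup>2"
      by (simp add: power_mult_distrib)
    finally show "(\<Sum>\<alpha>\<in>Y. (?c \<alpha>)\<^sup>2) \<le> (2 ^ Suc n * (jnorm (Suc n) s * jnorm (Suc n) t))\<^sup>2" .
  qed simp
qed

definition length_part :: "nat \<Rightarrow> (('h \<times> 'd) list \<Rightarrow> 'k) \<Rightarrow> ('h \<times> 'd) list \<Rightarrow> 'k" where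
  "length_part n t vs = (if length vs = n then t vs else 0)"

lemma hs_jet_tensor_power: "t \<in> tensor_power S n \<Longrightarrow> hs_jet t"
proof -
  assume t: "t \<in> tensor_power S n"
  then have z: "\<And>vs. length vs \<noteq> n \<Longrightarrow> t vs = 0" and m: "multilinear S n t" and s: "sq n t"
    by (auto simp: tensor_power_def)
  obtain C where C: "\<And>vs. length vs = n \<Longrightarrow> norm (t vs) \<le> C * prod_list (map norm vs)"
    using t by (auto simp: tensor_power_def)
  have "mlf t"
    unfolding mlf_def
  proof (intro allI)
    fix us vs
    show "(\<lambda>x. t (us @ x # vs)) \<in> dualW S"
    proof (cases "length us + 1 + length vs = n")
      case True
      then have l: "Vector_Spaces.linear (scaleW S) (*) (\<lambda>x. t (us @ x # vs))"
        using m by (simp add: multilinear_def)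
      have "norm (t (us @ x # vs)) \<le> norm x * (C * prod_list (map norm us) * prod_list (map norm vs))" for x
        using C[of "us @ x # vs"] True by (simp add: mult_ac)
      then show ?thesis using l by (auto simp: dualW_iff Vector_Spaces.linear_iff)
    next
      case False
      then have "(\<lambda>x. t (us @ x # vs)) = (\<lambda>_. 0)" by (auto simp: z)
      then show ?thesis by (simp only: dualW_zero)
    qed
  qed
  moreover have "\<exists>C. hs_le k t C" for k
  proof (cases "k = n")
    case False
    then have "hs_le k t 0 \<longleftrightarrow> hs_le k (\<lambda>_. 0) 0" by (intro hs_le_cong) (simp add: z)
    then show ?thesis using hs_le_zero by blast
  qed (use s hs_le_tnorm in blast)
  ultimately show "hs_jet t" by (rule hs_jetI)
qed

lemma length_part_tensor_power:
  assumes "mlf t" "sq n t"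
  shows "length_part n t \<in> tensor_power S n"
proof -
  have "multilinear S n (length_part n t)"
    using mlf_slot[OF assms(1)] by (auto simp: multilinear_def length_part_def dualW_def)
  moreover have "\<exists>C. \<forall>vs. length vs = n \<longrightarrow> norm (length_part n t vs) \<le> C * prod_list (map norm vs)"
    using norm_le_of_hs_le[OF assms(1)] hs_le_tnorm[OF assms(2)]
    by (intro exI[of _ "tnorm n t"]) (auto simp: length_part_def)
  moreover have "sq n (length_part n t)"
    using assms(2) by (rule summable_on_cong[THEN iffD1, rotated]) (simp add: length_part_def)
  ultimately show ?thesis by (auto simp: tensor_power_def length_part_def)
qed

lemma nth_deriv_eq_length_part: "nth_deriv n F w = length_part n (deriv_form F w)"
  by (auto simp: nth_deriv_def length_part_def fun_eq_iff)

end

section \<open>Functions of Hilbert-Schmidt type\<close>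

lemma vector_derivative_bound:
  fixes f :: "real \<Rightarrow> 'b::real_normed_vector"
  assumes "\<And>r. r \<in> {0..1} \<Longrightarrow> (f has_vector_derivative f' r) (at r within {0..1})"
    and "\<And>r. r \<in> {0..1} \<Longrightarrow> norm (f' r) \<le> B" and "a \<in> {0..1}" "b \<in> {0..1}"
  shows "norm (f b - f a) \<le> B * \<bar>b - a\<bar>"
proof -
  have "norm (f b - f a) \<le> B * norm (b - a)"
  proof (rule differentiable_bound[of "{0..1}" f "\<lambda>r h. h *\<^sub>R f' r"])
    show "(f has_derivative (\<lambda>h. h *\<^sub>R f' r)) (at r within {0..1})" if "r \<in> {0..1}" for r
      using assms(1)[OF that] by (simp add: has_vector_derivative_def)
    show "onorm (\<lambda>h. h *\<^sub>R f' r) \<le> B" if "r \<in> {0..1}" for r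
    proof (rule onorm_le)
      show "norm (h *\<^sub>R f' r) \<le> B * norm h" for h
        using mult_right_mono[OF assms(2)[OF that], of "norm h"] by (simp add: mult.commute)
    qed
  qed (use assms in auto)
  then show ?thesis by simp
qed

text \<open>Two applications of the mean value inequality, to the first derivative and to f minus
  its linear part; this gives the crude constant B instead of B / 2.\<close>

lemma taylor_second_order:
  fixes f :: "real \<Rightarrow> 'b::real_normed_vector"
  assumes f: "\<And>r. r \<in> {0..1} \<Longrightarrow> (f has_vector_derivative f' r) (at r within {0..1})"
    and f': "\<And>r. r \<in> {0..1} \<Longrightarrow> (f' has_vector_derivative f'' r) (at r within {0..1})"
    and B: "\<And>r. r \<in> {0..1} \<Longrightarrow> norm (f'' r) \<le> B"
  shows "norm (f 1 - f 0 - f' 0) \<le> B"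
proof -
  have "0 \<le> B" using order_trans[OF norm_ge_zero B[of 0]] by simp
  have *: "norm (f' r - f' 0) \<le> B" if "r \<in> {0..1}" for r
  proof -
    have "norm (f' r - f' 0) \<le> B * \<bar>r - 0\<bar>"
      by (rule vector_derivative_bound[OF f' B]) (use that in auto)
    also have "\<dots> \<le> B * 1" by (rule mult_left_mono) (use that \<open>0 \<le> B\<close> in auto)
    finally show ?thesis by simp
  qed
  have "norm ((f 1 - 1 *\<^sub>R f' 0) - (f 0 - 0 *\<^sub>R f' 0)) \<le> B * \<bar>1 - 0\<bar>"
  proof (rule vector_derivative_bound[where f = "\<lambda>r. f r - r *\<^sub>R f' 0" and f' = "\<lambda>r. f' r - f' 0"])
    show "((\<lambda>r. f r - r *\<^sub>R f' 0) has_vector_derivative (f' r - f' 0)) (at r within {0..1})" if "r \<in> {0..1}" for r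
    proof -
      have "((\<lambda>r. r *\<^sub>R f' 0) has_vector_derivative f' 0) (at r within {0..1})"
        unfolding has_vector_derivative_def by (auto intro!: derivative_eq_intros)
      then show ?thesis using f[OF that] by (rule has_vector_derivative_diff[rotated])
    qed
  qed (use * in auto)
  then show ?thesis by (simp add: algebra_simps)
qed

lemma has_vector_derivative_at_0I:
  fixes f :: "real \<Rightarrow> 'b::real_normed_vector"
  assumes "0 < \<delta>" and "\<And>r. \<bar>r\<bar> < \<delta> \<Longrightarrow> norm (f r - f 0 - r *\<^sub>R D) \<le> K * r\<^sup>2"
  shows "(f has_vector_derivative D) (at 0)"
  unfolding has_vector_derivative_def has_derivative_at_alt
proof (intro conjI allI impI)
  show "bounded_linear (\<lambda>x. x *\<^sub>R D)" by (rule bounded_linear_scaleR_left)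
  fix \<epsilon> :: real assume "0 < \<epsilon>"
  \<comment> \<open>K may be negative or zero, hence the denominator with its absolute value plus
    1.\<close>
  let ?d = "min \<delta> (\<epsilon> / (\<bar>K\<bar> + 1))"
  have "norm (f r - f 0 - r *\<^sub>R D) \<le> \<epsilon> * \<bar>r\<bar>" if "\<bar>r\<bar> < ?d" for r
  proof -
    have "\<bar>r\<bar> * (\<bar>K\<bar> + 1) \<le> \<epsilon>" using that by (simp add: field_simps)
    have "norm (f r - f 0 - r *\<^sub>R D) \<le> K * r\<^sup>2" using assms(2) that by simp
    also have "\<dots> \<le> (\<bar>K\<bar> + 1) * r\<^sup>2" by (rule mult_right_mono) auto
    also have "\<dots> = (\<bar>r\<bar> * (\<bar>K\<bar> + 1)) * \<bar>r\<bar>" by (simp add: power2_eq_square)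
    also have "\<dots> \<le> \<epsilon> * \<bar>r\<bar>" by (rule mult_right_mono) (use \<open>\<bar>r\<bar> * (\<bar>K\<bar> + 1) \<le> \<epsilon>\<close> in auto)
    finally show ?thesis .
  qed
  then show "\<exists>d>0. \<forall>r. norm (r - 0) < d \<longrightarrow> norm (f r - f 0 - (r - 0) *\<^sub>R D) \<le> \<epsilon> * norm (r - 0)"
    using \<open>0 < \<epsilon>\<close> \<open>0 < \<delta>\<close> by (intro exI[of _ ?d]) (auto simp: add_nonneg_pos)
qed

declare split_paired_All [simp del] split_paired_Ex [simp del]

context phase_space
begin

text \<open>
  A family \<open>G\<close> of candidates for the derivatives of \<open>\<lambda>w. G w []\<close>. Derivatives along lines suffice,
  because the local bounds turn them into a second order Taylor estimate that is uniform in the direction.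
\<close>

definition hs_field :: "('h \<times> 'd \<Rightarrow> ('h \<times> 'd) list \<Rightarrow> 'k) \<Rightarrow> bool" where
  "hs_field G \<longleftrightarrow> (\<forall>w. mlf (G w)) \<and>
     (\<forall>w h vs. ((\<lambda>r. G (w + r *\<^sub>R h) vs) has_vector_derivative G w (h # vs)) (at 0)) \<and>
     (\<forall>n w. \<exists>\<rho>>0. \<exists>C. \<forall>w'\<in>ball w \<rho>. hs_le n (G w') C)"

lemma line_derivative:
  fixes G :: "'h \<times> 'd \<Rightarrow> ('h \<times> 'd) list \<Rightarrow> 'k"
  assumes "\<And>w h vs. ((\<lambda>r. G (w + r *\<^sub>R h) vs) has_vector_derivative G w (h # vs)) (at 0)"
  shows "((\<lambda>r. G (w + r *\<^sub>R h) vs) has_vector_derivative G (w + r0 *\<^sub>R h) (h # vs)) (at r0 within A)"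
proof (rule has_vector_derivative_at_within)
  have 1: "((\<lambda>r::real. r - r0) has_vector_derivative 1) (at r0)"
    by (auto intro!: derivative_eq_intros)
  have eq: "w + r0 *\<^sub>R h + (r - r0) *\<^sub>R h = w + r *\<^sub>R h" for r
    by (simp add: algebra_simps)
  have 2: "((\<lambda>r. G ((w + r0 *\<^sub>R h) + r *\<^sub>R h) vs) has_vector_derivative G (w + r0 *\<^sub>R h) (h # vs)) (at (r0 - r0))"
    using assms by simp
  show "((\<lambda>r. G (w + r *\<^sub>R h) vs) has_vector_derivative G (w + r0 *\<^sub>R h) (h # vs)) (at r0)"
    using vector_diff_chain_at[OF 1 2] by (simp add: o_def eq)
qed

lemma hs_field_mlf: "hs_field G \<Longrightarrow> mlf (G w)"
  by (simp add: hs_field_def)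

lemma hs_field_bounded: "hs_field G \<Longrightarrow> \<exists>\<rho>>0. \<exists>C. \<forall>w'\<in>ball w \<rho>. hs_le n (G w') C"
  by (simp add: hs_field_def)

lemma hs_field_jet: "hs_field G \<Longrightarrow> hs_jet (G w)"
  by (rule hs_jetI[OF hs_field_mlf]) (use hs_field_bounded centre_in_ball in blast)+

text \<open>On the segment from w to w + h the second derivative is the form in h, h and vs, so a
  bound two orders higher controls the error uniformly in h and vs. The ingredients of
  \<open>hs_field\<close> are assumed separately because the lemma also serves the partial sums of a
  series, with one C for all of them.\<close>

lemma remainder_bound:
  assumes m: "\<And>w. mlf (G w)"
    and d: "\<And>w h vs. ((\<lambda>r. G (w + r *\<^sub>R h) vs) has_vector_derivative G w (h # vs)) (at 0)"
    and b: "\<And>w'. w' \<in> ball w \<rho> \<Longrightarrow> hs_le (Suc (Suc (length vs))) (G w') C" and h: "norm h < \<rho>"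
  shows "norm (G (w + h) vs - G w vs - G w (h # vs)) \<le> C * (norm h)\<^sup>2 * prod_list (map norm vs)"
proof -
  have "norm (G (w + 1 *\<^sub>R h) vs - G (w + 0 *\<^sub>R h) vs - G (w + 0 *\<^sub>R h) (h # vs))
      \<le> C * (norm h)\<^sup>2 * prod_list (map norm vs)"
  proof (rule taylor_second_order)
    fix r :: real assume r: "r \<in> {0..1}"
    then have "\<bar>r\<bar> * norm h \<le> 1 * norm h" by (intro mult_right_mono) auto
    then have "w + r *\<^sub>R h \<in> ball w \<rho>" using h by (simp add: dist_norm)
    from norm_le_of_hs_le[OF m, of "h # h # vs"] b[OF this]
    show "norm (G (w + r *\<^sub>R h) (h # h # vs)) \<le> C * (norm h)\<^sup>2 * prod_list (map norm vs)"
      by (simp add: power2_eq_square mult.assoc)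
  qed (rule line_derivative[OF d])+
  then show ?thesis by simp
qed

lemma hs_field_remainder:
  assumes "hs_field G"
  obtains \<rho> C where "0 < \<rho>" "0 \<le> C"
    "\<And>(h :: 'h \<times> 'd) vs. norm h < \<rho> \<Longrightarrow> length vs = n \<Longrightarrow>
      norm (G (w + h) vs - G w vs - G w (h # vs)) \<le> C * (norm h)\<^sup>2 * prod_list (map norm vs)"
proof -
  obtain \<rho> C where \<rho>: "0 < \<rho>" "\<And>w'. w' \<in> ball w \<rho> \<Longrightarrow> hs_le (Suc (Suc n)) (G w') C"
    using hs_field_bounded[OF assms, where n = "Suc (Suc n)" and w = w] by blast
  show thesis
  proof (rule that[of \<rho> C])
    show "0 \<le> C" using hs_le_nonneg[OF \<rho>(2)[of w]] \<rho>(1) by simp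
    fix h :: "'h \<times> 'd" and vs :: "('h \<times> 'd) list" assume *: "norm h < \<rho>" "length vs = n"
    show "norm (G (w + h) vs - G w vs - G w (h # vs)) \<le> C * (norm h)\<^sup>2 * prod_list (map norm vs)"
      by (rule remainder_bound[of G w \<rho>]) (use assms \<rho> * in \<open>auto simp: hs_field_def\<close>)
  qed (rule \<rho>(1))
qed

lemma prod_list_norm_nonneg: "0 \<le> prod_list (map norm vs)"
  by (rule prod_list_nonneg) auto

lemma hs_field_uniform:
  assumes "hs_field G" "0 < \<epsilon>"
  shows "\<exists>\<delta>>0. \<forall>h. norm h < \<delta> \<longrightarrow> (\<forall>vs. length vs = n \<longrightarrow>
    norm (G (w + h) vs - G w vs - G w (h # vs)) \<le> \<epsilon> * norm h * prod_list (map norm vs))"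
proof -
  obtain \<rho> C where \<rho>: "0 < \<rho>" "0 \<le> C"
    "\<And>(h :: 'h \<times> 'd) vs. norm h < \<rho> \<Longrightarrow> length vs = n \<Longrightarrow>
      norm (G (w + h) vs - G w vs - G w (h # vs)) \<le> C * (norm h)\<^sup>2 * prod_list (map norm vs)"
    using hs_field_remainder[OF assms(1)] by blast
  show ?thesis
  proof (intro exI[of _ "min \<rho> (\<epsilon> / (C + 1))"] conjI allI impI)
    show "0 < min \<rho> (\<epsilon> / (C + 1))" using \<rho> assms(2) by simp
    fix h :: "'h \<times> 'd" and vs :: "('h \<times> 'd) list" assume h: "norm h < min \<rho> (\<epsilon> / (C + 1))" and vs: "length vs = n"
    have "norm h * (C + 1) \<le> \<epsilon>" using h \<rho>(2) by (simp add: field_simps)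
    then have "C * norm h \<le> \<epsilon>" using norm_ge_zero[of h] by (simp add: algebra_simps del: norm_ge_zero)
    then have "(C * norm h) * norm h * prod_list (map norm vs) \<le> \<epsilon> * norm h * prod_list (map norm vs)"
      by (intro mult_right_mono prod_list_norm_nonneg) auto
    then show "norm (G (w + h) vs - G w vs - G w (h # vs)) \<le> \<epsilon> * norm h * prod_list (map norm vs)"
      using \<rho>(3)[of h vs] h vs by (simp add: power2_eq_square mult.assoc)
  qed
qed

lemma has_derivative_of_uniform:
  assumes "(\<lambda>h. G w (h # vs)) \<in> dualW S"
    and "\<And>\<epsilon>. 0 < \<epsilon> \<Longrightarrow> \<exists>\<delta>>0. \<forall>h. norm h < \<delta> \<longrightarrow>
      norm (G (w + h) vs - G w vs - G w (h # vs)) \<le> \<epsilon> * norm h * P" and "0 \<le> P"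
  shows "((\<lambda>x. G x vs) has_derivative (\<lambda>h. G w (h # vs))) (at w)"
  unfolding has_derivative_at_alt
proof (intro conjI allI impI)
  show "bounded_linear (\<lambda>h. G w (h # vs))" by (rule dualW_bounded[OF assms(1)])
  fix \<epsilon> :: real assume "0 < \<epsilon>"
  then have "0 < \<epsilon> / (P + 1)" using \<open>0 \<le> P\<close> by simp
  then obtain \<delta> where \<delta>: "\<delta> > 0" "\<And>h. norm h < \<delta> \<Longrightarrow>
      norm (G (w + h) vs - G w vs - G w (h # vs)) \<le> \<epsilon> / (P + 1) * norm h * P"
    using assms(2)[of "\<epsilon> / (P + 1)"] by blast
  have "\<epsilon> / (P + 1) * norm h * P \<le> \<epsilon> * norm h" for h :: "'h \<times> 'd"
  proof -
    have "\<epsilon> * P \<le> \<epsilon> * (P + 1)" using \<open>0 < \<epsilon>\<close> by simp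
    then have "\<epsilon> * P / (P + 1) \<le> \<epsilon>" using \<open>0 \<le> P\<close> by (simp add: divide_le_eq)
    then have "(\<epsilon> * P / (P + 1)) * norm h \<le> \<epsilon> * norm h" by (rule mult_right_mono) simp
    then show ?thesis by (simp add: mult_ac)
  qed
  then have "norm (G y vs - G w vs - G w ((y - w) # vs)) \<le> \<epsilon> * norm (y - w)" if "norm (y - w) < \<delta>" for y
    using \<delta>(2)[OF that] order_trans by fastforce
  then show "\<exists>d>0. \<forall>y. norm (y - w) < d \<longrightarrow> norm (G y vs - G w vs - G w ((y - w) # vs)) \<le> \<epsilon> * norm (y - w)"
    using \<delta>(1) by blast
qed

lemma hs_field_has_derivative:
  assumes "hs_field G"
  shows "((\<lambda>x. G x vs) has_derivative (\<lambda>h. G w (h # vs))) (at w)"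
proof (rule has_derivative_of_uniform[OF mlf_hd[OF hs_field_mlf[OF assms]]])
  show "\<exists>\<delta>>0. \<forall>h. norm h < \<delta> \<longrightarrow>
      norm (G (w + h) vs - G w vs - G w (h # vs)) \<le> \<epsilon> * norm h * prod_list (map norm vs)" if "0 < \<epsilon>" for \<epsilon>
    using hs_field_uniform[OF assms that, of "length vs" w] by blast
qed (rule prod_list_norm_nonneg)

text \<open>Uniqueness of the Frechet derivative, one vector at a time, identifies the candidates
  with the iterated derivatives. Closure properties of functions of Hilbert-Schmidt type are thereby
  proved by exhibiting candidates.\<close>

lemma hs_field_deriv_form:
  assumes "hs_field G"
  shows "deriv_form (\<lambda>w. G w []) w vs = G w vs"
proof (induction vs arbitrary: w)
  case (Cons v vs)
  have "frechet_derivative (\<lambda>x. G x vs) (at w) = (\<lambda>h. G w (h # vs))"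
    using frechet_derivative_at[OF hs_field_has_derivative[OF assms]] by simp
  then show ?case by (simp add: Cons.IH)
qed simp

section \<open>Comparison of \<open>hs_field\<close> with \<open>hs_functions\<close>\<close>

lemma inj_on_zip: "inj_on (zip ss) {is. length is = length ss}"
  by (rule inj_on_inverseI[of _ "map snd"]) simp

lemma hs_le_signs:
  assumes "hs_le n t C" "length ss = n"
  shows "(\<lambda>is. (norm (t (map2 (basisW S) ss is)))\<^sup>2) summable_on {is. length is = n}"
    and "(\<Sum>\<^sub>\<infinity>is | length is = n. (norm (t (map2 (basisW S) ss is)))\<^sup>2) \<le> C\<^sup>2"
proof -
  have *: "(\<Sum>is\<in>X. (norm (t (map2 (basisW S) ss is)))\<^sup>2) \<le> C\<^sup>2" if "finite X" "X \<subseteq> {is. length is = n}" for X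
  proof -
    have "(\<Sum>is\<in>X. (norm (t (map2 (basisW S) ss is)))\<^sup>2) = (\<Sum>is\<in>zip ss ` X. (norm (t (map eW is)))\<^sup>2)"
      by (subst sum.reindex) (use inj_on_subset[OF inj_on_zip] that assms(2) in auto)
    also have "\<dots> \<le> C\<^sup>2"
      using assms that unfolding hs_le_def by (elim conjE allE[where x = "zip ss ` X"] impE) auto
    finally show ?thesis .
  qed
  show 1: "(\<lambda>is. (norm (t (map2 (basisW S) ss is)))\<^sup>2) summable_on {is. length is = n}"
    by (rule nonneg_bdd_above_summable_on) (use * in \<open>auto intro!: bdd_aboveI[of _ "C\<^sup>2"]\<close>)
  show "(\<Sum>\<^sub>\<infinity>is | length is = n. (norm (t (map2 (basisW S) ss is)))\<^sup>2) \<le> C\<^sup>2"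
    by (rule infsum_le_finite_sums[OF 1]) (use * in auto)
qed

lemma hs_field_hs_functions:
  assumes "hs_field G"
  shows "(\<lambda>w. G w []) \<in> hs_functions S"
proof -
  note eq = hs_field_deriv_form[OF assms]
  have m: "multilinear S n (G w)" for n w
    using mlf_slot[OF hs_field_mlf[OF assms]] by (auto simp: multilinear_def dualW_def)
  have b: "\<exists>C. \<forall>vs. length vs = n \<longrightarrow> norm (G w vs) \<le> C * prod_list (map norm vs)" for n w
  proof (intro exI[of _ "tnorm n (G w)"] allI impI)
    fix vs :: "('h \<times> 'd) list" assume "length vs = n"
    then show "norm (G w vs) \<le> tnorm n (G w) * prod_list (map norm vs)"
      using norm_le_of_hs_le[OF hs_field_mlf[OF assms, of w] hs_jet_le[OF hs_field_jet[OF assms]], of vs] by simp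
  qed
  have "(\<lambda>w. G w []) \<in> smooth_functions S"
    unfolding smooth_functions_def smooth_map_def mem_Collect_eq eq
    using m b hs_field_uniform[OF assms] by simp
  moreover have "\<exists>\<rho>>0. \<exists>C. \<forall>w'\<in>ball w \<rho>.
      (\<Sum>\<^sub>\<infinity>is | length is = length ss. (norm (G w' (map2 (basisW S) ss is)))\<^sup>2) \<le> C" for ss w
  proof -
    obtain \<rho> C where "0 < \<rho>" "\<And>w'. w' \<in> ball w \<rho> \<Longrightarrow> hs_le (length ss) (G w') C"
      using hs_field_bounded[OF assms, where n = "length ss" and w = w] by blast
    then show ?thesis using hs_le_signs(2)[OF _ refl] by blast
  qed
  ultimately show ?thesis
    unfolding hs_functions_def mem_Collect_eq eq
    using hs_le_signs(1)[OF hs_jet_le[OF hs_field_jet[OF assms]] refl] by blast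
qed

text \<open>There are finitely many sign patterns of length n; grouping the index lists by their
  pattern adds the bounds up.\<close>

lemma hs_le_of_signs:
  assumes "\<And>ss. length ss = n \<Longrightarrow>
      (\<lambda>is. (norm (t (map2 (basisW S) ss is)))\<^sup>2) summable_on {is. length is = n} \<and>
      (\<Sum>\<^sub>\<infinity>is | length is = n. (norm (t (map2 (basisW S) ss is)))\<^sup>2) \<le> C ss"
  shows "hs_le n t (sqrt (\<Sum>ss | length ss = n. C ss))"
proof -
  have fin: "finite {ss :: bool list. length ss = n}"
    using finite_lists_length_eq[of "UNIV :: bool set" n] by simp
  have C0: "0 \<le> C ss" if "length ss = n" for ss
    by (rule order_trans[OF _ conjunct2[OF assms[OF that]]]) (rule infsum_nonneg, simp)
  have *: "(\<Sum>is\<in>X. (norm (t (map eW is)))\<^sup>2) \<le> (\<Sum>ss | length ss = n. C ss)"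
    if X: "finite X" "X \<subseteq> {is. length is = n}" for X
  proof -
    have "(\<Sum>is\<in>X. (norm (t (map eW is)))\<^sup>2)
        = (\<Sum>ss | length ss = n. \<Sum>is | is \<in> X \<and> map fst is = ss. (norm (t (map eW is)))\<^sup>2)"
      by (rule sum.group[symmetric]) (use X fin in auto)
    also have "\<dots> \<le> (\<Sum>ss | length ss = n. C ss)"
    proof (rule sum_mono)
      fix ss assume "ss \<in> {ss :: bool list. length ss = n}"
      then have ss: "length ss = n" by simp
      have inj: "inj_on (map snd) {is. is \<in> X \<and> map fst is = ss}"
        by (rule inj_on_inverseI[of _ "zip ss"]) (auto simp: zip_map_fst_snd)
      have "(\<Sum>is | is \<in> X \<and> map fst is = ss. (norm (t (map eW is)))\<^sup>2)
          = (\<Sum>is\<in>map snd ` {is. is \<in> X \<and> map fst is = ss}. (norm (t (map2 (basisW S) ss is)))\<^sup>2)"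
        by (subst sum.reindex[OF inj]) (auto simp: zip_map_fst_snd intro!: sum.cong)
      also have "\<dots> \<le> (\<Sum>\<^sub>\<infinity>is | length is = n. (norm (t (map2 (basisW S) ss is)))\<^sup>2)"
        by (rule finite_sum_le_infsum) (use assms[OF ss] X in auto)
      also have "\<dots> \<le> C ss" using assms[OF ss] by simp
      finally show "(\<Sum>is | is \<in> X \<and> map fst is = ss. (norm (t (map eW is)))\<^sup>2) \<le> C ss" .
    qed
    finally show ?thesis .
  qed
  have "0 \<le> (\<Sum>ss | length ss = n. C ss)" by (rule sum_nonneg) (use C0 in auto)
  then show ?thesis using * by (simp add: hs_le_def)
qed

lemma hs_functions_hs_field:
  assumes F: "F \<in> hs_functions S"
  shows "hs_field (deriv_form F)"
proof -
  have sm: "smooth_map S {()} (\<lambda>_. 1) (\<lambda>w _. F w)"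
    using F by (simp add: hs_functions_def smooth_functions_def)
  have ml: "multilinear S n (deriv_form F w)"
    and bd: "\<exists>C. \<forall>vs. length vs = n \<longrightarrow> norm (deriv_form F w vs) \<le> C * prod_list (map norm vs)"
    and un: "\<And>\<epsilon>. 0 < \<epsilon> \<Longrightarrow> \<exists>\<delta>>0. \<forall>h. norm h < \<delta> \<longrightarrow> (\<forall>vs. length vs = n \<longrightarrow>
      norm (deriv_form F (w + h) vs - deriv_form F w vs - deriv_form F w (h # vs)) \<le> \<epsilon> * norm h * prod_list (map norm vs))" for n w
    using sm unfolding smooth_map_def by auto
  have m: "mlf (deriv_form F w)" for w
    unfolding mlf_def
  proof (intro allI)
    fix us vs :: "('h \<times> 'd) list"
    let ?n = "length us + 1 + length vs"
    obtain C where C: "\<And>ws. length ws = ?n \<Longrightarrow> norm (deriv_form F w ws) \<le> C * prod_list (map norm ws)"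
      using bd[of ?n w] by blast
    have "norm (deriv_form F w (us @ x # vs)) \<le> norm x * (C * prod_list (map norm us) * prod_list (map norm vs))" for x
      using C[of "us @ x # vs"] by (simp add: mult_ac)
    moreover have "Vector_Spaces.linear (scaleW S) (*) (\<lambda>x. deriv_form F w (us @ x # vs))"
      using ml[of ?n w] unfolding multilinear_def by simp
    ultimately show "(\<lambda>x. deriv_form F w (us @ x # vs)) \<in> dualW S"
      unfolding dualW_iff Vector_Spaces.linear_iff by blast
  qed
  have der: "((\<lambda>x. deriv_form F x vs) has_derivative (\<lambda>h. deriv_form F w (h # vs))) (at w)" for w vs
  proof (rule has_derivative_of_uniform[OF mlf_hd[OF m]])
    show "\<exists>\<delta>>0. \<forall>h. norm h < \<delta> \<longrightarrow> norm (deriv_form F (w + h) vs - deriv_form F w vs - deriv_form F w (h # vs))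
        \<le> \<epsilon> * norm h * prod_list (map norm vs)" if "0 < \<epsilon>" for \<epsilon>
      using un[OF that, of "length vs" w] by blast
  qed (rule prod_list_norm_nonneg)
  have line: "((\<lambda>r. deriv_form F (w + r *\<^sub>R h) vs) has_vector_derivative deriv_form F w (h # vs)) (at 0)" for w h vs
  proof -
    have l: "((\<lambda>r. w + r *\<^sub>R h) has_derivative (\<lambda>r. r *\<^sub>R h)) (at 0)"
      by (auto intro!: derivative_eq_intros)
    have "((\<lambda>r. deriv_form F (w + r *\<^sub>R h) vs) has_derivative (\<lambda>r. deriv_form F w ((r *\<^sub>R h) # vs))) (at 0)"
      by (rule has_derivative_compose[OF l, of "\<lambda>x. deriv_form F x vs"]) (use der[of vs w] in simp)
    moreover have "deriv_form F w ((r *\<^sub>R h) # vs) = r *\<^sub>R deriv_form F w (h # vs)" for r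
      using linear_scale[OF bounded_linear.linear[OF dualW_bounded[OF mlf_hd[OF m]]]] .
    ultimately show ?thesis by (simp add: has_vector_derivative_def)
  qed
  have loc: "\<exists>\<rho>>0. \<exists>C. \<forall>w'\<in>ball w \<rho>. hs_le n (deriv_form F w') C" for n w
  \<comment> \<open>\<open>hs_functions\<close> constrains only nonempty patterns; in order 0 local
    boundedness comes from the continuity of F.\<close>
  proof (cases "n = 0")
    case True
    have "isCont F w" using has_derivative_continuous[OF der[of "[]" w]] by simp
    then obtain \<rho> where \<rho>: "\<rho> > 0" "\<And>w'. dist w' w < \<rho> \<Longrightarrow> dist (F w') (F w) < 1"
      unfolding continuous_at_eps_delta by (metis zero_less_one)
    have "hs_le 0 (deriv_form F w') (norm (F w) + 1)" if "w' \<in> ball w \<rho>" for w'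
    proof -
      have "norm (F w' - F w) < 1" using \<rho>(2)[of w'] that by (simp add: dist_norm norm_minus_commute)
      then show ?thesis using norm_triangle_sub[of "F w'" "F w"] by (simp add: hs_le_0_iff)
    qed
    then show ?thesis using True \<rho>(1) by blast
  next
    case False
    let ?B = "{ss :: bool list. length ss = n}"
    have fin: "finite ?B" using finite_lists_length_eq[of "UNIV :: bool set" n] by simp
    have ne: "?B \<noteq> {}" using Ex_list_of_length[of n] by auto
    have "\<forall>ss. \<exists>\<rho> C. length ss = n \<longrightarrow> \<rho> > 0 \<and> (\<forall>w'\<in>ball w \<rho>.
              (\<Sum>\<^sub>\<infinity>is | length is = n. (norm (deriv_form F w' (map2 (basisW S) ss is)))\<^sup>2) \<le> C)"
    proof
      fix ss :: "bool list"
      show "\<exists>\<rho> C. length ss = n \<longrightarrow> \<rho> > 0 \<and> (\<forall>w'\<in>ball w \<rho>.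
              (\<Sum>\<^sub>\<infinity>is | length is = n. (norm (deriv_form F w' (map2 (basisW S) ss is)))\<^sup>2) \<le> C)"
      proof (cases "length ss = n")
        case True
        then have "ss \<noteq> []" using False by auto
        then show ?thesis using F True unfolding hs_functions_def by blast
      qed auto
    qed
    then obtain \<rho> C where \<rho>: "\<And>ss. length ss = n \<Longrightarrow> \<rho> ss > 0 \<and> (\<forall>w'\<in>ball w (\<rho> ss).
              (\<Sum>\<^sub>\<infinity>is | length is = n. (norm (deriv_form F w' (map2 (basisW S) ss is)))\<^sup>2) \<le> C ss)"
      by metis
    have "hs_le n (deriv_form F w') (sqrt (\<Sum>ss\<in>?B. C ss))" if w': "w' \<in> ball w (Min (\<rho> ` ?B))" for w'
    proof (rule hs_le_of_signs)
      fix ss :: "bool list" assume ss: "length ss = n"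
      then have "ss \<noteq> []" using False by auto
      then have "(\<lambda>is. (norm (deriv_form F w' (map2 (basisW S) ss is)))\<^sup>2) summable_on {is. length is = n}"
        using F ss unfolding hs_functions_def by blast
      moreover have "Min (\<rho> ` ?B) \<le> \<rho> ss" using fin ss by (intro Min_le) auto
      then have "w' \<in> ball w (\<rho> ss)" using w' by auto
      ultimately show "(\<lambda>is. (norm (deriv_form F w' (map2 (basisW S) ss is)))\<^sup>2) summable_on {is. length is = n} \<and>
        (\<Sum>\<^sub>\<infinity>is | length is = n. (norm (deriv_form F w' (map2 (basisW S) ss is)))\<^sup>2) \<le> C ss"
        using \<rho>[OF ss] by blast
    qed
    moreover have "0 < Min (\<rho> ` ?B)" using fin ne \<rho> by (subst Min_gr_iff) auto
    ultimately show ?thesis by blast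
  qed
  show ?thesis using m line loc by (simp add: hs_field_def)
qed

end

section \<open>Symmetry of higher derivatives\<close>

lemma has_sum_diff_fun:
  fixes f g :: "'a \<Rightarrow> 'b::real_normed_vector"
  assumes "(f has_sum a) A" "(g has_sum b) A"
  shows "((\<lambda>x. f x - g x) has_sum (a - b)) A"
  using has_sum_add[OF assms(1) has_sum_bounded_linear[OF bounded_linear_minus[OF bounded_linear_ident] assms(2)]] by (simp add: o_def)

context phase_space
begin

text \<open>The norm measures how far the second difference in directions u and v is from the second
  derivative. Along u, the derivative of this error is a difference of two first order remainders,
  which gives the third power. The second difference is symmetric in u and v, and the symmetry of
  the form is to be read off from it.\<close>

lemma second_difference_bound:
  assumes G: "hs_field G"
  obtains \<rho> K where "0 < \<rho>" "0 \<le> K"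
    "\<And>u v. norm u + norm v < \<rho> \<Longrightarrow>
      norm (G (w + v + u) vs - G (w + u) vs - (G (w + v) vs - G w vs) - G w (v # u # vs)) \<le> K * (norm u + norm v) ^ 3"
proof -
  obtain \<rho> C where \<rho>: "0 < \<rho>" "0 \<le> C"
    "\<And>(h :: 'h \<times> 'd) us. norm h < \<rho> \<Longrightarrow> length us = Suc (length vs) \<Longrightarrow>
      norm (G (w + h) us - G w us - G w (h # us)) \<le> C * (norm h)\<^sup>2 * prod_list (map norm us)"
    using hs_field_remainder[OF G] by blast
  define P where "P = prod_list (map norm vs)"
  have P: "0 \<le> P" by (simp add: P_def prod_list_norm_nonneg)
  note line = line_derivative[of G, OF hs_field_def[THEN iffD1, OF G, THEN conjunct2, THEN conjunct1, rule_format]]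
  show thesis
  proof (rule that[of \<rho> "2 * (C * P)"])
    show "0 < \<rho>" by (rule \<rho>)
    show "0 \<le> 2 * (C * P)" using \<rho>(2) P by simp
    fix u v :: "'h \<times> 'd" assume uv: "norm u + norm v < \<rho>"
    let ?a = "norm u + norm v"
    let ?f = "\<lambda>r. G (w + v + r *\<^sub>R u) vs - G (w + r *\<^sub>R u) vs - r *\<^sub>R G w (v # u # vs)"
    let ?f' = "\<lambda>r. G (w + v + r *\<^sub>R u) (u # vs) - G (w + r *\<^sub>R u) (u # vs) - G w (v # u # vs)"
    have est: "norm (G (w + h) (u # vs) - G w (u # vs) - G w (h # u # vs)) \<le> C * ?a\<^sup>2 * (?a * P)" if "norm h \<le> ?a" for h
    proof -
      have "norm (G (w + h) (u # vs) - G w (u # vs) - G w (h # u # vs)) \<le> C * (norm h)\<^sup>2 * (norm u * P)"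
        using \<rho>(3)[of h "u # vs"] that uv by (simp add: P_def)
      also have "\<dots> \<le> C * ?a\<^sup>2 * (?a * P)"
        using that \<rho>(2) P by (intro mult_mono mult_nonneg_nonneg power_mono) auto
      finally show ?thesis .
    qed
    have "norm (?f 1 - ?f 0) \<le> 2 * (C * ?a\<^sup>2 * (?a * P)) * \<bar>1 - 0\<bar>"
    proof (rule vector_derivative_bound[where f = ?f and f' = ?f'])
      fix r :: real assume r: "r \<in> {0..1}"
      have "((\<lambda>r. r *\<^sub>R G w (v # u # vs)) has_vector_derivative G w (v # u # vs)) (at r within {0..1})"
        unfolding has_vector_derivative_def by (auto intro!: derivative_eq_intros)
      then show "(?f has_vector_derivative ?f' r) (at r within {0..1})"
        by (rule has_vector_derivative_diff[OF has_vector_derivative_diff[OF line line]])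
      have ru: "norm (r *\<^sub>R u) \<le> norm u"
        using r mult_right_mono[of "\<bar>r\<bar>" 1 "norm u"] by auto
      \<comment> \<open>Additivity in the first slot splits the linear term for the increment v + r
        u, so that its part along r u cancels between the two remainders.\<close>
      have "G w ((v + r *\<^sub>R u) # u # vs) = G w (v # u # vs) + G w ((r *\<^sub>R u) # u # vs)"
        by (rule dualW_add[OF mlf_hd[OF hs_field_mlf[OF G]]])
      then have eq: "?f' r = (G (w + (v + r *\<^sub>R u)) (u # vs) - G w (u # vs) - G w ((v + r *\<^sub>R u) # u # vs))
          - (G (w + r *\<^sub>R u) (u # vs) - G w (u # vs) - G w ((r *\<^sub>R u) # u # vs))"
        by (simp add: add.assoc)
      have "norm (?f' r) \<le> norm (G (w + (v + r *\<^sub>R u)) (u # vs) - G w (u # vs) - G w ((v + r *\<^sub>R u) # u # vs))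
          + norm (G (w + r *\<^sub>R u) (u # vs) - G w (u # vs) - G w ((r *\<^sub>R u) # u # vs))"
        unfolding eq by (rule norm_triangle_ineq4)
      also have "\<dots> \<le> C * ?a\<^sup>2 * (?a * P) + C * ?a\<^sup>2 * (?a * P)"
      proof (rule add_mono[OF est est])
        show "norm (r *\<^sub>R u) \<le> ?a" using ru norm_ge_zero[of v] by linarith
        show "norm (v + r *\<^sub>R u) \<le> ?a" using norm_triangle_ineq[of v "r *\<^sub>R u"] ru by linarith
      qed
      also have "\<dots> = 2 * (C * ?a\<^sup>2 * (?a * P))" by (rule mult_2[symmetric])
      finally show "norm (?f' r) \<le> 2 * (C * ?a\<^sup>2 * (?a * P))" .
    qed auto
    moreover have cube: "2 * (C * a\<^sup>2 * (a * P)) * \<bar>1 - 0\<bar> = 2 * (C * P) * a ^ 3" for a :: real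
      by (simp add: power2_eq_square power3_eq_cube)
    moreover have "?f 1 - ?f 0 = G (w + v + u) vs - G (w + u) vs - (G (w + v) vs - G w vs) - G w (v # u # vs)"
      by simp
    ultimately show "norm (G (w + v + u) vs - G (w + u) vs - (G (w + v) vs - G w vs) - G w (v # u # vs)) \<le> 2 * (C * P) * ?a ^ 3"
      by (simp only: cube)
  qed
qed

text \<open>Schwarz's theorem. With u and v scaled by t, both forms are within order
  \<open>t ^ 3\<close> of the same second difference, while their difference scales like
  \<open>t\<^sup>2\<close>; then t tends to 0.\<close>

lemma hs_field_swap:
  assumes G: "hs_field G"
  shows "G w (u # v # vs) = G w (v # u # vs)"
proof -
  obtain \<rho> K where \<rho>: "0 < \<rho>" "0 \<le> K"
    "\<And>u v. norm u + norm v < \<rho> \<Longrightarrow>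
      norm (G (w + v + u) vs - G (w + u) vs - (G (w + v) vs - G w vs) - G w (v # u # vs)) \<le> K * (norm u + norm v) ^ 3"
    using second_difference_bound[OF G] by blast
  let ?a = "norm u + norm v"
  let ?X = "G w (u # v # vs) - G w (v # u # vs)"
  have sc: "G w ((t *\<^sub>R x) # (t *\<^sub>R y) # vs) = t\<^sup>2 *\<^sub>R G w (x # y # vs)" for t :: real and x y
  proof -
    have "G w ((t *\<^sub>R x) # (t *\<^sub>R y) # vs) = t *\<^sub>R G w (x # (t *\<^sub>R y) # vs)"
      by (rule linear_scale[OF bounded_linear.linear[OF dualW_bounded[OF mlf_hd[OF hs_field_mlf[OF G]]]]])
    also have "G w (x # (t *\<^sub>R y) # vs) = t *\<^sub>R G w (x # y # vs)"
      by (rule linear_scale[OF bounded_linear.linear[OF dualW_bounded[OF mlf_hd[OF mlf_front[OF hs_field_mlf[OF G]]]]]])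
    finally show ?thesis by (simp add: power2_eq_square)
  qed
  have key: "norm ?X \<le> (2 * K * ?a ^ 3) * t" if t: "0 < t" "t * ?a < \<rho>" for t :: real
  proof -
    have n: "norm (t *\<^sub>R u) + norm (t *\<^sub>R v) = t * ?a" using t by (simp add: distrib_left)
    let ?D = "G (w + t *\<^sub>R v + t *\<^sub>R u) vs - G (w + t *\<^sub>R u) vs - (G (w + t *\<^sub>R v) vs - G w vs)"
    have "norm (?D - t\<^sup>2 *\<^sub>R G w (v # u # vs)) \<le> K * (t * ?a) ^ 3"
      using \<rho>(3)[of "t *\<^sub>R u" "t *\<^sub>R v"] t n sc by simp
    moreover have "norm (?D - t\<^sup>2 *\<^sub>R G w (u # v # vs)) \<le> K * (t * ?a) ^ 3"
      using \<rho>(3)[of "t *\<^sub>R v" "t *\<^sub>R u"] t n sc[of t u v] by (simp add: algebra_simps)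
    ultimately have "norm ((?D - t\<^sup>2 *\<^sub>R G w (v # u # vs)) - (?D - t\<^sup>2 *\<^sub>R G w (u # v # vs)))
        \<le> K * (t * ?a) ^ 3 + K * (t * ?a) ^ 3"
      by (rule order_trans[OF norm_triangle_ineq4 add_mono])
    moreover have "(?D - t\<^sup>2 *\<^sub>R G w (v # u # vs)) - (?D - t\<^sup>2 *\<^sub>R G w (u # v # vs)) = t\<^sup>2 *\<^sub>R ?X"
      by (simp add: scaleR_diff_right)
    ultimately have "t\<^sup>2 * norm ?X \<le> K * (t * ?a) ^ 3 + K * (t * ?a) ^ 3"
      by simp
    also have "\<dots> = t\<^sup>2 * ((2 * K * ?a ^ 3) * t)"
    proof -
      have "K * (t * a) ^ 3 + K * (t * a) ^ 3 = t\<^sup>2 * ((2 * K * a ^ 3) * t)" for a :: real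
        by (simp add: power_mult_distrib power2_eq_square power3_eq_cube)
      then show ?thesis .
    qed
    finally show ?thesis using t by simp
  qed
  have "norm ?X \<le> 0 + \<epsilon>" if "0 < \<epsilon>" for \<epsilon> :: real
  proof -
    define c where "c = 2 * K * ?a ^ 3"
    have c: "0 \<le> c" using \<rho>(2) by (simp add: c_def)
    define t where "t = min (\<rho> / (?a + 1)) (\<epsilon> / (c + 1))"
    have a0: "0 \<le> ?a" by simp
    have t: "0 < t" using that \<rho> c a0 unfolding t_def by (simp add: add_nonneg_pos del: add_nonneg_nonneg)
    have "t * (?a + 1) \<le> \<rho>"
      using a0 unfolding t_def by (metis add_nonneg_pos min.cobounded1 pos_le_divide_eq zero_less_one)
    then have "t * ?a < \<rho>" using t by (simp add: distrib_left)
    moreover have "t * (c + 1) \<le> \<epsilon>"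
      using c unfolding t_def by (metis add_nonneg_pos min.cobounded2 pos_le_divide_eq zero_less_one)
    then have "c * t \<le> \<epsilon>" using t by (simp add: algebra_simps)
    ultimately show ?thesis using key[OF t] by (simp add: c_def)
  qed
  then have "norm ?X \<le> 0" by (rule field_le_epsilon)
  then show ?thesis by simp
qed

lemma deriv_form_append: "deriv_form (\<lambda>x. deriv_form F x us) w vs = deriv_form F w (vs @ us)"
  by (induction vs arbitrary: w) auto

declare deriv_form.simps(2) [simp del]

text \<open>By \<open>deriv_form_append\<close> a derivative of \<open>dird v F\<close> carries v in
  its last slot. Neighbouring swaps bring it to the front, where all slot estimates are
  made.\<close>

lemma deriv_form_snoc:
  assumes "F \<in> hs_functions S"
  shows "deriv_form F w (vs @ [v]) = deriv_form F w (v # vs)"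
proof (induction vs arbitrary: w)
  case (Cons x vs)
  have "deriv_form F w (x # vs @ [v]) = deriv_form F w (x # v # vs)"
    by (simp only: deriv_form.simps(2)[of F w x] Cons.IH)
  then show ?case by (simp only: append_Cons hs_field_swap[OF hs_functions_hs_field[OF assms]])
qed simp

section \<open>Directional derivatives and termwise differentiation of series\<close>

definition dird :: "'h \<times> 'd \<Rightarrow> ('h \<times> 'd \<Rightarrow> 'k) \<Rightarrow> 'h \<times> 'd \<Rightarrow> 'k" where
  "dird v F = (\<lambda>w. deriv_form F w [v])"

abbreviation HS where "HS \<equiv> hs_functions S"

lemma deriv_form_dird:
  "F \<in> HS \<Longrightarrow> deriv_form (dird v F) w vs = deriv_form F w (v # vs)"
  unfolding dird_def by (simp only: deriv_form_append deriv_form_snoc)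

text \<open>A line derivative puts its direction h behind v only after an application of symmetry,
  since differentiation adds slots at the front.\<close>

lemma hs_field_front:
  assumes G: "hs_field G"
  shows "hs_field (\<lambda>w vs. G w (v # vs))"
  unfolding hs_field_def
proof (intro conjI allI)
  show "mlf (\<lambda>vs. G w (v # vs))" for w
    by (rule mlf_front[OF hs_field_mlf[OF G]])
  show "((\<lambda>r. G (w + r *\<^sub>R h) (v # vs)) has_vector_derivative G w (v # h # vs)) (at 0)" for w h vs
    using G unfolding hs_field_def hs_field_swap[OF G, of w v h] by blast
  show "\<exists>\<rho>>0. \<exists>C. \<forall>w'\<in>ball w \<rho>. hs_le n (\<lambda>vs. G w' (v # vs)) C" for n w
    using hs_field_bounded[OF G, where n = "Suc n" and w = w] hs_le_front_vector[OF hs_field_mlf[OF G]] by blast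
qed

lemma dird_HS:
  assumes F: "F \<in> HS"
  shows "dird v F \<in> HS"
  using hs_field_hs_functions[OF hs_field_front[OF hs_functions_hs_field[OF F]], of v] by (simp add: dird_def)

lemma HS_jet: "F \<in> HS \<Longrightarrow> hs_jet (deriv_form F w)"
  by (rule hs_field_jet[OF hs_functions_hs_field])

lemma dird_swap: "F \<in> HS \<Longrightarrow> dird u (dird v F) = dird v (dird u F)"
  unfolding dird_def[of u "dird v F"] dird_def[of v "dird u F"]
  by (simp only: deriv_form_dird) (simp only: hs_field_swap[OF hs_functions_hs_field])

text \<open>Termwise differentiation. The hypothesis gives absolute convergence in every order, and
  the quadratic Taylor remainder of a partial sum has a bound independent of the finite set Y, so it
  passes to the limit.\<close>

lemma hs_field_series:
  fixes G :: "'b \<Rightarrow> 'h \<times> 'd \<Rightarrow> ('h \<times> 'd) list \<Rightarrow> 'k"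
  assumes G: "\<And>b. hs_field (G b)"
    and bnd: "\<And>n w. \<exists>\<rho>>0. \<exists>C. \<forall>w'\<in>ball w \<rho>. \<forall>Y. finite Y \<longrightarrow> (\<Sum>b\<in>Y. tnorm n (G b w')) \<le> C"
  shows "(\<lambda>b. norm (G b w vs)) summable_on UNIV"
    and "hs_field (\<lambda>w vs. \<Sum>\<^sub>\<infinity>b. G b w vs)"
proof -
  have abs: "(\<lambda>b. norm (G b w vs)) summable_on UNIV" for w vs
  proof -
    obtain \<rho> C where \<rho>: "0 < \<rho>" "\<And>w' Y. w' \<in> ball w \<rho> \<Longrightarrow> finite Y \<Longrightarrow> (\<Sum>b\<in>Y. tnorm (length vs) (G b w')) \<le> C"
      using bnd[of w "length vs"] by blast
    let ?P = "prod_list (map norm vs)"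
    have "(\<Sum>b\<in>Y. norm (G b w vs)) \<le> C * ?P" if "finite Y" for Y
    proof -
      have "(\<Sum>b\<in>Y. norm (G b w vs)) \<le> (\<Sum>b\<in>Y. tnorm (length vs) (G b w) * ?P)"
        by (rule sum_mono) (rule norm_le_of_hs_le[OF hs_field_mlf[OF G] hs_jet_le[OF hs_field_jet[OF G]]])
      also have "\<dots> = (\<Sum>b\<in>Y. tnorm (length vs) (G b w)) * ?P" by (simp add: sum_distrib_right)
      also have "\<dots> \<le> C * ?P" using \<rho> that by (intro mult_right_mono prod_list_norm_nonneg) auto
      finally show ?thesis .
    qed
    then show ?thesis by (intro nonneg_bdd_above_summable_on) (auto intro!: bdd_aboveI[of _ "C * ?P"])
  qed
  then show "(\<lambda>b. norm (G b w vs)) summable_on UNIV" .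
  have hs: "((\<lambda>b. G b w vs) has_sum (\<Sum>\<^sub>\<infinity>b. G b w vs)) UNIV" for w vs
    using abs_summable_summable[OF abs] by simp
  have mY: "mlf (\<lambda>vs. \<Sum>b\<in>Y. G b w vs)" for Y w
    by (rule mlf_sum) (rule hs_field_mlf[OF G])
  have dY: "((\<lambda>r. \<Sum>b\<in>Y. G b (w + r *\<^sub>R h) vs) has_vector_derivative (\<Sum>b\<in>Y. G b w (h # vs))) (at 0)" for Y w h vs
    by (rule has_vector_derivative_sum) (use G in \<open>auto simp: hs_field_def\<close>)
  have bY: "\<exists>\<rho>>0. \<exists>C. \<forall>w'\<in>ball w \<rho>. \<forall>Y. finite Y \<longrightarrow> hs_le n (\<lambda>vs. \<Sum>b\<in>Y. G b w' vs) C" for n w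
  proof -
    obtain \<rho> C where \<rho>: "0 < \<rho>" "\<And>w' Y. w' \<in> ball w \<rho> \<Longrightarrow> finite Y \<Longrightarrow> (\<Sum>b\<in>Y. tnorm n (G b w')) \<le> C"
      using bnd[of w n] by blast
    have "hs_le n (\<lambda>vs. \<Sum>b\<in>Y. G b w' vs) C" if "w' \<in> ball w \<rho>" "finite Y" for w' Y
      by (rule hs_le_mono[OF hs_le_sum[OF that(2) hs_jet_le[OF hs_field_jet[OF G]]] \<rho>(2)[OF that]])
    then show ?thesis using \<rho>(1) by blast
  qed
  have lim: "hs_le n (\<lambda>vs. \<Sum>\<^sub>\<infinity>b. G b w vs) C" if "\<And>Y. finite Y \<Longrightarrow> hs_le n (\<lambda>vs. \<Sum>b\<in>Y. G b w vs) C" for n w C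
    by (rule hs_le_has_sum[where A = UNIV and T = "\<lambda>b vs. G b w vs"]) (use that hs in auto)
  have b: "\<exists>\<rho>>0. \<exists>C. \<forall>w'\<in>ball w \<rho>. hs_le n (\<lambda>vs. \<Sum>\<^sub>\<infinity>b. G b w' vs) C" for n w
  proof -
    obtain \<rho> C where \<rho>: "0 < \<rho>" "\<And>w' Y. w' \<in> ball w \<rho> \<Longrightarrow> finite Y \<Longrightarrow> hs_le n (\<lambda>vs. \<Sum>b\<in>Y. G b w' vs) C"
      using bY[of w n] by blast
    have "\<forall>w'\<in>ball w \<rho>. hs_le n (\<lambda>vs. \<Sum>\<^sub>\<infinity>b. G b w' vs) C"
      by (intro ballI lim \<rho>(2))
    then show ?thesis using \<rho>(1) by blast
  qed
  have m: "mlf (\<lambda>vs. \<Sum>\<^sub>\<infinity>b. G b w vs)" for w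
    unfolding mlf_def dualW_iff
  proof (intro allI conjI)
    fix us vs :: "('h \<times> 'd) list"
    have sl: "(\<lambda>x. G b w (us @ x # vs)) \<in> dualW S" for b
      by (rule mlf_slot[OF hs_field_mlf[OF G]])
    show "(\<Sum>\<^sub>\<infinity>b. G b w (us @ (x + y) # vs)) = (\<Sum>\<^sub>\<infinity>b. G b w (us @ x # vs)) + (\<Sum>\<^sub>\<infinity>b. G b w (us @ y # vs))" for x y
      unfolding dualW_add[OF sl] by (rule infsum_add) (rule abs_summable_summable[OF abs])+
    show "(\<Sum>\<^sub>\<infinity>b. G b w (us @ scaleW S c x # vs)) = c * (\<Sum>\<^sub>\<infinity>b. G b w (us @ x # vs))" for c x
      unfolding dualW_scale[OF sl] by (rule infsum_cmult_right) (rule abs_summable_summable[OF abs])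
    let ?n = "length us + 1 + length vs"
    obtain \<rho> C where \<rho>: "0 < \<rho>" "\<And>w' Y. w' \<in> ball w \<rho> \<Longrightarrow> finite Y \<Longrightarrow> hs_le ?n (\<lambda>vs. \<Sum>b\<in>Y. G b w' vs) C"
      using bY[of w ?n] by blast
    have "norm (\<Sum>\<^sub>\<infinity>b. G b w (us @ x # vs)) \<le> C * prod_list (map norm (us @ x # vs))" for x
      by (rule has_sum_norm_le[OF hs], rule norm_le_of_hs_le[OF mY]) (use \<rho> in simp)
    then have "norm (\<Sum>\<^sub>\<infinity>b. G b w (us @ x # vs)) \<le> norm x * (C * prod_list (map norm us) * prod_list (map norm vs))" for x
      by (simp add: mult_ac)
    then show "\<exists>C. \<forall>x. norm (\<Sum>\<^sub>\<infinity>b. G b w (us @ x # vs)) \<le> norm x * C" by blast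
  qed
  have d: "((\<lambda>r. \<Sum>\<^sub>\<infinity>b. G b (w + r *\<^sub>R h) vs) has_vector_derivative (\<Sum>\<^sub>\<infinity>b. G b w (h # vs))) (at 0)" for w h vs
  proof -
    let ?P = "prod_list (map norm vs)"
    obtain \<rho> C where \<rho>: "0 < \<rho>" "\<And>w' Y. w' \<in> ball w \<rho> \<Longrightarrow> finite Y \<Longrightarrow> hs_le (Suc (Suc (length vs))) (\<lambda>vs. \<Sum>b\<in>Y. G b w' vs) C"
      using bY[of w "Suc (Suc (length vs))"] by blast
    show ?thesis
    proof (rule has_vector_derivative_at_0I[where \<delta> = "\<rho> / (norm h + 1)" and K = "C * (norm h)\<^sup>2 * ?P"])
      show "0 < \<rho> / (norm h + 1)" using \<rho>(1) by (simp add: add_nonneg_pos)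
      fix r :: real assume r: "\<bar>r\<bar> < \<rho> / (norm h + 1)"
      then have "\<bar>r\<bar> * (norm h + 1) < \<rho>" by (simp add: pos_less_divide_eq add_nonneg_pos)
      then have rh: "norm (r *\<^sub>R h) < \<rho>" by (simp add: distrib_left)
      have "((\<lambda>b. G b (w + r *\<^sub>R h) vs - G b w vs - G b w ((r *\<^sub>R h) # vs))
          has_sum ((\<Sum>\<^sub>\<infinity>b. G b (w + r *\<^sub>R h) vs) - (\<Sum>\<^sub>\<infinity>b. G b w vs) - (\<Sum>\<^sub>\<infinity>b. G b w ((r *\<^sub>R h) # vs)))) UNIV"
        by (intro has_sum_diff_fun hs)
      then have "norm ((\<Sum>\<^sub>\<infinity>b. G b (w + r *\<^sub>R h) vs) - (\<Sum>\<^sub>\<infinity>b. G b w vs) - (\<Sum>\<^sub>\<infinity>b. G b w ((r *\<^sub>R h) # vs)))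
          \<le> C * (norm (r *\<^sub>R h))\<^sup>2 * ?P"
      proof (rule has_sum_norm_le)
        fix Y :: "'b set" assume Y: "finite Y"
        show "norm (\<Sum>b\<in>Y. G b (w + r *\<^sub>R h) vs - G b w vs - G b w ((r *\<^sub>R h) # vs)) \<le> C * (norm (r *\<^sub>R h))\<^sup>2 * ?P"
          unfolding sum_subtractf
          by (rule remainder_bound[where G = "\<lambda>w vs. \<Sum>b\<in>Y. G b w vs", OF mY dY \<rho>(2) rh]) (use Y in auto)
      qed
      moreover have "(\<Sum>\<^sub>\<infinity>b. G b w ((r *\<^sub>R h) # vs)) = r *\<^sub>R (\<Sum>\<^sub>\<infinity>b. G b w (h # vs))"
        using linear_scale[OF bounded_linear.linear[OF dualW_bounded[OF mlf_hd[OF m]]]] .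
      ultimately show "norm ((\<Sum>\<^sub>\<infinity>b. G b (w + r *\<^sub>R h) vs) - (\<Sum>\<^sub>\<infinity>b. G b (w + 0 *\<^sub>R h) vs) - r *\<^sub>R (\<Sum>\<^sub>\<infinity>b. G b w (h # vs)))
          \<le> C * (norm h)\<^sup>2 * ?P * r\<^sup>2"
        by (simp add: power_mult_distrib mult_ac)
    qed
  qed
  show "hs_field (\<lambda>w vs. \<Sum>\<^sub>\<infinity>b. G b w vs)"
    using m d b by (simp add: hs_field_def)
qed

lemma HS_series:
  fixes F :: "'b \<Rightarrow> 'h \<times> 'd \<Rightarrow> 'k"
  assumes F: "\<And>b. F b \<in> HS"
    and bnd: "\<And>n w. \<exists>\<rho>>0. \<exists>C. \<forall>w'\<in>ball w \<rho>. \<forall>Y. finite Y \<longrightarrow> (\<Sum>b\<in>Y. tnorm n (deriv_form (F b) w')) \<le> C"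
  shows "(\<lambda>b. norm (deriv_form (F b) w vs)) summable_on UNIV"
    and "(\<lambda>w. \<Sum>\<^sub>\<infinity>b. F b w) \<in> HS"
    and "deriv_form (\<lambda>w. \<Sum>\<^sub>\<infinity>b. F b w) w vs = (\<Sum>\<^sub>\<infinity>b. deriv_form (F b) w vs)"
proof -
  note 1 = hs_field_series[where G = "\<lambda>b. deriv_form (F b)", OF hs_functions_hs_field[OF F] bnd]
  show "(\<lambda>b. norm (deriv_form (F b) w vs)) summable_on UNIV" by (rule 1(1))
  show "(\<lambda>w. \<Sum>\<^sub>\<infinity>b. F b w) \<in> HS" using hs_field_hs_functions[OF 1(2)] by simp
  show "deriv_form (\<lambda>w. \<Sum>\<^sub>\<infinity>b. F b w) w vs = (\<Sum>\<^sub>\<infinity>b. deriv_form (F b) w vs)"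
    using hs_field_deriv_form[OF 1(2), of w vs] by simp
qed

section \<open>Products, sums and affine functions\<close>

lemma leibniz_has_vector_derivative:
  fixes s t :: "real \<Rightarrow> ('h \<times> 'd) list \<Rightarrow> 'k"
  assumes "\<And>us. ((\<lambda>r. s r us) has_vector_derivative s' us) (at x)"
    and "\<And>us. ((\<lambda>r. t r us) has_vector_derivative t' us) (at x)"
  shows "((\<lambda>r. leibniz (s r) (t r) vs) has_vector_derivative (leibniz s' (t x) vs + leibniz (s x) t' vs)) (at x)"
  using assms
proof (induction vs arbitrary: s t s' t')
  case Nil
  show ?case
    using has_vector_derivative_mult[OF Nil(1)[of "[]"] Nil(2)[of "[]"]] by (simp add: add.commute)
next
  case (Cons v vs)
  have "((\<lambda>r. leibniz (\<lambda>us. s r (v # us)) (t r) vs + leibniz (s r) (\<lambda>us. t r (v # us)) vs) has_vector_derivative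
     (leibniz (\<lambda>us. s' (v # us)) (t x) vs + leibniz (\<lambda>us. s x (v # us)) t' vs) +
     (leibniz s' (\<lambda>us. t x (v # us)) vs + leibniz (s x) (\<lambda>us. t' (v # us)) vs)) (at x)"
    by (intro has_vector_derivative_add Cons.IH Cons.prems)
  then show ?case by (simp add: algebra_simps)
qed

lemma HS_jnorm_bounded:
  assumes F: "F \<in> HS"
  shows "\<exists>\<rho>>0. \<exists>C. \<forall>w'\<in>ball w \<rho>. jnorm n (deriv_form F w') \<le> C"
proof -
  have "\<exists>\<rho>>0. \<exists>C. \<forall>w'\<in>ball w \<rho>. (\<Sum>k\<le>n. tnorm k (deriv_form F w')) \<le> C"
  proof (induction n)
    case 0
    show ?case using hs_field_bounded[OF hs_functions_hs_field[OF F], where n = 0 and w = w] by (auto simp: hs_le_iff)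
  next
    case (Suc n)
    obtain \<rho> C where 1: "0 < \<rho>" "\<And>w'. w' \<in> ball w \<rho> \<Longrightarrow> (\<Sum>k\<le>n. tnorm k (deriv_form F w')) \<le> C"
      using Suc by blast
    obtain \<sigma> D where 2: "0 < \<sigma>" "\<And>w'. w' \<in> ball w \<sigma> \<Longrightarrow> hs_le (Suc n) (deriv_form F w') D"
      using hs_field_bounded[OF hs_functions_hs_field[OF F], where n = "Suc n" and w = w] by blast
    show ?case
    proof (rule exI[of _ "min \<rho> \<sigma>"], intro exI[of _ "C + D"] conjI ballI)
      show "(\<Sum>k\<le>Suc n. tnorm k (deriv_form F w')) \<le> C + D" if "w' \<in> ball w (min \<rho> \<sigma>)" for w'
        using 1(2)[of w'] 2(2)[of w'] that by (simp add: hs_le_iff add_mono)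
    qed (use 1(1) 2(1) in simp)
  qed
  moreover have "jnorm n (deriv_form F w') \<le> (\<Sum>k\<le>n. tnorm k (deriv_form F w'))" for w'
    unfolding jnorm_def by (rule L2_set_le_sum) simp
  ultimately show ?thesis by (meson order_trans)
qed

lemma hs_field_mult:
  assumes F: "F \<in> HS" and G: "G \<in> HS"
  shows "hs_field (\<lambda>w. leibniz (deriv_form F w) (deriv_form G w))"
  unfolding hs_field_def
proof (intro conjI allI)
  fix w
  show "mlf (leibniz (deriv_form F w) (deriv_form G w))"
    by (intro mlf_leibniz hs_jetD HS_jet F G)
  show "((\<lambda>r. leibniz (deriv_form F (w + r *\<^sub>R h)) (deriv_form G (w + r *\<^sub>R h)) vs) has_vector_derivative
       leibniz (deriv_form F w) (deriv_form G w) (h # vs)) (at 0)" for h vs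
    using leibniz_has_vector_derivative[where s = "\<lambda>r. deriv_form F (w + r *\<^sub>R h)" and t = "\<lambda>r. deriv_form G (w + r *\<^sub>R h)"
        and x = 0 and vs = vs and s' = "\<lambda>us. deriv_form F w (h # us)" and t' = "\<lambda>us. deriv_form G w (h # us)"]
      hs_functions_hs_field[OF F] hs_functions_hs_field[OF G] by (simp add: hs_field_def)
  fix n
  obtain \<rho> C where 1: "0 < \<rho>" "\<And>w'. w' \<in> ball w \<rho> \<Longrightarrow> jnorm n (deriv_form F w') \<le> C"
    using HS_jnorm_bounded[OF F] by blast
  obtain \<sigma> D where 2: "0 < \<sigma>" "\<And>w'. w' \<in> ball w \<sigma> \<Longrightarrow> jnorm n (deriv_form G w') \<le> D"
    using HS_jnorm_bounded[OF G] by blast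
  have "hs_le n (leibniz (deriv_form F w') (deriv_form G w')) (2 ^ n * (C * D))" if "w' \<in> ball w (min \<rho> \<sigma>)" for w'
  proof (rule hs_le_mono[OF hs_le_leibniz[OF HS_jet[OF F] HS_jet[OF G]]])
    have a: "jnorm n (deriv_form F w') \<le> C" and b: "jnorm n (deriv_form G w') \<le> D"
      using 1(2)[of w'] 2(2)[of w'] that by auto
    have "jnorm n (deriv_form F w') * jnorm n (deriv_form G w') \<le> C * D"
      by (rule mult_mono[OF a b order_trans[OF jnorm_nonneg a] jnorm_nonneg])
    then show "2 ^ n * (jnorm n (deriv_form F w') * jnorm n (deriv_form G w')) \<le> 2 ^ n * (C * D)"
      by (rule mult_left_mono) simp
  qed
  moreover have "0 < min \<rho> \<sigma>" using 1(1) 2(1) by simp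
  ultimately show "\<exists>\<rho>>0. \<exists>C. \<forall>w'\<in>ball w \<rho>. hs_le n (leibniz (deriv_form F w') (deriv_form G w')) C"
    by blast
qed

lemma HS_mult: "F \<in> HS \<Longrightarrow> G \<in> HS \<Longrightarrow> (\<lambda>w. F w * G w) \<in> HS"
  using hs_field_hs_functions[OF hs_field_mult] by simp

lemma deriv_form_mult:
  "F \<in> HS \<Longrightarrow> G \<in> HS \<Longrightarrow> deriv_form (\<lambda>w. F w * G w) w = leibniz (deriv_form F w) (deriv_form G w)"
  using hs_field_deriv_form[OF hs_field_mult] by (intro ext) simp

lemma hs_field_add:
  assumes F: "hs_field F" and G: "hs_field G"
  shows "hs_field (\<lambda>w vs. F w vs + G w vs)"
  unfolding hs_field_def
proof (intro conjI allI)
  fix w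
  show "mlf (\<lambda>vs. F w vs + G w vs)" by (intro mlf_add hs_field_mlf F G)
  show "((\<lambda>r. F (w + r *\<^sub>R h) vs + G (w + r *\<^sub>R h) vs) has_vector_derivative F w (h # vs) + G w (h # vs)) (at 0)" for h vs
    using F G unfolding hs_field_def by (intro has_vector_derivative_add) blast+
  fix n
  obtain \<rho> C where 1: "0 < \<rho>" "\<And>w'. w' \<in> ball w \<rho> \<Longrightarrow> hs_le n (F w') C"
    using hs_field_bounded[OF F] by blast
  obtain \<sigma> D where 2: "0 < \<sigma>" "\<And>w'. w' \<in> ball w \<sigma> \<Longrightarrow> hs_le n (G w') D"
    using hs_field_bounded[OF G] by blast
  show "\<exists>\<rho>>0. \<exists>C. \<forall>w'\<in>ball w \<rho>. hs_le n (\<lambda>vs. F w' vs + G w' vs) C"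
  proof (rule exI[of _ "min \<rho> \<sigma>"], intro exI[of _ "C + D"] conjI ballI)
    show "hs_le n (\<lambda>vs. F w' vs + G w' vs) (C + D)" if "w' \<in> ball w (min \<rho> \<sigma>)" for w'
      by (rule hs_le_add[OF 1(2) 2(2)]) (use that in auto)
  qed (use 1(1) 2(1) in simp)
qed

lemma hs_field_scale:
  assumes F: "hs_field F"
  shows "hs_field (\<lambda>w vs. c * F w vs)"
  unfolding hs_field_def
proof (intro conjI allI)
  fix w
  show "mlf (\<lambda>vs. c * F w vs)" by (rule mlf_scale[OF hs_field_mlf[OF F]])
  show "((\<lambda>r. c * F (w + r *\<^sub>R h) vs) has_vector_derivative c * F w (h # vs)) (at 0)" for h vs
    by (rule has_vector_derivative_mult_right) (use F in \<open>simp add: hs_field_def\<close>)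
  fix n
  show "\<exists>\<rho>>0. \<exists>C. \<forall>w'\<in>ball w \<rho>. hs_le n (\<lambda>vs. c * F w' vs) C"
    using hs_field_bounded[OF F, where n = n and w = w] hs_le_scale by blast
qed

lemma HS_add: "F \<in> HS \<Longrightarrow> G \<in> HS \<Longrightarrow> (\<lambda>w. F w + G w) \<in> HS"
  using hs_field_hs_functions[OF hs_field_add[OF hs_functions_hs_field hs_functions_hs_field]] by simp

lemma deriv_form_add:
  "F \<in> HS \<Longrightarrow> G \<in> HS \<Longrightarrow> deriv_form (\<lambda>w. F w + G w) w vs = deriv_form F w vs + deriv_form G w vs"
  using hs_field_deriv_form[OF hs_field_add[OF hs_functions_hs_field hs_functions_hs_field]] by simp

lemma HS_scale: "F \<in> HS \<Longrightarrow> (\<lambda>w. c * F w) \<in> HS"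
  using hs_field_hs_functions[OF hs_field_scale[OF hs_functions_hs_field]] by simp

lemma deriv_form_scale: "F \<in> HS \<Longrightarrow> deriv_form (\<lambda>w. c * F w) w vs = c * deriv_form F w vs"
  using hs_field_deriv_form[OF hs_field_scale[OF hs_functions_hs_field]] by simp

text \<open>The jet of an affine function at a point where its value is c and its linear part is
  u.\<close>

definition affine_jet :: "'k \<Rightarrow> ('h \<times> 'd \<Rightarrow> 'k) \<Rightarrow> ('h \<times> 'd) list \<Rightarrow> 'k" where
  "affine_jet c u vs = (case vs of [] \<Rightarrow> c | [v] \<Rightarrow> u v | _ \<Rightarrow> 0)"

lemma hs_field_affine:
  assumes u: "u \<in> dualW S"
  shows "hs_field (\<lambda>w. affine_jet (c + u w) u)"
  unfolding hs_field_def
proof (intro conjI allI)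
  fix w
  show "mlf (affine_jet (c + u w) u)"
    unfolding mlf_def
  proof (intro allI)
    fix us vs :: "('h \<times> 'd) list"
    show "(\<lambda>x. affine_jet (c + u w) u (us @ x # vs)) \<in> dualW S"
    proof -
      have "affine_jet (c + u w) u (us @ x # vs) = (if us = [] \<and> vs = [] then u x else 0)" for x
        by (cases us) (auto simp: affine_jet_def split: list.splits)
      then show ?thesis using u dualW_zero by (cases "us = [] \<and> vs = []") auto
    qed
  qed
  show "((\<lambda>r. affine_jet (c + u (w + r *\<^sub>R h)) u vs) has_vector_derivative affine_jet (c + u w) u (h # vs)) (at 0)" for h vs
  proof (cases vs)
    case Nil
    have "c + u (w + r *\<^sub>R h) = c + u w + r *\<^sub>R u h" for r
      using dualW_add[OF u] linear_scale[OF bounded_linear.linear[OF dualW_bounded[OF u]]] by simp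
    moreover have "((\<lambda>r. c + u w + r *\<^sub>R u h) has_vector_derivative u h) (at 0)"
      unfolding has_vector_derivative_def by (auto intro!: derivative_eq_intros)
    ultimately show ?thesis using Nil by (simp add: affine_jet_def add.assoc)
  next
    case (Cons v vs')
    then show ?thesis by (cases vs') (auto simp: affine_jet_def)
  qed
  fix n
  have "\<exists>C. \<forall>w'\<in>ball w 1. hs_le n (affine_jet (c + u w') u) C"
  proof -
    consider "n = 0" | "n = 1" | "n \<ge> 2" by linarith
    then show ?thesis
    proof cases
      case 1
      obtain K where K: "0 \<le> K" "\<And>w. norm (u w) \<le> norm w * K"
        using bounded_linear.nonneg_bounded[OF dualW_bounded[OF u]] by blast
      have "hs_le 0 (affine_jet (c + u w') u) (norm c + (norm w + 1) * K)" if "w' \<in> ball w 1" for w'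
      proof -
        have "norm w' \<le> norm w + 1" using that norm_triangle_sub[of w' w] by (simp add: dist_norm norm_minus_commute)
        then have "norm w' * K \<le> (norm w + 1) * K" using K(1) by (rule mult_right_mono)
        then have "norm (u w') \<le> (norm w + 1) * K" using K(2)[of w'] by linarith
        then show ?thesis using norm_triangle_ineq[of c "u w'"] by (simp add: hs_le_0_iff affine_jet_def)
      qed
      then show ?thesis using 1 by blast
    next
      case 2
      have "hs_le (Suc 0) (affine_jet (c + u w') u) (sqrt (nu u))" for w'
        by (rule hs_le_Suc[where c = "\<lambda>\<alpha>. norm (u (eW \<alpha>))"])
          (use nu_nonneg[of u] nu_finite[OF u] in \<open>auto simp: hs_le_0_iff affine_jet_def\<close>)
      then show ?thesis unfolding 2 One_nat_def by blast
    next
      case 3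
      have "hs_le n (affine_jet (c + u w') u) 0" for w'
      proof -
        have "hs_le n (affine_jet (c + u w') u) 0 \<longleftrightarrow> hs_le n (\<lambda>_. 0) 0"
          by (rule hs_le_cong) (use 3 in \<open>auto simp: affine_jet_def split: list.splits\<close>)
        then show ?thesis using hs_le_zero by simp
      qed
      then show ?thesis by blast
    qed
  qed
  then show "\<exists>\<rho>>0. \<exists>C. \<forall>w'\<in>ball w \<rho>. hs_le n (affine_jet (c + u w') u) C"
    using zero_less_one by blast
qed

lemma HS_linear: "u \<in> dualW S \<Longrightarrow> u \<in> HS"
  using hs_field_hs_functions[OF hs_field_affine[of u 0]] by (simp add: affine_jet_def[of _ _ "[]"])

lemma deriv_form_linear: "u \<in> dualW S \<Longrightarrow> deriv_form u w = affine_jet (u w) u"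
  using hs_field_deriv_form[OF hs_field_affine[of u 0]] by (intro ext) (simp add: affine_jet_def[of _ _ "[]"])

lemma HS_const: "(\<lambda>_. c) \<in> HS"
  using hs_field_hs_functions[OF hs_field_affine[OF dualW_zero, of c]] by (simp add: affine_jet_def)

lemma deriv_form_const: "deriv_form (\<lambda>_ :: 'h \<times> 'd. c :: 'k) w vs = (if vs = [] then c else 0)"
  using hs_field_deriv_form[OF hs_field_affine[OF dualW_zero, of c], of w vs]
  by (auto simp: affine_jet_def split: list.splits)

lemma HS_sum: "(\<And>b. b \<in> Y \<Longrightarrow> F b \<in> HS) \<Longrightarrow> (\<lambda>w. \<Sum>b\<in>Y. F b w) \<in> HS"
  by (induction Y rule: infinite_finite_induct) (auto intro: HS_const HS_add)

lemma dird_add: "F \<in> HS \<Longrightarrow> G \<in> HS \<Longrightarrow> dird v (\<lambda>w. F w + G w) = (\<lambda>w. dird v F w + dird v G w)"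
  by (simp add: dird_def deriv_form_add del: deriv_form.simps)

lemma dird_scale: "F \<in> HS \<Longrightarrow> dird v (\<lambda>w. c * F w) = (\<lambda>w. c * dird v F w)"
  by (simp add: dird_def deriv_form_scale del: deriv_form.simps)

lemma dird_mult:
  "F \<in> HS \<Longrightarrow> G \<in> HS \<Longrightarrow> dird v (\<lambda>w. F w * G w) = (\<lambda>w. dird v F w * G w + F w * dird v G w)"
  by (simp add: dird_def deriv_form_mult del: deriv_form.simps) simp

lemma dird_add_vector: "F \<in> HS \<Longrightarrow> dird (u + v) F = (\<lambda>w. dird u F w + dird v F w)"
  unfolding dird_def by (intro ext dualW_add[OF mlf_hd] hs_jetD HS_jet)

end

section \<open>Interchange of infinite sums and summable families of functions\<close>

lemma abs_summable_on_prodI: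
  fixes f :: "'a \<Rightarrow> 'b \<Rightarrow> 'c::real_normed_vector"
  assumes "\<And>X Y. finite X \<Longrightarrow> finite Y \<Longrightarrow> (\<Sum>x\<in>X. \<Sum>y\<in>Y. norm (f x y)) \<le> C"
  shows "(\<lambda>p. norm (case p of (x, y) \<Rightarrow> f x y)) summable_on UNIV \<times> UNIV"
proof (rule nonneg_bdd_above_summable_on)
  show "bdd_above (sum (\<lambda>p. norm (case p of (x, y) \<Rightarrow> f x y)) ` {F. F \<subseteq> UNIV \<times> UNIV \<and> finite F})"
  proof (rule bdd_aboveI[of _ C], clarify)
    fix F :: "('a \<times> 'b) set" assume F: "finite F"
    have "(\<Sum>p\<in>F. norm (case p of (x, y) \<Rightarrow> f x y)) \<le> (\<Sum>p\<in>fst ` F \<times> snd ` F. norm (case p of (x, y) \<Rightarrow> f x y))"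
      by (rule sum_mono2) (use F subset_fst_snd[of F] in auto)
    also have "\<dots> = (\<Sum>x\<in>fst ` F. \<Sum>y\<in>snd ` F. norm (f x y))"
      by (simp add: sum.cartesian_product case_prod_unfold)
    also have "\<dots> \<le> C" by (rule assms) (use F in auto)
    finally show "(\<Sum>p\<in>F. norm (case p of (x, y) \<Rightarrow> f x y)) \<le> C" .
  qed
qed auto

lemma infsum_swap_of_bound:
  fixes f :: "'a \<Rightarrow> 'b \<Rightarrow> 'c::banach"
  assumes "\<And>X Y. finite X \<Longrightarrow> finite Y \<Longrightarrow> (\<Sum>x\<in>X. \<Sum>y\<in>Y. norm (f x y)) \<le> C"
  shows "(\<Sum>\<^sub>\<infinity>x. \<Sum>\<^sub>\<infinity>y. f x y) = (\<Sum>\<^sub>\<infinity>y. \<Sum>\<^sub>\<infinity>x. f x y)"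
  by (rule infsum_swap_banach) (rule abs_summable_summable[OF abs_summable_on_prodI[OF assms]])

lemma infsum_bool_split:
  fixes f :: "bool \<times> 'a \<Rightarrow> 'b::banach"
  assumes "f summable_on UNIV"
  shows "(\<Sum>\<^sub>\<infinity>b. f b) = (\<Sum>\<^sub>\<infinity>i. f (False, i)) + (\<Sum>\<^sub>\<infinity>i. f (True, i))"
    and "(\<lambda>i. f (c, i)) summable_on UNIV"
proof -
  have *: "(\<lambda>i. f (c, i)) summable_on UNIV" for c
  proof -
    have "f summable_on range (Pair c)" by (rule summable_on_subset_banach[OF assms]) simp
    then have "(f \<circ> Pair c) summable_on UNIV"
      by (subst (asm) summable_on_reindex) (auto simp: inj_on_def)
    then show ?thesis by (simp add: o_def)
  qed
  then show "(\<lambda>i. f (c, i)) summable_on UNIV" .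
  show "(\<Sum>\<^sub>\<infinity>b. f b) = (\<Sum>\<^sub>\<infinity>i. f (False, i)) + (\<Sum>\<^sub>\<infinity>i. f (True, i))"
    by (rule infsumI[OF has_sum_bool_split]) (use * in auto)
qed

context phase_space
begin

text \<open>Stronger than convergence of the series: the bounds hold in every order and locally
  uniformly. This is what \<open>lap\<close> preserves and what allows derivatives to be taken
  termwise.\<close>

definition hs_summable :: "('b \<Rightarrow> 'h \<times> 'd \<Rightarrow> 'k) \<Rightarrow> bool" where
  "hs_summable F \<longleftrightarrow> (\<forall>b. F b \<in> HS) \<and> (\<forall>n w. \<exists>\<rho>>0. \<exists>C. \<forall>w'\<in>ball w \<rho>. \<forall>Y. finite Y \<longrightarrow>
     (\<Sum>b\<in>Y. tnorm n (deriv_form (F b) w')) \<le> C)"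

lemma hs_summableD:
  assumes "hs_summable F"
  shows "F b \<in> HS" and "(\<lambda>b. norm (deriv_form (F b) w vs)) summable_on UNIV"
    and "(\<lambda>b. F b w) summable_on UNIV"
    and "(\<lambda>w. \<Sum>\<^sub>\<infinity>b. F b w) \<in> HS"
    and "deriv_form (\<lambda>w. \<Sum>\<^sub>\<infinity>b. F b w) w vs = (\<Sum>\<^sub>\<infinity>b. deriv_form (F b) w vs)"
proof -
  have F: "\<And>b. F b \<in> HS" and bnd: "\<And>n w. \<exists>\<rho>>0. \<exists>C. \<forall>w'\<in>ball w \<rho>. \<forall>Y. finite Y \<longrightarrow>
     (\<Sum>b\<in>Y. tnorm n (deriv_form (F b) w')) \<le> C"
    using assms by (simp_all add: hs_summable_def)
  show "F b \<in> HS" by (rule F)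
  show "(\<lambda>b. norm (deriv_form (F b) w vs)) summable_on UNIV" by (rule HS_series(1)[OF F bnd])
  show "(\<lambda>b. F b w) summable_on UNIV"
    using abs_summable_summable[OF HS_series(1)[OF F bnd, of w "[]"]] by simp
  show "(\<lambda>w. \<Sum>\<^sub>\<infinity>b. F b w) \<in> HS" by (rule HS_series(2)[OF F bnd])
  show "deriv_form (\<lambda>w. \<Sum>\<^sub>\<infinity>b. F b w) w vs = (\<Sum>\<^sub>\<infinity>b. deriv_form (F b) w vs)"
    by (rule HS_series(3)[OF F bnd])
qed

lemma hs_summable_bound:
  assumes "hs_summable F"
  obtains \<rho> C where "0 < \<rho>" "\<And>w' Y. w' \<in> ball w \<rho> \<Longrightarrow> finite Y \<Longrightarrow> (\<Sum>b\<in>Y. tnorm n (deriv_form (F b) w')) \<le> C"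
proof -
  have "\<exists>\<rho>>0. \<exists>C. \<forall>w'\<in>ball w \<rho>. \<forall>Y. finite Y \<longrightarrow> (\<Sum>b\<in>Y. tnorm n (deriv_form (F b) w')) \<le> C"
    using assms by (simp add: hs_summable_def)
  then show thesis using that by blast
qed

lemma tnorm_series_le:
  assumes F: "hs_summable F" and C: "\<And>Y. finite Y \<Longrightarrow> (\<Sum>b\<in>Y. tnorm n (deriv_form (F b) w)) \<le> C"
  shows "tnorm n (deriv_form (\<lambda>w. \<Sum>\<^sub>\<infinity>b. F b w) w) \<le> C"
proof -
  have "hs_le n (deriv_form (\<lambda>w. \<Sum>\<^sub>\<infinity>b. F b w) w) C"
  proof (rule hs_le_has_sum[where A = UNIV and T = "\<lambda>b. deriv_form (F b) w"])
    show "((\<lambda>b. deriv_form (F b) w (map eW is)) has_sum deriv_form (\<lambda>w. \<Sum>\<^sub>\<infinity>b. F b w) w (map eW is)) UNIV" for "is"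
      using abs_summable_summable[OF hs_summableD(2)[OF F]] by (simp add: hs_summableD(5)[OF F])
    show "hs_le n (\<lambda>vs. \<Sum>b\<in>Y. deriv_form (F b) w vs) C" if "finite Y" for Y
      by (rule hs_le_mono[OF hs_le_sum[OF that hs_jet_le[OF HS_jet[OF hs_summableD(1)[OF F]]]] C[OF that]])
  qed
  then show ?thesis by (simp add: hs_le_iff)
qed

lemma jnorm_dird: "F \<in> HS \<Longrightarrow> jnorm n (deriv_form (dird v F) w) = jnorm n (\<lambda>vs. deriv_form F w (v # vs))"
  by (simp add: jnorm_def tensor_norm_def deriv_form_dird)

lemma norm_le_tnorm_0: "norm (F w) = tnorm 0 (deriv_form F w)"
  by (simp add: tensor_norm_def)

section \<open>The second order operator of a Hilbert-Schmidt operator\<close>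

text \<open>For D the identity this would be the trace of the mixed second derivative, which may
  diverge because that derivative is only Hilbert-Schmidt.\<close>

definition lap :: "('h \<Rightarrow>\<^sub>L 'h) \<Rightarrow> ('h \<times> 'd \<Rightarrow> 'k) \<Rightarrow> 'h \<times> 'd \<Rightarrow> 'k" where
  "lap D F = (\<lambda>w. \<Sum>\<^sub>\<infinity>j. dird (D (e j), 0) (dird (0, de j) F) w)"

definition hs_norm :: "('h \<Rightarrow>\<^sub>L 'h) \<Rightarrow> real" where
  "hs_norm D = sqrt (\<Sum>\<^sub>\<infinity>j. (norm (D (e j)))\<^sup>2)"

lemma hs_norm_L2:
  assumes "D \<in> hilbert_schmidt_operators S" "finite Y"
  shows "L2_set (\<lambda>j. norm (D (e j))) Y \<le> hs_norm D"
proof -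
  have "(\<lambda>j. (norm (D (e j)))\<^sup>2) summable_on UNIV"
    using assms(1) by (simp add: hilbert_schmidt_operators_def summable_on_UNIV_nonneg_real_iff)
  then have "(\<Sum>j\<in>Y. (norm (D (e j)))\<^sup>2) \<le> (\<Sum>\<^sub>\<infinity>j. (norm (D (e j)))\<^sup>2)"
    by (rule finite_sum_le_infsum) (use assms in auto)
  then show ?thesis by (simp add: hs_norm_def L2_set_def)
qed

lemma hs_norm_nonneg [simp]: "0 \<le> hs_norm D"
  by (simp add: hs_norm_def infsum_nonneg)

context
  fixes D assumes D: "D \<in> hilbert_schmidt_operators S"
begin

text \<open>Cauchy-Schwarz in j: the numbers \<open>norm (D (e j))\<close> are square summable since
  D is Hilbert-Schmidt, the contractions with \<open>de j\<close> because the dual basis is a Bessel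
  family. All bounds for \<open>lap\<close> and \<open>contract\<close> rest on this
  estimate.\<close>

lemma sum_tnorm_contract_le:
  assumes t: "hs_jet t" and Y: "finite Y"
  shows "(\<Sum>j\<in>Y. tnorm n (\<lambda>vs. t ((0, de j) # (D (e j), 0) # vs))) \<le> hs_norm D * tnorm (Suc (Suc n)) t"
proof -
  have "(\<Sum>j\<in>Y. tnorm n (\<lambda>vs. t ((0, de j) # (D (e j), 0) # vs)))
      \<le> (\<Sum>j\<in>Y. \<bar>norm (D (e j))\<bar> * \<bar>tnorm (Suc n) (\<lambda>vs. t ((0, de j) # vs))\<bar>)"
  proof (rule sum_mono)
    fix j
    show "tnorm n (\<lambda>vs. t ((0, de j) # (D (e j), 0) # vs))
        \<le> \<bar>norm (D (e j))\<bar> * \<bar>tnorm (Suc n) (\<lambda>vs. t ((0, de j) # vs))\<bar>"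
      using tnorm_front_le[OF hs_jet_front[OF t, of "(0, de j)"], of n "(D (e j), 0)"]
      by (simp add: norm_Pair)
  qed
  also have "\<dots> \<le> L2_set (\<lambda>j. norm (D (e j))) Y * L2_set (\<lambda>j. tnorm (Suc n) (\<lambda>vs. t ((0, de j) # vs))) Y"
    by (rule L2_set_mult_ineq)
  also have "\<dots> \<le> hs_norm D * tnorm (Suc (Suc n)) t"
  proof (rule mult_mono)
    show "L2_set (\<lambda>j. tnorm (Suc n) (\<lambda>vs. t ((0, de j) # vs))) Y \<le> tnorm (Suc (Suc n)) t"
      using sum_tnorm_front_le[OF hs_jetD[OF t] hs_jet_le[OF t] bessel_de Y, of "Suc n"]
      by (simp add: L2_set_le_iff)
  qed (use hs_norm_L2[OF D Y] in auto)
  finally show ?thesis .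
qed

lemma deriv_form_dird_dird:
  "F \<in> HS \<Longrightarrow> deriv_form (dird v (dird u F)) w = (\<lambda>vs. deriv_form F w (u # v # vs))"
  by (rule ext) (simp add: deriv_form_dird dird_HS)

lemma sum_tnorm_lap_le:
  assumes F: "F \<in> HS" and Y: "finite Y"
  shows "(\<Sum>j\<in>Y. tnorm n (deriv_form (dird (D (e j), 0) (dird (0, de j) F)) w))
    \<le> hs_norm D * tnorm (Suc (Suc n)) (deriv_form F w)"
  unfolding deriv_form_dird_dird[OF F] by (rule sum_tnorm_contract_le[OF HS_jet[OF F] Y])

lemma hs_summable_lap:
  assumes F: "F \<in> HS"
  shows "hs_summable (\<lambda>j. dird (D (e j), 0) (dird (0, de j) F))"
  unfolding hs_summable_def
proof (intro conjI allI)
  show "dird (D (e j), 0) (dird (0, de j) F) \<in> HS" for j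
    by (intro dird_HS F)
  fix n w
  obtain \<rho> C where \<rho>: "0 < \<rho>" "\<And>w'. w' \<in> ball w \<rho> \<Longrightarrow> hs_le (Suc (Suc n)) (deriv_form F w') C"
    using hs_field_bounded[OF hs_functions_hs_field[OF F], where n = "Suc (Suc n)" and w = w] by blast
  have "(\<Sum>j\<in>Y. tnorm n (deriv_form (dird (D (e j), 0) (dird (0, de j) F)) w')) \<le> hs_norm D * C"
    if "w' \<in> ball w \<rho>" "finite Y" for w' Y
    using \<rho>(2)[OF that(1)]
    by (intro order_trans[OF sum_tnorm_lap_le[OF F that(2)]] mult_left_mono) (auto simp: hs_le_iff)
  then show "\<exists>\<rho>>0. \<exists>C. \<forall>w'\<in>ball w \<rho>. \<forall>Y. finite Y \<longrightarrow>
      (\<Sum>j\<in>Y. tnorm n (deriv_form (dird (D (e j), 0) (dird (0, de j) F)) w')) \<le> C"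
    using \<rho>(1) by blast
qed

lemma lap_HS: "F \<in> HS \<Longrightarrow> lap D F \<in> HS"
  unfolding lap_def by (rule hs_summableD(4)[OF hs_summable_lap])

lemma deriv_form_lap:
  assumes F: "F \<in> HS"
  shows "deriv_form (lap D F) w vs = (\<Sum>\<^sub>\<infinity>j. deriv_form F w ((0, de j) # (D (e j), 0) # vs))"
  unfolding lap_def hs_summableD(5)[OF hs_summable_lap[OF F]]
  by (simp only: deriv_form_dird[OF dird_HS[OF F]] deriv_form_dird[OF F])

lemma tnorm_lap_le: "F \<in> HS \<Longrightarrow> tnorm n (deriv_form (lap D F) w) \<le> hs_norm D * tnorm (Suc (Suc n)) (deriv_form F w)"
  unfolding lap_def by (rule tnorm_series_le[OF hs_summable_lap sum_tnorm_lap_le])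

lemma lap_add: "F \<in> HS \<Longrightarrow> G \<in> HS \<Longrightarrow> lap D (\<lambda>w. F w + G w) = (\<lambda>w. lap D F w + lap D G w)"
  unfolding lap_def
  by (simp add: dird_add dird_HS) (intro ext infsum_add hs_summableD(3)[OF hs_summable_lap])

lemma lap_scale: "F \<in> HS \<Longrightarrow> lap D (\<lambda>w. c * F w) = (\<lambda>w. c * lap D F w)"
  unfolding lap_def
  by (simp add: dird_scale dird_HS) (intro ext infsum_cmult_right hs_summableD(3)[OF hs_summable_lap])

lemma lap_const: "lap D (\<lambda>_. c) = (\<lambda>_. 0)"
proof -
  have "dird (0, de j) (\<lambda>_. c) = (\<lambda>_. 0)" "dird v (\<lambda>_. 0) = (\<lambda>_. 0)" for j v
    by (auto simp: dird_def deriv_form_const)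
  then show ?thesis by (simp add: lap_def)
qed

lemma lap_sum: "(\<And>b. b \<in> Y \<Longrightarrow> F b \<in> HS) \<Longrightarrow> lap D (\<lambda>w. \<Sum>b\<in>Y. F b w) = (\<lambda>w. \<Sum>b\<in>Y. lap D (F b) w)"
  by (induction Y rule: infinite_finite_induct) (auto simp: lap_const lap_add HS_sum)

text \<open>Constant coefficients: by symmetry of derivatives v may stand before or after the
  contracted slots.\<close>

lemma dird_lap:
  assumes F: "F \<in> HS"
  shows "dird v (lap D F) = lap D (dird v F)"
proof
  fix w
  have "dird v (lap D F) w = (\<Sum>\<^sub>\<infinity>j. deriv_form F w [(0, de j), (D (e j), 0), v])"
    unfolding dird_def[of v] deriv_form_lap[OF F] ..
  also have "\<dots> = (\<Sum>\<^sub>\<infinity>j. deriv_form F w [v, (0, de j), (D (e j), 0)])"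
    using deriv_form_snoc[OF F, of w "[_, _]" v] by simp
  also have "\<dots> = lap D (dird v F) w"
    using deriv_form_lap[OF dird_HS[OF F], of v w "[]"] by (simp add: deriv_form_dird[OF F])
  finally show "dird v (lap D F) w = lap D (dird v F) w" .
qed

lemma hs_summable_lap_image:
  assumes F: "hs_summable F"
  shows "hs_summable (\<lambda>b. lap D (F b))"
  unfolding hs_summable_def
proof (intro conjI allI)
  show "lap D (F b) \<in> HS" for b by (rule lap_HS[OF hs_summableD(1)[OF F]])
  fix n w
  obtain \<rho> C where \<rho>: "0 < \<rho>" "\<And>w' Y. w' \<in> ball w \<rho> \<Longrightarrow> finite Y \<Longrightarrow> (\<Sum>b\<in>Y. tnorm (Suc (Suc n)) (deriv_form (F b) w')) \<le> C"
    using hs_summable_bound[OF F] by blast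
  have "(\<Sum>b\<in>Y. tnorm n (deriv_form (lap D (F b)) w')) \<le> hs_norm D * C" if "w' \<in> ball w \<rho>" "finite Y" for w' Y
  proof -
    have "(\<Sum>b\<in>Y. tnorm n (deriv_form (lap D (F b)) w')) \<le> (\<Sum>b\<in>Y. hs_norm D * tnorm (Suc (Suc n)) (deriv_form (F b) w'))"
      by (rule sum_mono) (rule tnorm_lap_le[OF hs_summableD(1)[OF F]])
    also have "\<dots> \<le> hs_norm D * C"
      unfolding sum_distrib_left[symmetric] by (intro mult_left_mono \<rho>(2) that) simp
    finally show ?thesis .
  qed
  then show "\<exists>\<rho>>0. \<exists>C. \<forall>w'\<in>ball w \<rho>. \<forall>Y. finite Y \<longrightarrow> (\<Sum>b\<in>Y. tnorm n (deriv_form (lap D (F b)) w')) \<le> C"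
    using \<rho>(1) by blast
qed

text \<open>Two infinite sums are exchanged. The double sum converges absolutely: summing over j
  costs two orders, and in that order the sum over b is bounded by
  \<open>hs_summable\<close>.\<close>

lemma lap_series:
  assumes F: "hs_summable F"
  shows "lap D (\<lambda>w. \<Sum>\<^sub>\<infinity>b. F b w) = (\<lambda>w. \<Sum>\<^sub>\<infinity>b. lap D (F b) w)"
proof
  fix w
  let ?a = "\<lambda>j b. deriv_form (F b) w [(0, de j), (D (e j), 0)]"
  obtain \<rho> C where \<rho>: "0 < \<rho>" "\<And>w' Y. w' \<in> ball w \<rho> \<Longrightarrow> finite Y \<Longrightarrow> (\<Sum>b\<in>Y. tnorm (Suc (Suc 0)) (deriv_form (F b) w')) \<le> C"
    using hs_summable_bound[OF F] by blast
  have "(\<Sum>j\<in>X. \<Sum>b\<in>Y. norm (?a j b)) \<le> hs_norm D * C" if X: "finite X" and Y: "finite Y" for X Y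
  proof -
    have "(\<Sum>j\<in>X. \<Sum>b\<in>Y. norm (?a j b)) = (\<Sum>b\<in>Y. \<Sum>j\<in>X. norm (?a j b))" by (rule sum.swap)
    also have "\<dots> \<le> (\<Sum>b\<in>Y. hs_norm D * tnorm (Suc (Suc 0)) (deriv_form (F b) w))"
    proof (rule sum_mono)
      fix b
      have "norm (?a j b) = tnorm 0 (deriv_form (dird (D (e j), 0) (dird (0, de j) (F b))) w)" for j
        by (simp add: norm_le_tnorm_0[symmetric])
          (simp add: dird_def[of "(D (e j), 0)"] deriv_form_dird hs_summableD(1)[OF F])
      then show "(\<Sum>j\<in>X. norm (?a j b)) \<le> hs_norm D * tnorm (Suc (Suc 0)) (deriv_form (F b) w)"
        using sum_tnorm_lap_le[OF hs_summableD(1)[OF F] X] by simp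
    qed
    also have "\<dots> \<le> hs_norm D * C"
      unfolding sum_distrib_left[symmetric] using \<rho> Y by (intro mult_left_mono) auto
    finally show ?thesis .
  qed
  then have "(\<Sum>\<^sub>\<infinity>j. \<Sum>\<^sub>\<infinity>b. ?a j b) = (\<Sum>\<^sub>\<infinity>b. \<Sum>\<^sub>\<infinity>j. ?a j b)"
    by (rule infsum_swap_of_bound)
  then show "lap D (\<lambda>w. \<Sum>\<^sub>\<infinity>b. F b w) w = (\<Sum>\<^sub>\<infinity>b. lap D (F b) w)"
    using deriv_form_lap[OF hs_summableD(4)[OF F], of w "[]"] deriv_form_lap[OF hs_summableD(1)[OF F], of _ w "[]"]
    by (simp add: hs_summableD(5)[OF F])
qed

lemma lap_power_HS: "F \<in> HS \<Longrightarrow> (lap D ^^ i) F \<in> HS"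
  by (induction i) (auto intro: lap_HS)

lemma dird_lap_power: "F \<in> HS \<Longrightarrow> dird v ((lap D ^^ i) F) = (lap D ^^ i) (dird v F)"
  by (induction i) (auto simp: dird_lap lap_power_HS)

lemma lap_power_series:
  "hs_summable F \<Longrightarrow> hs_summable (\<lambda>b. (lap D ^^ i) (F b)) \<and>
    (lap D ^^ i) (\<lambda>w. \<Sum>\<^sub>\<infinity>b. F b w) = (\<lambda>w. \<Sum>\<^sub>\<infinity>b. (lap D ^^ i) (F b) w)"
  by (induction i) (auto simp: lap_series intro: hs_summable_lap_image)

end

end

section \<open>Bidifferential operators\<close>

context phase_space
begin

text \<open>Only the loss of r orders in each argument is recorded, not the form of the operator; c
  is independent of w because the coefficients are constant. This bound makes series over Bessel
  families converge.\<close>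

definition bidiff :: "nat \<Rightarrow> (('h \<times> 'd \<Rightarrow> 'k) \<Rightarrow> ('h \<times> 'd \<Rightarrow> 'k) \<Rightarrow> 'h \<times> 'd \<Rightarrow> 'k) \<Rightarrow> bool" where
  "bidiff r E \<longleftrightarrow>
     (\<forall>F\<in>HS. \<forall>G\<in>HS. E F G \<in> HS) \<and>
     (\<forall>F\<in>HS. \<forall>F'\<in>HS. \<forall>G\<in>HS. E (\<lambda>w. F w + F' w) G = (\<lambda>w. E F G w + E F' G w)) \<and>
     (\<forall>F\<in>HS. \<forall>G\<in>HS. \<forall>G'\<in>HS. E F (\<lambda>w. G w + G' w) = (\<lambda>w. E F G w + E F G' w)) \<and>
     (\<forall>n. \<exists>c\<ge>0. \<forall>F\<in>HS. \<forall>G\<in>HS. \<forall>w. tnorm n (deriv_form (E F G) w)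
        \<le> c * (jnorm (n + r) (deriv_form F w) * jnorm (n + r) (deriv_form G w)))"

lemma bidiff_HS: "bidiff r E \<Longrightarrow> F \<in> HS \<Longrightarrow> G \<in> HS \<Longrightarrow> E F G \<in> HS"
  by (simp add: bidiff_def)

lemma bidiff_add_left: "bidiff r E \<Longrightarrow> F \<in> HS \<Longrightarrow> F' \<in> HS \<Longrightarrow> G \<in> HS \<Longrightarrow>
    E (\<lambda>w. F w + F' w) G = (\<lambda>w. E F G w + E F' G w)"
  by (simp add: bidiff_def)

lemma bidiff_add_right: "bidiff r E \<Longrightarrow> F \<in> HS \<Longrightarrow> G \<in> HS \<Longrightarrow> G' \<in> HS \<Longrightarrow>
    E F (\<lambda>w. G w + G' w) = (\<lambda>w. E F G w + E F G' w)"
  by (simp add: bidiff_def)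

lemma bidiff_bound:
  assumes "bidiff r E"
  obtains c where "0 \<le> c" "\<And>F G w. F \<in> HS \<Longrightarrow> G \<in> HS \<Longrightarrow> tnorm n (deriv_form (E F G) w)
        \<le> c * (jnorm (n + r) (deriv_form F w) * jnorm (n + r) (deriv_form G w))"
proof -
  have "\<exists>c\<ge>0. \<forall>F\<in>HS. \<forall>G\<in>HS. \<forall>w. tnorm n (deriv_form (E F G) w)
        \<le> c * (jnorm (n + r) (deriv_form F w) * jnorm (n + r) (deriv_form G w))"
    using assms by (simp add: bidiff_def)
  then show thesis using that by blast
qed

abbreviation pmult :: "('h \<times> 'd \<Rightarrow> 'k) \<Rightarrow> ('h \<times> 'd \<Rightarrow> 'k) \<Rightarrow> 'h \<times> 'd \<Rightarrow> 'k" where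
  "pmult F G \<equiv> (\<lambda>w. F w * G w)"

lemma bidiff_pmult: "bidiff 0 pmult"
proof -
  have "\<exists>c\<ge>0. \<forall>F\<in>HS. \<forall>G\<in>HS. \<forall>w. tnorm n (deriv_form (pmult F G) w)
        \<le> c * (jnorm (n + 0) (deriv_form F w) * jnorm (n + 0) (deriv_form G w))" for n
    by (rule exI[of _ "2 ^ n"]) (use hs_le_leibniz[OF HS_jet HS_jet] in \<open>auto simp: deriv_form_mult hs_le_iff\<close>)
  then show ?thesis
    unfolding bidiff_def by (auto simp: HS_mult distrib_left distrib_right)
qed

text \<open>Multiplies the symbol of E by the sum over b of the tensors of \<open>p b\<close>,
  acting on the first argument, with \<open>q b\<close>, acting on the second.\<close>

definition insert_pair :: "('b \<Rightarrow> 'h \<times> 'd) \<Rightarrow> ('b \<Rightarrow> 'h \<times> 'd) \<Rightarrow>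
    (('h \<times> 'd \<Rightarrow> 'k) \<Rightarrow> ('h \<times> 'd \<Rightarrow> 'k) \<Rightarrow> 'h \<times> 'd \<Rightarrow> 'k) \<Rightarrow>
    ('h \<times> 'd \<Rightarrow> 'k) \<Rightarrow> ('h \<times> 'd \<Rightarrow> 'k) \<Rightarrow> 'h \<times> 'd \<Rightarrow> 'k" where
  "insert_pair p q E F G = (\<lambda>w. \<Sum>\<^sub>\<infinity>b. E (dird (p b) F) (dird (q b) G) w)"

text \<open>Cauchy-Schwarz with one square summable factor from each function, so Bessel families
  suffice on both sides, in contrast to \<open>sum_tnorm_contract_le\<close>.\<close>

lemma sum_jnorm_dird_le:
  assumes "F \<in> HS" "G \<in> HS" "bessel p K" "bessel q L" "finite Y"
  shows "(\<Sum>b\<in>Y. jnorm n (deriv_form (dird (p b) F) w) * jnorm n (deriv_form (dird (q b) G) w))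
    \<le> K * L * (jnorm (Suc n) (deriv_form F w) * jnorm (Suc n) (deriv_form G w))"
proof -
  have KL: "0 \<le> K" "0 \<le> L" using assms by (auto simp: bessel_def)
  have a: "L2_set (\<lambda>b. jnorm n (deriv_form (dird (p b) F) w)) Y \<le> K * jnorm (Suc n) (deriv_form F w)"
    using sum_jnorm_front_le[OF HS_jet[OF assms(1)] assms(3,5)] KL by (simp add: L2_set_le_iff jnorm_dird assms)
  have b: "L2_set (\<lambda>b. jnorm n (deriv_form (dird (q b) G) w)) Y \<le> L * jnorm (Suc n) (deriv_form G w)"
    using sum_jnorm_front_le[OF HS_jet[OF assms(2)] assms(4,5)] KL by (simp add: L2_set_le_iff jnorm_dird assms)
  have "(\<Sum>b\<in>Y. jnorm n (deriv_form (dird (p b) F) w) * jnorm n (deriv_form (dird (q b) G) w))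
    \<le> L2_set (\<lambda>b. jnorm n (deriv_form (dird (p b) F) w)) Y * L2_set (\<lambda>b. jnorm n (deriv_form (dird (q b) G) w)) Y"
    using L2_set_mult_ineq[of "\<lambda>b. jnorm n (deriv_form (dird (p b) F) w)" "\<lambda>b. jnorm n (deriv_form (dird (q b) G) w)" Y] by simp
  also have "\<dots> \<le> (K * jnorm (Suc n) (deriv_form F w)) * (L * jnorm (Suc n) (deriv_form G w))"
    by (rule mult_mono[OF a b]) (use KL in auto)
  finally show ?thesis by (simp add: mult_ac)
qed

lemma sum_tnorm_insert_pair_le:
  assumes E: "bidiff r E" and p: "bessel p K" and q: "bessel q L"
  obtains c where "0 \<le> c" "\<And>F G w Y. F \<in> HS \<Longrightarrow> G \<in> HS \<Longrightarrow> finite Y \<Longrightarrow>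
    (\<Sum>b\<in>Y. tnorm n (deriv_form (E (dird (p b) F) (dird (q b) G)) w))
      \<le> c * (jnorm (n + Suc r) (deriv_form F w) * jnorm (n + Suc r) (deriv_form G w))"
proof -
  obtain c where c: "0 \<le> c" "\<And>F G w. F \<in> HS \<Longrightarrow> G \<in> HS \<Longrightarrow> tnorm n (deriv_form (E F G) w)
        \<le> c * (jnorm (n + r) (deriv_form F w) * jnorm (n + r) (deriv_form G w))"
    using bidiff_bound[OF E] by blast
  show thesis
  proof (rule that[of "c * (K * L)"])
    show "0 \<le> c * (K * L)" using c p q by (simp add: bessel_def)
    fix F G w and Y :: "'a set" assume FG: "F \<in> HS" "G \<in> HS" and Y: "finite Y"
    have "(\<Sum>b\<in>Y. tnorm n (deriv_form (E (dird (p b) F) (dird (q b) G)) w))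
        \<le> (\<Sum>b\<in>Y. c * (jnorm (n + r) (deriv_form (dird (p b) F) w) * jnorm (n + r) (deriv_form (dird (q b) G) w)))"
      by (rule sum_mono) (intro c(2) dird_HS FG)
    also have "\<dots> = c * (\<Sum>b\<in>Y. jnorm (n + r) (deriv_form (dird (p b) F) w) * jnorm (n + r) (deriv_form (dird (q b) G) w))"
      by (simp add: sum_distrib_left)
    also have "\<dots> \<le> c * (K * L * (jnorm (Suc (n + r)) (deriv_form F w) * jnorm (Suc (n + r)) (deriv_form G w)))"
      by (intro mult_left_mono sum_jnorm_dird_le FG p q Y c(1))
    finally show "(\<Sum>b\<in>Y. tnorm n (deriv_form (E (dird (p b) F) (dird (q b) G)) w))
      \<le> c * (K * L) * (jnorm (n + Suc r) (deriv_form F w) * jnorm (n + Suc r) (deriv_form G w))"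
      by (simp add: mult.assoc)
  qed
qed

lemma hs_summable_insert_pair:
  assumes E: "bidiff r E" and p: "bessel p K" and q: "bessel q L" and F: "F \<in> HS" and G: "G \<in> HS"
  shows "hs_summable (\<lambda>b. E (dird (p b) F) (dird (q b) G))"
  unfolding hs_summable_def
proof (intro conjI allI)
  show "E (dird (p b) F) (dird (q b) G) \<in> HS" for b
    by (intro bidiff_HS[OF E] dird_HS F G)
  fix n w
  obtain c where c: "0 \<le> c" "\<And>F G w Y. F \<in> HS \<Longrightarrow> G \<in> HS \<Longrightarrow> finite Y \<Longrightarrow>
    (\<Sum>b\<in>Y. tnorm n (deriv_form (E (dird (p b) F) (dird (q b) G)) w))
      \<le> c * (jnorm (n + Suc r) (deriv_form F w) * jnorm (n + Suc r) (deriv_form G w))"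
    using sum_tnorm_insert_pair_le[OF E p q] by blast
  obtain \<rho> C where 1: "0 < \<rho>" "\<And>w'. w' \<in> ball w \<rho> \<Longrightarrow> jnorm (n + Suc r) (deriv_form F w') \<le> C"
    using HS_jnorm_bounded[OF F] by blast
  obtain \<sigma> M where 2: "0 < \<sigma>" "\<And>w'. w' \<in> ball w \<sigma> \<Longrightarrow> jnorm (n + Suc r) (deriv_form G w') \<le> M"
    using HS_jnorm_bounded[OF G] by blast
  have "(\<Sum>b\<in>Y. tnorm n (deriv_form (E (dird (p b) F) (dird (q b) G)) w')) \<le> c * (C * M)"
    if w': "w' \<in> ball w (min \<rho> \<sigma>)" and Y: "finite Y" for w' Y
  proof -
    have a: "jnorm (n + Suc r) (deriv_form F w') \<le> C" and b: "jnorm (n + Suc r) (deriv_form G w') \<le> M"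
      using 1(2)[of w'] 2(2)[of w'] w' by auto
    have "jnorm (n + Suc r) (deriv_form F w') * jnorm (n + Suc r) (deriv_form G w') \<le> C * M"
      by (rule mult_mono[OF a b order_trans[OF jnorm_nonneg a] jnorm_nonneg])
    then show ?thesis
      using order_trans[OF c(2)[OF F G Y] mult_left_mono[OF _ c(1)]] by blast
  qed
  moreover have "0 < min \<rho> \<sigma>" using 1(1) 2(1) by simp
  ultimately show "\<exists>\<rho>>0. \<exists>C. \<forall>w'\<in>ball w \<rho>. \<forall>Y. finite Y \<longrightarrow>
      (\<Sum>b\<in>Y. tnorm n (deriv_form (E (dird (p b) F) (dird (q b) G)) w')) \<le> C"
    by blast
qed

lemma bidiff_insert_pair:
  assumes E: "bidiff r E" and p: "bessel p K" and q: "bessel q L"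
  shows "bidiff (Suc r) (insert_pair p q E)"
proof -
  note sm = hs_summable_insert_pair[OF E p q]
  have "insert_pair p q E F G \<in> HS" if "F \<in> HS" "G \<in> HS" for F G
    unfolding insert_pair_def by (rule hs_summableD(4)[OF sm[OF that]])
  moreover have "insert_pair p q E (\<lambda>w. F w + F' w) G = (\<lambda>w. insert_pair p q E F G w + insert_pair p q E F' G w)"
    if "F \<in> HS" "F' \<in> HS" "G \<in> HS" for F F' G
    unfolding insert_pair_def using that
    by (simp add: dird_add bidiff_add_left[OF E] dird_HS)
      (intro ext infsum_add hs_summableD(3)[OF sm] that)
  moreover have "insert_pair p q E F (\<lambda>w. G w + G' w) = (\<lambda>w. insert_pair p q E F G w + insert_pair p q E F G' w)"
    if "F \<in> HS" "G \<in> HS" "G' \<in> HS" for F G G'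
    unfolding insert_pair_def using that
    by (simp add: dird_add bidiff_add_right[OF E] dird_HS)
      (intro ext infsum_add hs_summableD(3)[OF sm] that)
  moreover have "\<exists>c\<ge>0. \<forall>F\<in>HS. \<forall>G\<in>HS. \<forall>w. tnorm n (deriv_form (insert_pair p q E F G) w)
        \<le> c * (jnorm (n + Suc r) (deriv_form F w) * jnorm (n + Suc r) (deriv_form G w))" for n
  proof -
    obtain c where c: "0 \<le> c" "\<And>F G w Y. F \<in> HS \<Longrightarrow> G \<in> HS \<Longrightarrow> finite Y \<Longrightarrow>
      (\<Sum>b\<in>Y. tnorm n (deriv_form (E (dird (p b) F) (dird (q b) G)) w))
        \<le> c * (jnorm (n + Suc r) (deriv_form F w) * jnorm (n + Suc r) (deriv_form G w))"
      using sum_tnorm_insert_pair_le[OF E p q] by blast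
    have "tnorm n (deriv_form (insert_pair p q E F G) w)
        \<le> c * (jnorm (n + Suc r) (deriv_form F w) * jnorm (n + Suc r) (deriv_form G w))" if "F \<in> HS" "G \<in> HS" for F G w
      unfolding insert_pair_def by (rule tnorm_series_le[OF sm[OF that] c(2)[OF that]])
    then show ?thesis using c(1) by blast
  qed
  ultimately show ?thesis unfolding bidiff_def by blast
qed

text \<open>Directional derivatives commute, so both iterated sums have the same terms; the double
  family is absolutely summable by the bound for E and the Bessel constants.\<close>

lemma insert_pair_swap:
  assumes E: "bidiff r E" and p: "bessel p K" and q: "bessel q L" and p': "bessel p' K'" and q': "bessel q' L'"
    and F: "F \<in> HS" and G: "G \<in> HS"
  shows "insert_pair p q (insert_pair p' q' E) F G = insert_pair p' q' (insert_pair p q E) F G"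
proof
  fix w
  let ?a = "\<lambda>b b'. E (dird (p' b') (dird (p b) F)) (dird (q' b') (dird (q b) G)) w"
  obtain c where c: "0 \<le> c" "\<And>F G w Y. F \<in> HS \<Longrightarrow> G \<in> HS \<Longrightarrow> finite Y \<Longrightarrow>
    (\<Sum>b\<in>Y. tnorm 0 (deriv_form (E (dird (p' b) F) (dird (q' b) G)) w))
      \<le> c * (jnorm (0 + Suc r) (deriv_form F w) * jnorm (0 + Suc r) (deriv_form G w))"
    using sum_tnorm_insert_pair_le[OF E p' q'] by blast
  define C where "C = c * (K * L * (jnorm (Suc (Suc r)) (deriv_form F w) * jnorm (Suc (Suc r)) (deriv_form G w)))"
  have "(\<Sum>b\<in>X. \<Sum>b'\<in>Y. norm (?a b b')) \<le> C" if X: "finite X" and Y: "finite Y" for X Y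
  proof -
    have "(\<Sum>b\<in>X. \<Sum>b'\<in>Y. norm (?a b b')) \<le> (\<Sum>b\<in>X. c * (jnorm (Suc r) (deriv_form (dird (p b) F) w) * jnorm (Suc r) (deriv_form (dird (q b) G) w)))"
      by (rule sum_mono) (use c(2)[OF dird_HS[OF F] dird_HS[OF G] Y] in \<open>simp add: norm_le_tnorm_0\<close>)
    also have "\<dots> \<le> C"
      unfolding sum_distrib_left[symmetric] C_def
      by (intro mult_left_mono sum_jnorm_dird_le F G p q X c(1))
    finally show ?thesis .
  qed
  then have "(\<Sum>\<^sub>\<infinity>b. \<Sum>\<^sub>\<infinity>b'. ?a b b') = (\<Sum>\<^sub>\<infinity>b'. \<Sum>\<^sub>\<infinity>b. ?a b b')"
    by (rule infsum_swap_of_bound)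
  then show "insert_pair p q (insert_pair p' q' E) F G w = insert_pair p' q' (insert_pair p q E) F G w"
    by (simp add: insert_pair_def dird_swap[OF F, of "p' _"] dird_swap[OF G, of "q' _"])
qed

section \<open>The commutation relation of the second order operator with products\<close>

text \<open>Together with \<open>qfam Y\<close>, the flag tells which argument takes the operator:
  \<open>True\<close> gives the pairing of \<open>D\<^sub>1 F\<close> with
  \<open>X D\<^sub>2 G\<close>, \<open>False\<close> that of \<open>D\<^sub>1 G\<close> with
  \<open>Y D\<^sub>2 F\<close>. For \<open>X = A + id_blinfun\<close> and
  \<open>Y = A - id_blinfun\<close> the sum is \<open>bform S A\<close>.\<close>

definition pfam :: "('h \<Rightarrow>\<^sub>L 'h) \<Rightarrow> bool \<times> nat \<Rightarrow> 'h \<times> 'd" where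
  "pfam X = (\<lambda>(b, j). if b then (X (e j), 0) else (0, de j))"

definition qfam :: "('h \<Rightarrow>\<^sub>L 'h) \<Rightarrow> bool \<times> nat \<Rightarrow> 'h \<times> 'd" where
  "qfam X = (\<lambda>(b, j). if b then (0, de j) else (X (e j), 0))"

lemma bessel_pfam: "X \<in> bounded_operators S \<Longrightarrow> bessel (pfam X) (norm X + 1)"
  unfolding pfam_def by (rule bessel_bool[OF bessel_operator bessel_de])

lemma bessel_qfam: "X \<in> bounded_operators S \<Longrightarrow> bessel (qfam X) (1 + norm X)"
  unfolding qfam_def by (rule bessel_bool[OF bessel_de bessel_operator])

abbreviation ins :: "('h \<Rightarrow>\<^sub>L 'h) \<Rightarrow> ('h \<Rightarrow>\<^sub>L 'h) \<Rightarrow>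
    (('h \<times> 'd \<Rightarrow> 'k) \<Rightarrow> ('h \<times> 'd \<Rightarrow> 'k) \<Rightarrow> 'h \<times> 'd \<Rightarrow> 'k) \<Rightarrow>
    ('h \<times> 'd \<Rightarrow> 'k) \<Rightarrow> ('h \<times> 'd \<Rightarrow> 'k) \<Rightarrow> 'h \<times> 'd \<Rightarrow> 'k" where
  "ins X Y \<equiv> insert_pair (pfam X) (qfam Y)"

lemma hs_bounded: "D \<in> hilbert_schmidt_operators S \<Longrightarrow> D \<in> bounded_operators S"
  by (simp add: hilbert_schmidt_operators_def)

lemma bounded_operators_add: "X \<in> bounded_operators S \<Longrightarrow> Y \<in> bounded_operators S \<Longrightarrow> X + Y \<in> bounded_operators S"
  by (simp add: bounded_operators_def blinfun.add_left H.scale_right_distrib)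

lemma bounded_operators_diff: "X \<in> bounded_operators S \<Longrightarrow> Y \<in> bounded_operators S \<Longrightarrow> X - Y \<in> bounded_operators S"
  by (simp add: bounded_operators_def blinfun.diff_left H.scale_right_diff_distrib)

lemma bounded_operators_id: "id_blinfun \<in> bounded_operators S"
  by (simp add: bounded_operators_def)

lemma bidiff_ins:
  "bidiff r E \<Longrightarrow> X \<in> bounded_operators S \<Longrightarrow> Y \<in> bounded_operators S \<Longrightarrow> bidiff (Suc r) (ins X Y E)"
  by (rule bidiff_insert_pair[OF _ bessel_pfam bessel_qfam])

lemma hs_summable_ins:
  "bidiff r E \<Longrightarrow> X \<in> bounded_operators S \<Longrightarrow> Y \<in> bounded_operators S \<Longrightarrow> F \<in> HS \<Longrightarrow> G \<in> HS \<Longrightarrow>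
    hs_summable (\<lambda>b. E (dird (pfam X b) F) (dird (qfam Y b) G))"
  by (rule hs_summable_insert_pair[OF _ bessel_pfam bessel_qfam])

text \<open>An index involves either X or Y but never both, so the operator is additive in the pair
  (X, Y) although it looks bilinear. The passage from B to A is thus one additional insertion of A -
  B.\<close>

lemma ins_add:
  assumes E: "bidiff r E" and X: "X \<in> bounded_operators S" "X' \<in> bounded_operators S"
    and Y: "Y \<in> bounded_operators S" "Y' \<in> bounded_operators S" and F: "F \<in> HS" and G: "G \<in> HS"
  shows "ins (X + X') (Y + Y') E F G w = ins X Y E F G w + ins X' Y' E F G w"
proof -
  have "E (dird (pfam (X + X') b) F) (dird (qfam (Y + Y') b) G) w
      = E (dird (pfam X b) F) (dird (qfam Y b) G) w + E (dird (pfam X' b) F) (dird (qfam Y' b) G) w" for b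
  proof (cases b)
    case (Pair c j)
    have *: "(blinfun_apply (Z + Z') (e j), 0) = (Z (e j), 0::'d) + (blinfun_apply Z' (e j), 0)" for Z Z'
      by (simp add: blinfun.add_left)
    show ?thesis
      unfolding Pair pfam_def qfam_def
      by (cases c) (simp_all add: * dird_add_vector F G bidiff_add_left[OF E] bidiff_add_right[OF E] dird_HS del: add_Pair)
  qed
  then show ?thesis
    unfolding insert_pair_def
    by (simp add: infsum_add hs_summableD(3)[OF hs_summable_ins[OF E X(1) Y(1) F G]]
        hs_summableD(3)[OF hs_summable_ins[OF E X(2) Y(2) F G]])
qed

context
  fixes D assumes D: "D \<in> hilbert_schmidt_operators S"
begin

text \<open>Measures how \<open>lap D\<close> fails to be a derivation of E. For E the product it is
  the second order product rule; it is a predicate of E because insertions inherit it.\<close>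

definition lap_rule :: "(('h \<times> 'd \<Rightarrow> 'k) \<Rightarrow> ('h \<times> 'd \<Rightarrow> 'k) \<Rightarrow> 'h \<times> 'd \<Rightarrow> 'k) \<Rightarrow> bool" where
  "lap_rule E \<longleftrightarrow> (\<forall>F\<in>HS. \<forall>G\<in>HS. lap D (E F G) = (\<lambda>w. E (lap D F) G w + E F (lap D G) w + ins D D E F G w))"

lemma lap_rule_pmult: "lap_rule pmult"
  unfolding lap_rule_def
proof (intro ballI ext)
  fix F G w assume F: "F \<in> HS" and G: "G \<in> HS"
  let ?p = "\<lambda>j. (D (e j), 0::'d)" and ?q = "\<lambda>j. (0::'h, de j)"
  note b = hs_bounded[OF D]
  \<comment> \<open>The mixed terms of the product rule are the two halves of
    \<open>ins D D pmult\<close>.\<close>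
  have eq: "dird (?p j) (dird (?q j) (pmult F G)) w
      = dird (?p j) (dird (?q j) F) w * G w + F w * dird (?p j) (dird (?q j) G) w
        + (dird (?q j) F w * dird (?p j) G w + dird (?p j) F w * dird (?q j) G w)" for j
    by (simp add: dird_mult F G dird_add HS_mult dird_HS algebra_simps)
  have sF: "(\<lambda>j. dird (?p j) (dird (?q j) F) w * G w) summable_on UNIV"
    by (rule summable_on_cmult_left[OF hs_summableD(3)[OF hs_summable_lap[OF D F]]])
  have sG: "(\<lambda>j. F w * dird (?p j) (dird (?q j) G) w) summable_on UNIV"
    by (rule summable_on_cmult_right[OF hs_summableD(3)[OF hs_summable_lap[OF D G]]])
  have s: "(\<lambda>b. pmult (dird (pfam D b) F) (dird (qfam D b) G) w) summable_on UNIV"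
    by (rule hs_summableD(3)[OF hs_summable_ins[OF bidiff_pmult b b F G]])
  have s1: "(\<lambda>j. dird (?q j) F w * dird (?p j) G w) summable_on UNIV"
    using infsum_bool_split(2)[OF s, of False] by (simp add: pfam_def qfam_def)
  have s2: "(\<lambda>j. dird (?p j) F w * dird (?q j) G w) summable_on UNIV"
    using infsum_bool_split(2)[OF s, of True] by (simp add: pfam_def qfam_def)
  have "ins D D pmult F G w = (\<Sum>\<^sub>\<infinity>j. dird (?q j) F w * dird (?p j) G w) + (\<Sum>\<^sub>\<infinity>j. dird (?p j) F w * dird (?q j) G w)"
    unfolding insert_pair_def infsum_bool_split(1)[OF s] by (simp add: pfam_def qfam_def)
  moreover have "lap D F w * G w = (\<Sum>\<^sub>\<infinity>j. dird (?p j) (dird (?q j) F) w * G w)"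
    unfolding lap_def by (rule infsum_cmult_left[symmetric, OF hs_summableD(3)[OF hs_summable_lap[OF D F]]])
  moreover have "F w * lap D G w = (\<Sum>\<^sub>\<infinity>j. F w * dird (?p j) (dird (?q j) G) w)"
    unfolding lap_def by (rule infsum_cmult_right[symmetric, OF hs_summableD(3)[OF hs_summable_lap[OF D G]]])
  ultimately show "lap D (pmult F G) w = pmult (lap D F) G w + pmult F (lap D G) w + ins D D pmult F G w"
    unfolding lap_def[of D "pmult F G"] eq
    by (simp add: infsum_add sF sG s1 s2 summable_on_add)
qed

text \<open>\<open>lap D\<close> passes through the series over b and the derivatives. The rule for
  E then produces an inner \<open>ins D D\<close>, which \<open>insert_pair_swap\<close> brings to
  the outside.\<close>

lemma lap_rule_ins:
  assumes E: "bidiff r E" and EL: "lap_rule E" and X: "X \<in> bounded_operators S" and Y: "Y \<in> bounded_operators S"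
  shows "lap_rule (ins X Y E)"
  unfolding lap_rule_def
proof (intro ballI ext)
  fix F G w assume F: "F \<in> HS" and G: "G \<in> HS"
  note b = hs_bounded[OF D]
  note E' = bidiff_ins[OF E b b]
  have "lap D (ins X Y E F G) w = (\<Sum>\<^sub>\<infinity>b. lap D (E (dird (pfam X b) F) (dird (qfam Y b) G)) w)"
    unfolding insert_pair_def[of _ _ E] lap_series[OF D hs_summable_ins[OF E X Y F G]] ..
  also have "\<dots> = (\<Sum>\<^sub>\<infinity>b. E (dird (pfam X b) (lap D F)) (dird (qfam Y b) G) w + E (dird (pfam X b) F) (dird (qfam Y b) (lap D G)) w
      + ins D D E (dird (pfam X b) F) (dird (qfam Y b) G) w)"
    using EL unfolding lap_rule_def by (simp add: dird_HS F G dird_lap[OF D F] dird_lap[OF D G])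
  also have "\<dots> = ins X Y E (lap D F) G w + ins X Y E F (lap D G) w + ins X Y (ins D D E) F G w"
    unfolding insert_pair_def[of "pfam X"]
    using hs_summableD(3)[OF hs_summable_ins[OF E X Y lap_HS[OF D F] G]] hs_summableD(3)[OF hs_summable_ins[OF E X Y F lap_HS[OF D G]]]
      hs_summableD(3)[OF hs_summable_ins[OF E' X Y F G]]
    by (simp add: infsum_add summable_on_add)
  also have "ins X Y (ins D D E) F G = ins D D (ins X Y E) F G"
    by (rule insert_pair_swap[OF E bessel_pfam[OF X] bessel_qfam[OF Y] bessel_pfam[OF b] bessel_qfam[OF b] F G])
  finally show "lap D (ins X Y E F G) w = ins X Y E (lap D F) G w + ins X Y E F (lap D G) w + ins D D (ins X Y E) F G w" .
qed

end

end

section \<open>The intertwining identity\<close>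

text \<open>Exponents in degree n of a product of three exponential series. The set is symmetric in
  the three coordinates, unlike the nested sums in \<open>star\<close>.\<close>

definition triples :: "nat \<Rightarrow> (nat \<times> nat \<times> nat) set" where
  "triples n = {(r, i, j). r + i + j = n}"

lemma finite_triples: "finite (triples n)"
  by (rule finite_subset[of _ "{..n} \<times> {..n} \<times> {..n}"]) (auto simp: triples_def)

definition pairs :: "nat \<Rightarrow> (nat \<times> nat) set" where
  "pairs n = {(i, m). i + m = n}"

lemma finite_pairs: "finite (pairs n)"
  by (rule finite_subset[of _ "{..n} \<times> {..n}"]) (auto simp: pairs_def)

lemma of_nat_mult_inverse_fact: "of_nat (Suc r) * inverse (fact (Suc r)) = (inverse (fact r) :: 'a::field_char_0)"
  by (simp add: field_simps del: of_nat_Suc)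

lemma fact_weight_Suc:
  fixes a b y :: "'a::field_char_0"
  shows "of_nat (Suc r) * (inverse (a * fact (Suc r) * b) * y) = inverse (a * fact r * b) * y"
    and "of_nat (Suc r) * (inverse (fact (Suc r) * b) * y) = inverse (fact r * b) * y"
    and "of_nat (Suc r) * (inverse (a * fact (Suc r)) * y) = inverse (a * fact r) * y"
proof -
  have *: "of_nat (Suc r) * (inverse (a * fact (Suc r) * b) * y) = inverse (a * fact r * b) * y" for a b :: 'a
  proof -
    have "of_nat (Suc r) * (inverse (a * fact (Suc r) * b) * y)
        = inverse a * (of_nat (Suc r) * inverse (fact (Suc r))) * inverse b * y"
      by (simp only: inverse_mult_distrib mult_ac)
    then show ?thesis by (simp only: of_nat_mult_inverse_fact inverse_mult_distrib)
  qed
  from *[of a b] *[of 1 b] *[of a 1] show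
    "of_nat (Suc r) * (inverse (a * fact (Suc r) * b) * y) = inverse (a * fact r * b) * y"
    "of_nat (Suc r) * (inverse (fact (Suc r) * b) * y) = inverse (fact r * b) * y"
    "of_nat (Suc r) * (inverse (a * fact (Suc r)) * y) = inverse (a * fact r) * y"
    by (simp_all only: mult_1_left mult_1_right)
qed

lemma sum_triples: "(\<Sum>(r, i, j)\<in>triples n. f r i j) = (\<Sum>(r, m)\<in>pairs n. \<Sum>(i, j)\<in>pairs m. f r i j)"
proof -
  have "(\<Sum>(r, m)\<in>pairs n. \<Sum>(i, j)\<in>pairs m. f r i j)
      = (\<Sum>((r, m), (i, j))\<in>(SIGMA x:pairs n. pairs (snd x)). f r i j)"
    by (subst sum.Sigma[symmetric]) (auto simp: finite_pairs case_prod_unfold)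
  also have "\<dots> = (\<Sum>(r, i, j)\<in>triples n. f r i j)"
    by (rule sum.reindex_bij_witness[where i = "\<lambda>(r, i, j). ((r, i + j), (i, j))" and j = "\<lambda>((r, m), (i, j)). (r, i, j)"])
      (auto simp: pairs_def triples_def)
  finally show ?thesis by simp
qed

lemma sum_pairs: "(\<Sum>(r, m)\<in>pairs n. f r m) = (\<Sum>r\<le>n. f r (n - r))"
  by (rule sum.reindex_bij_witness[where i = "\<lambda>r. (r, n - r)" and j = fst]) (auto simp: pairs_def)

text \<open>This is the derivative of a product of three exponential series: \<open>Suc n\<close> is
  split as \<open>r + i + j\<close>, and each summand cancels the top factor of its own
  factorial.\<close>

lemma sum_triples_Suc:
  fixes f :: "nat \<Rightarrow> nat \<Rightarrow> nat \<Rightarrow> 'a::field_char_0"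
  shows "of_nat (Suc n) * (\<Sum>(r, i, j)\<in>triples (Suc n). inverse (fact r * fact i * fact j) * f r i j)
    = (\<Sum>(r, i, j)\<in>triples n. inverse (fact r * fact i * fact j) * (f (Suc r) i j + f r (Suc i) j + f r i (Suc j)))"
proof -
  let ?w = "\<lambda>r i j. inverse (fact r * fact i * fact j) :: 'a"
  \<comment> \<open>Reindexing along the shift s of one coordinate; c is that coordinate, and it
    vanishes on the triples missed by s.\<close>
  have red: "(\<Sum>(r, i, j)\<in>triples (Suc n). of_nat (c (r, i, j)) * (?w r i j * f r i j))
      = (\<Sum>(r, i, j)\<in>triples n. of_nat (c (s (r, i, j))) * ((\<lambda>(r, i, j). ?w r i j * f r i j) (s (r, i, j))))"
    if s: "inj s" "s ` triples n \<subseteq> triples (Suc n)" and z: "\<And>x. x \<in> triples (Suc n) \<Longrightarrow> x \<notin> s ` triples n \<Longrightarrow> c x = 0" for c s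
  proof -
    have "(\<Sum>(r, i, j)\<in>triples (Suc n). of_nat (c (r, i, j)) * (?w r i j * f r i j))
        = (\<Sum>x\<in>triples (Suc n). of_nat (c x) * ((\<lambda>(r, i, j). ?w r i j * f r i j) x))"
      by (simp add: case_prod_unfold)
    also have "\<dots> = (\<Sum>x\<in>s ` triples n. of_nat (c x) * ((\<lambda>(r, i, j). ?w r i j * f r i j) x))"
      by (rule sum.mono_neutral_right[OF finite_triples s(2)]) (use z in auto)
    also have "\<dots> = (\<Sum>x\<in>triples n. of_nat (c (s x)) * ((\<lambda>(r, i, j). ?w r i j * f r i j) (s x)))"
      by (subst sum.reindex) (auto intro: inj_on_subset[OF s(1)])
    finally show ?thesis by (simp add: case_prod_unfold)
  qed
  have 1: "(\<Sum>(r, i, j)\<in>triples (Suc n). of_nat r * (?w r i j * f r i j)) = (\<Sum>(r, i, j)\<in>triples n. ?w r i j * f (Suc r) i j)"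
  proof -
    have "(\<Sum>(r, i, j)\<in>triples (Suc n). of_nat (fst (r, i, j)) * (?w r i j * f r i j))
      = (\<Sum>(r, i, j)\<in>triples n. of_nat (fst ((\<lambda>(r, i, j). (Suc r, i, j)) (r, i, j))) * ((\<lambda>(r, i, j). ?w r i j * f r i j) ((\<lambda>(r, i, j). (Suc r, i, j)) (r, i, j))))"
    proof (rule red, goal_cases)
      case (3 x)
      then show ?case by (cases x; cases "fst x") (force simp: triples_def)+
    qed (auto simp: inj_def triples_def)
    also have "\<dots> = (\<Sum>(r, i, j)\<in>triples n. ?w r i j * f (Suc r) i j)"
      by (simp only: fact_weight_Suc mult.assoc case_prod_conv fst_conv snd_conv)
    finally show ?thesis by simp
  qed
  have 2: "(\<Sum>(r, i, j)\<in>triples (Suc n). of_nat i * (?w r i j * f r i j)) = (\<Sum>(r, i, j)\<in>triples n. ?w r i j * f r (Suc i) j)"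
  proof -
    have "(\<Sum>(r, i, j)\<in>triples (Suc n). of_nat (fst (snd (r, i, j))) * (?w r i j * f r i j))
      = (\<Sum>(r, i, j)\<in>triples n. of_nat (fst (snd ((\<lambda>(r, i, j). (r, Suc i, j)) (r, i, j)))) * ((\<lambda>(r, i, j). ?w r i j * f r i j) ((\<lambda>(r, i, j). (r, Suc i, j)) (r, i, j))))"
    proof (rule red[where c = "\<lambda>x. fst (snd x)"], goal_cases)
      case (3 x)
      then show ?case by (cases x; cases "fst (snd x)") (force simp: triples_def)+
    qed (auto simp: inj_def triples_def)
    also have "\<dots> = (\<Sum>(r, i, j)\<in>triples n. ?w r i j * f r (Suc i) j)"
      by (simp only: fact_weight_Suc case_prod_conv fst_conv snd_conv)
    finally show ?thesis by simp
  qed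
  have 3: "(\<Sum>(r, i, j)\<in>triples (Suc n). of_nat j * (?w r i j * f r i j)) = (\<Sum>(r, i, j)\<in>triples n. ?w r i j * f r i (Suc j))"
  proof -
    have "(\<Sum>(r, i, j)\<in>triples (Suc n). of_nat (snd (snd (r, i, j))) * (?w r i j * f r i j))
      = (\<Sum>(r, i, j)\<in>triples n. of_nat (snd (snd ((\<lambda>(r, i, j). (r, i, Suc j)) (r, i, j)))) * ((\<lambda>(r, i, j). ?w r i j * f r i j) ((\<lambda>(r, i, j). (r, i, Suc j)) (r, i, j))))"
    proof (rule red[where c = "\<lambda>x. snd (snd x)"], goal_cases)
      case (3 x)
      then show ?case by (cases x; cases "snd (snd x)") (force simp: triples_def)+
    qed (auto simp: inj_def triples_def)
    also have "\<dots> = (\<Sum>(r, i, j)\<in>triples n. ?w r i j * f r i (Suc j))"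
      by (simp only: fact_weight_Suc case_prod_conv fst_conv snd_conv)
    finally show ?thesis by simp
  qed
  have "of_nat (Suc n) * (\<Sum>(r, i, j)\<in>triples (Suc n). ?w r i j * f r i j)
      = (\<Sum>(r, i, j)\<in>triples (Suc n). of_nat r * (?w r i j * f r i j) + of_nat i * (?w r i j * f r i j) + of_nat j * (?w r i j * f r i j))"
    unfolding sum_distrib_left
  proof (intro sum.cong refl, clarify)
    fix r i j assume "(r, i, j) \<in> triples (Suc n)"
    then have "(of_nat (Suc n) :: 'a) = of_nat r + of_nat i + of_nat j"
      by (simp only: triples_def mem_Collect_eq case_prod_conv of_nat_add[symmetric])
    then show "of_nat (Suc n) * (?w r i j * f r i j)
        = of_nat r * (?w r i j * f r i j) + of_nat i * (?w r i j * f r i j) + of_nat j * (?w r i j * f r i j)"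
      by (simp only: distrib_right)
  qed
  then show ?thesis
    using 1 2 3 by (simp add: sum.distrib case_prod_unfold distrib_left)
qed

lemma sum_triples_0: "(\<Sum>(r, i, j)\<in>triples n. if j = 0 then f r i else 0) = (\<Sum>(r, i)\<in>pairs n. f r i)"
proof -
  have "(\<Sum>(r, i, j)\<in>triples n. if j = 0 then f r i else 0)
      = (\<Sum>(r, i, j)\<in>(\<lambda>(r, i). (r, i, 0::nat)) ` pairs n. if j = 0 then f r i else 0)"
    by (rule sum.mono_neutral_right[OF finite_triples]) (auto simp: triples_def pairs_def image_iff split_paired_Ex split_paired_All)
  also have "\<dots> = (\<Sum>(r, i)\<in>pairs n. f r i)"
    by (subst sum.reindex) (auto simp: inj_on_def case_prod_unfold)
  finally show ?thesis .
qed

text \<open>Two exponentials are three with all terms supported on \<open>j = 0\<close>; the shift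
  in j then contributes nothing.\<close>

lemma sum_pairs_Suc:
  fixes f :: "nat \<Rightarrow> nat \<Rightarrow> 'a::field_char_0"
  shows "of_nat (Suc n) * (\<Sum>(i, m)\<in>pairs (Suc n). inverse (fact i * fact m) * f i m)
    = (\<Sum>(i, m)\<in>pairs n. inverse (fact i * fact m) * (f (Suc i) m + f i (Suc m)))"
proof -
  have *: "inverse (fact r * fact i * fact j) * (if j = 0 then x else 0) = (if j = 0 then inverse (fact r * fact i) * x else 0)"
    for r i j :: nat and x :: 'a
    by simp
  have "of_nat (Suc n) * (\<Sum>(r, i, j)\<in>triples (Suc n). inverse (fact r * fact i * fact j) * (if j = 0 then f r i else 0))
      = (\<Sum>(r, i, j)\<in>triples n. inverse (fact r * fact i * fact j) * (if j = 0 then f (Suc r) i + f r (Suc i) else 0))"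
    by (rule sum_triples_Suc[where f = "\<lambda>r i j. if j = 0 then f r i else 0", THEN trans])
      (intro sum.cong refl, auto)
  then show ?thesis by (simp only: * sum_triples_0)
qed

lemma sum_infsum_fun:
  fixes f :: "'a \<Rightarrow> 'b \<Rightarrow> 'c::real_normed_field"
  assumes "\<And>x. x \<in> T \<Longrightarrow> f x summable_on UNIV"
  shows "(\<Sum>x\<in>T. c x * (\<Sum>\<^sub>\<infinity>b. f x b)) = (\<Sum>\<^sub>\<infinity>b. \<Sum>x\<in>T. c x * f x b)"
proof -
  have "((\<lambda>b. \<Sum>x\<in>T. c x * f x b) has_sum (\<Sum>x\<in>T. c x * (\<Sum>\<^sub>\<infinity>b. f x b))) UNIV"
    by (rule has_sum_sum_fun) (rule has_sum_cmult_right, use assms in simp)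
  then show ?thesis by (simp add: infsumI)
qed

context phase_space
begin

text \<open>A concrete version of \<open>cochain\<close>, which rests on a definite description; the
  two agree on functions of Hilbert-Schmidt type by \<open>cochain_eq\<close>. As in
  \<open>cochain\<close>, the factorial is left out.\<close>

definition exp_op :: "('h \<Rightarrow>\<^sub>L 'h) \<Rightarrow> nat \<Rightarrow> ('h \<times> 'd \<Rightarrow> 'k) \<Rightarrow> ('h \<times> 'd \<Rightarrow> 'k) \<Rightarrow> 'h \<times> 'd \<Rightarrow> 'k" where
  "exp_op A r = (ins (A + id_blinfun) (A - id_blinfun) ^^ r) pmult"

lemma exp_op_0: "exp_op A 0 = pmult"
  by (simp add: exp_op_def)

lemma exp_op_Suc: "exp_op A (Suc r) = ins (A + id_blinfun) (A - id_blinfun) (exp_op A r)"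
  by (simp add: exp_op_def)

lemma bidiff_exp_op: "A \<in> bounded_operators S \<Longrightarrow> bidiff r (exp_op A r)"
  by (induction r)
    (auto simp: exp_op_0 exp_op_Suc bidiff_pmult intro!: bidiff_ins bounded_operators_add bounded_operators_diff bounded_operators_id)

lemma exp_op_HS: "A \<in> bounded_operators S \<Longrightarrow> F \<in> HS \<Longrightarrow> G \<in> HS \<Longrightarrow> exp_op A r F G \<in> HS"
  by (rule bidiff_HS[OF bidiff_exp_op])

lemma hs_summable_exp_op:
  assumes A: "A \<in> bounded_operators S" and B: "B \<in> bounded_operators S" and FG: "F \<in> HS" "G \<in> HS"
  shows "hs_summable (\<lambda>b. exp_op A r (dird (pfam (B + id_blinfun) b) F) (dird (qfam (B - id_blinfun) b) G))"
  by (intro hs_summable_ins[OF bidiff_exp_op[OF A]] bounded_operators_add[OF B] bounded_operators_diff[OF B] bounded_operators_id FG)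

lemma lap_rule_exp_op:
  assumes D: "D \<in> hilbert_schmidt_operators S" and A: "A \<in> bounded_operators S"
  shows "lap_rule D (exp_op A r)"
  by (induction r)
    (auto simp: exp_op_0 exp_op_Suc intro!: lap_rule_pmult[OF D] lap_rule_ins[OF D bidiff_exp_op[OF A]]
      bounded_operators_add[OF A] bounded_operators_diff[OF A] bounded_operators_id)

text \<open>
  Both sides satisfy the same recursion in \<open>n\<close>: they are the coefficients of \<open>exp (\<hbar> lap)\<close> after the
  product of \<open>B\<close>, and of the product of \<open>A\<close> after \<open>exp (\<hbar> lap)\<close> in both arguments.
\<close>

lemma lap_exp_intertwine:
  assumes A: "A \<in> bounded_operators S" and B: "B \<in> bounded_operators S" and D: "A - B \<in> hilbert_schmidt_operators S"
    and F: "F \<in> HS" and G: "G \<in> HS"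
  shows "(\<Sum>(i, m)\<in>pairs n. inverse (fact i * fact m) * (lap (A - B) ^^ i) (exp_op B m F G) w)
    = (\<Sum>(r, i, j)\<in>triples n. inverse (fact r * fact i * fact j)
        * exp_op A r ((lap (A - B) ^^ i) F) ((lap (A - B) ^^ j) G) w)"
  using F G
proof (induction n arbitrary: F G w)
  case 0
  have "pairs 0 = {(0, 0)}" "triples 0 = {(0, 0, 0)}" by (auto simp: pairs_def triples_def)
  then show ?case by (simp add: exp_op_0)
next
  case (Suc n)
  note F = Suc.prems(1) and G = Suc.prems(2)
  let ?L = "lap (A - B)"
  let ?p = "pfam (B + id_blinfun)" and ?q = "qfam (B - id_blinfun)"
  let ?c = "\<lambda>r i j. inverse (fact r * fact i * fact j) :: 'k"
  let ?U = "\<lambda>r i j. exp_op A r ((?L ^^ i) F) ((?L ^^ j) G)"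
  let ?Z = "\<lambda>w. \<Sum>(r, i, j)\<in>triples n. ?c r i j * ?U r i j w"
  let ?R = "\<lambda>F G w. \<Sum>(i, m)\<in>pairs n. inverse (fact i * fact m) * (?L ^^ i) (exp_op B m F G) w"
  note P = lap_power_HS[OF D]
  have UHS: "?U r i j \<in> HS" for r i j by (intro exp_op_HS A P F G)
  have RHS: "(?L ^^ i) (exp_op B m F G) \<in> HS" for i m by (intro exp_op_HS B P F G)
  \<comment> \<open>\<open>lap\<close> is applied to the induction hypothesis as an identity of
    functions.\<close>
  have first: "(\<Sum>(i, m)\<in>pairs n. inverse (fact i * fact m) * (?L ^^ Suc i) (exp_op B m F G) w)
      = (\<Sum>(r, i, j)\<in>triples n. ?c r i j * ?L (?U r i j) w)"
  proof -
    have "(\<Sum>(i, m)\<in>pairs n. inverse (fact i * fact m) * (?L ^^ Suc i) (exp_op B m F G) w) = ?L (?R F G) w"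
      by (subst case_prod_unfold, subst lap_sum[OF D]) (auto simp: lap_scale[OF D] RHS HS_scale case_prod_unfold)
    also have "?R F G = ?Z" by (intro ext Suc.IH F G)
    also have "?L ?Z w = (\<Sum>(r, i, j)\<in>triples n. ?c r i j * ?L (?U r i j) w)"
      by (subst case_prod_unfold, subst lap_sum[OF D]) (auto simp: lap_scale[OF D] UHS HS_scale case_prod_unfold)
    finally show ?thesis .
  qed
  \<comment> \<open>One insertion of \<open>exp_op B\<close> is pulled out as a series over b; the
    induction hypothesis is used for the differentiated arguments, and the derivatives are exchanged
    with the powers of \<open>lap\<close>.\<close>
  have second: "(\<Sum>(i, m)\<in>pairs n. inverse (fact i * fact m) * (?L ^^ i) (exp_op B (Suc m) F G) w)
      = (\<Sum>(r, i, j)\<in>triples n. ?c r i j * ins (B + id_blinfun) (B - id_blinfun) (exp_op A r) ((?L ^^ i) F) ((?L ^^ j) G) w)"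
  proof -
    have "(\<Sum>(i, m)\<in>pairs n. inverse (fact i * fact m) * (?L ^^ i) (exp_op B (Suc m) F G) w)
        = (\<Sum>x\<in>pairs n. inverse (fact (fst x) * fact (snd x)) * (\<Sum>\<^sub>\<infinity>b. (?L ^^ fst x) (exp_op B (snd x) (dird (?p b) F) (dird (?q b) G)) w))"
      unfolding exp_op_Suc insert_pair_def
        conjunct2[OF lap_power_series[OF D hs_summable_exp_op[OF B B F G]]] by (simp add: case_prod_unfold)
    also have "\<dots> = (\<Sum>\<^sub>\<infinity>b. \<Sum>x\<in>pairs n. inverse (fact (fst x) * fact (snd x)) * (?L ^^ fst x) (exp_op B (snd x) (dird (?p b) F) (dird (?q b) G)) w)"
      by (rule sum_infsum_fun) (rule hs_summableD(3)[OF conjunct1[OF lap_power_series[OF D hs_summable_exp_op[OF B B F G]]]])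
    also have "\<dots> = (\<Sum>\<^sub>\<infinity>b. ?R (dird (?p b) F) (dird (?q b) G) w)"
      by (simp add: case_prod_unfold)
    also have "\<dots> = (\<Sum>\<^sub>\<infinity>b. \<Sum>(r, i, j)\<in>triples n. ?c r i j
        * exp_op A r ((?L ^^ i) (dird (?p b) F)) ((?L ^^ j) (dird (?q b) G)) w)"
      by (simp only: Suc.IH[OF dird_HS[OF F] dird_HS[OF G]])
    also have "\<dots> = (\<Sum>\<^sub>\<infinity>b. \<Sum>x\<in>triples n. ?c (fst x) (fst (snd x)) (snd (snd x))
        * exp_op A (fst x) (dird (?p b) ((?L ^^ fst (snd x)) F)) (dird (?q b) ((?L ^^ snd (snd x)) G)) w)"
      by (simp add: case_prod_unfold dird_lap_power[OF D] F G)
    also have "\<dots> = (\<Sum>x\<in>triples n. ?c (fst x) (fst (snd x)) (snd (snd x))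
        * (\<Sum>\<^sub>\<infinity>b. exp_op A (fst x) (dird (?p b) ((?L ^^ fst (snd x)) F)) (dird (?q b) ((?L ^^ snd (snd x)) G)) w))"
      by (rule sum_infsum_fun[symmetric]) (rule hs_summableD(3)[OF hs_summable_exp_op[OF A B P[OF F] P[OF G]]])
    finally show ?thesis by (simp add: insert_pair_def case_prod_unfold)
  qed
  \<comment> \<open>By additivity the insertion for A is the one for B plus
    \<open>ins (A - B) (A - B)\<close>, and the latter is exactly the defect in the rule for
    \<open>lap\<close>.\<close>
  have step: "?L (?U r i j) w + ins (B + id_blinfun) (B - id_blinfun) (exp_op A r) ((?L ^^ i) F) ((?L ^^ j) G) w
      = ?U (Suc r) i j w + ?U r (Suc i) j w + ?U r i (Suc j) w" for r i j
  proof -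
    have D': "A - B \<in> bounded_operators S" by (rule hs_bounded[OF D])
    have eq: "A + id_blinfun = (B + id_blinfun) + (A - B)" "A - id_blinfun = (B - id_blinfun) + (A - B)" by simp_all
    have "?U (Suc r) i j w = ins (B + id_blinfun) (B - id_blinfun) (exp_op A r) ((?L ^^ i) F) ((?L ^^ j) G) w
        + ins (A - B) (A - B) (exp_op A r) ((?L ^^ i) F) ((?L ^^ j) G) w"
      unfolding exp_op_Suc by (subst eq(1), subst eq(2))
        (intro ins_add[OF bidiff_exp_op[OF A]] bounded_operators_add[OF B] bounded_operators_diff[OF B] bounded_operators_id D' P F G)
    then show ?thesis
      using lap_rule_exp_op[OF D A, of r] P[OF F] P[OF G] unfolding lap_rule_def[OF D] by simp
  qed
  have "of_nat (Suc n) * (\<Sum>(i, m)\<in>pairs (Suc n). inverse (fact i * fact m) * (?L ^^ i) (exp_op B m F G) w)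
      = (\<Sum>(i, m)\<in>pairs n. inverse (fact i * fact m) * ((?L ^^ Suc i) (exp_op B m F G) w + (?L ^^ i) (exp_op B (Suc m) F G) w))"
    by (rule sum_pairs_Suc)
  also have "\<dots> = (\<Sum>(i, m)\<in>pairs n. inverse (fact i * fact m) * (?L ^^ Suc i) (exp_op B m F G) w)
      + (\<Sum>(i, m)\<in>pairs n. inverse (fact i * fact m) * (?L ^^ i) (exp_op B (Suc m) F G) w)"
    by (simp only: distrib_left sum.distrib case_prod_unfold)
  also have "\<dots> = (\<Sum>(r, i, j)\<in>triples n. ?c r i j * (?L (?U r i j) w
      + ins (B + id_blinfun) (B - id_blinfun) (exp_op A r) ((?L ^^ i) F) ((?L ^^ j) G) w))"
    unfolding first second by (simp only: distrib_left sum.distrib case_prod_unfold)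
  also have "\<dots> = (\<Sum>(r, i, j)\<in>triples n. ?c r i j * (?U (Suc r) i j w + ?U r (Suc i) j w + ?U r i (Suc j) w))"
    by (simp only: step)
  also have "\<dots> = of_nat (Suc n) * (\<Sum>(r, i, j)\<in>triples (Suc n). ?c r i j * ?U r i j w)"
    by (rule sum_triples_Suc[symmetric])
  finally show ?case by (simp del: of_nat_Suc)
qed

section \<open>Powers of the bilinear form on Hilbert tensor powers\<close>

text \<open>The candidate for \<open>bform_power\<close>: one pair of slots is contracted at a time.
  It is defined on jets of all orders, a class that is closed under fixing the first slot.\<close>

primrec form_power :: "('b \<Rightarrow> 'h \<times> 'd) \<Rightarrow> ('b \<Rightarrow> 'h \<times> 'd) \<Rightarrow> nat \<Rightarrow>
    (('h \<times> 'd) list \<Rightarrow> 'k) \<Rightarrow> (('h \<times> 'd) list \<Rightarrow> 'k) \<Rightarrow> 'k" where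
  "form_power p q 0 s t = s [] * t []"
| "form_power p q (Suc r) s t = (\<Sum>\<^sub>\<infinity>b. form_power p q r (\<lambda>vs. s (p b # vs)) (\<lambda>vs. t (q b # vs)))"

lemma form_power_commute: "form_power p q r s t = form_power q p r t s"
  by (induction r arbitrary: s t) (simp_all add: mult.commute)

lemma form_power_cong:
  "(\<And>vs. length vs = r \<Longrightarrow> s vs = s' vs) \<Longrightarrow> (\<And>vs. length vs = r \<Longrightarrow> t vs = t' vs) \<Longrightarrow>
    form_power p q r s t = form_power p q r s' t'"
proof (induction r arbitrary: s t s' t')
  case (Suc r)
  have "form_power p q r (\<lambda>vs. s (p b # vs)) (\<lambda>vs. t (q b # vs)) = form_power p q r (\<lambda>vs. s' (p b # vs)) (\<lambda>vs. t' (q b # vs))" for b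
    by (rule Suc.IH) (simp_all add: Suc.prems)
  then show ?case by simp
qed simp

text \<open>Differentiating along \<open>p b\<close> fixes the first slot of the jet, so both sides
  obey the same recursion.\<close>

lemma exp_op_eq_form_power:
  "F \<in> HS \<Longrightarrow> G \<in> HS \<Longrightarrow> exp_op A r F G w
    = form_power (pfam (A + id_blinfun)) (qfam (A - id_blinfun)) r (deriv_form F w) (deriv_form G w)"
proof (induction r arbitrary: F G)
  case (Suc r)
  have d: "deriv_form (dird v H) w = (\<lambda>vs. deriv_form H w (v # vs))" if "H \<in> HS" for v H
    using deriv_form_dird[OF that] by (rule ext)
  show ?case
    unfolding exp_op_Suc insert_pair_def form_power.simps
    by (simp only: Suc.IH[OF dird_HS[OF Suc.prems(1)] dird_HS[OF Suc.prems(2)]] d[OF Suc.prems(1)] d[OF Suc.prems(2)])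
qed (simp add: exp_op_0)

lemma sum_tnorm_mult_front_le:
  assumes s: "hs_jet s" and t: "hs_jet t" and p: "bessel p K" and q: "bessel q L" and Y: "finite Y"
  shows "(\<Sum>b\<in>Y. tnorm n (\<lambda>vs. s (p b # vs)) * tnorm n (\<lambda>vs. t (q b # vs))) \<le> (K * L) * (tnorm (Suc n) s * tnorm (Suc n) t)"
proof -
  have KL: "0 \<le> K" "0 \<le> L" using p q by (auto simp: bessel_def)
  have a: "L2_set (\<lambda>b. tnorm n (\<lambda>vs. s (p b # vs))) Y \<le> K * tnorm (Suc n) s"
    using sum_tnorm_front_le[OF hs_jetD[OF s] hs_jet_le[OF s] p Y] KL by (simp add: L2_set_le_iff)
  have b: "L2_set (\<lambda>b. tnorm n (\<lambda>vs. t (q b # vs))) Y \<le> L * tnorm (Suc n) t"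
    using sum_tnorm_front_le[OF hs_jetD[OF t] hs_jet_le[OF t] q Y] KL by (simp add: L2_set_le_iff)
  have "(\<Sum>b\<in>Y. tnorm n (\<lambda>vs. s (p b # vs)) * tnorm n (\<lambda>vs. t (q b # vs)))
      \<le> L2_set (\<lambda>b. tnorm n (\<lambda>vs. s (p b # vs))) Y * L2_set (\<lambda>b. tnorm n (\<lambda>vs. t (q b # vs))) Y"
    using L2_set_mult_ineq[of "\<lambda>b. tnorm n (\<lambda>vs. s (p b # vs))" "\<lambda>b. tnorm n (\<lambda>vs. t (q b # vs))" Y] by simp
  also have "\<dots> \<le> (K * tnorm (Suc n) s) * (L * tnorm (Suc n) t)"
    by (rule mult_mono[OF a b]) (use KL in auto)
  finally show ?thesis by (simp add: mult_ac)
qed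

context
  fixes p q :: "'b \<Rightarrow> 'h \<times> 'd" and K L :: real
  assumes p: "bessel p K" and q: "bessel q L"
begin

lemma form_power_bound:
  assumes "hs_jet s" "hs_jet t"
  shows "norm (form_power p q r s t) \<le> (K * L) ^ r * (tnorm r s * tnorm r t)"
    and "(\<lambda>b. norm (form_power p q r (\<lambda>vs. s (p b # vs)) (\<lambda>vs. t (q b # vs)))) summable_on UNIV"
proof -
  have KL: "0 \<le> K * L" using p q by (simp add: bessel_def)
  \<comment> \<open>The bound at order r + 1 needs summability at order r, which needs the bound at
    order r. Both auxiliary facts therefore take that bound as an assumption.\<close>
  have front: "(\<Sum>b\<in>Y. norm (form_power p q r (\<lambda>vs. s (p b # vs)) (\<lambda>vs. t (q b # vs)))) \<le> (K * L) ^ Suc r * (tnorm (Suc r) s * tnorm (Suc r) t)"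
    if "finite Y" "hs_jet s" "hs_jet t"
      and IH: "\<forall>s t. hs_jet s \<longrightarrow> hs_jet t \<longrightarrow> norm (form_power p q r s t) \<le> (K * L) ^ r * (tnorm r s * tnorm r t)" for Y r s t
  proof -
    have "(\<Sum>b\<in>Y. norm (form_power p q r (\<lambda>vs. s (p b # vs)) (\<lambda>vs. t (q b # vs))))
        \<le> (\<Sum>b\<in>Y. (K * L) ^ r * (tnorm r (\<lambda>vs. s (p b # vs)) * tnorm r (\<lambda>vs. t (q b # vs))))"
      by (rule sum_mono) (intro IH[rule_format] hs_jet_front that)
    also have "\<dots> = (K * L) ^ r * (\<Sum>b\<in>Y. tnorm r (\<lambda>vs. s (p b # vs)) * tnorm r (\<lambda>vs. t (q b # vs)))"
      by (simp add: sum_distrib_left)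
    also have "\<dots> \<le> (K * L) ^ r * ((K * L) * (tnorm (Suc r) s * tnorm (Suc r) t))"
      by (intro mult_left_mono sum_tnorm_mult_front_le that p q zero_le_power KL)
    finally show ?thesis by (simp add: mult_ac)
  qed
  have sm: "(\<lambda>b. norm (form_power p q r (\<lambda>vs. s (p b # vs)) (\<lambda>vs. t (q b # vs)))) summable_on UNIV"
    if "hs_jet s" "hs_jet t"
      and IH: "\<forall>s t. hs_jet s \<longrightarrow> hs_jet t \<longrightarrow> norm (form_power p q r s t) \<le> (K * L) ^ r * (tnorm r s * tnorm r t)" for r s t
  proof (rule nonneg_bdd_above_summable_on)
    show "bdd_above (sum (\<lambda>b. norm (form_power p q r (\<lambda>vs. s (p b # vs)) (\<lambda>vs. t (q b # vs)))) ` {F. F \<subseteq> UNIV \<and> finite F})"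
      by (rule bdd_aboveI[of _ "(K * L) ^ Suc r * (tnorm (Suc r) s * tnorm (Suc r) t)"]) (use front[OF _ that] in auto)
  qed auto
  have bound: "norm (form_power p q r s t) \<le> (K * L) ^ r * (tnorm r s * tnorm r t)" if "hs_jet s" "hs_jet t" for r s t
    using that
  proof (induction r arbitrary: s t)
    case 0
    then show ?case by (simp add: norm_mult tensor_norm_def)
  next
    case (Suc r)
    have IH: "\<forall>s t. hs_jet s \<longrightarrow> hs_jet t \<longrightarrow> norm (form_power p q r s t) \<le> (K * L) ^ r * (tnorm r s * tnorm r t)"
      using Suc.IH by blast
    have "norm (\<Sum>\<^sub>\<infinity>b. form_power p q r (\<lambda>vs. s (p b # vs)) (\<lambda>vs. t (q b # vs))) \<le> (K * L) ^ Suc r * (tnorm (Suc r) s * tnorm (Suc r) t)"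
    proof (rule has_sum_norm_le)
      show "((\<lambda>b. form_power p q r (\<lambda>vs. s (p b # vs)) (\<lambda>vs. t (q b # vs))) has_sum
          (\<Sum>\<^sub>\<infinity>b. form_power p q r (\<lambda>vs. s (p b # vs)) (\<lambda>vs. t (q b # vs)))) UNIV"
        by (rule has_sum_infsum[OF abs_summable_summable[OF sm[OF Suc.prems IH]]])
      fix Y :: "'b set" assume Y: "finite Y"
      show "norm (\<Sum>b\<in>Y. form_power p q r (\<lambda>vs. s (p b # vs)) (\<lambda>vs. t (q b # vs))) \<le> (K * L) ^ Suc r * (tnorm (Suc r) s * tnorm (Suc r) t)"
        by (rule order_trans[OF norm_sum front[OF Y Suc.prems IH]])
    qed
    then show ?case by simp
  qed
  show "norm (form_power p q r s t) \<le> (K * L) ^ r * (tnorm r s * tnorm r t)" by (rule bound[OF assms])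
  show "(\<lambda>b. norm (form_power p q r (\<lambda>vs. s (p b # vs)) (\<lambda>vs. t (q b # vs)))) summable_on UNIV"
    by (rule sm[OF assms]) (use bound in blast)
qed

lemma form_power_add:
  "hs_jet s \<Longrightarrow> hs_jet s' \<Longrightarrow> hs_jet t \<Longrightarrow>
    form_power p q r (\<lambda>vs. s vs + s' vs) t = form_power p q r s t + form_power p q r s' t"
proof (induction r arbitrary: s s' t)
  case 0
  then show ?case by (simp add: distrib_right)
next
  case (Suc r)
  then show ?case
    using abs_summable_summable[OF form_power_bound(2)[OF Suc.prems(1,3)]] abs_summable_summable[OF form_power_bound(2)[OF Suc.prems(2,3)]]
    by (simp add: hs_jet_front infsum_add)
qed

lemma form_power_scale:
  "hs_jet s \<Longrightarrow> hs_jet t \<Longrightarrow> form_power p q r (\<lambda>vs. c * s vs) t = c * form_power p q r s t"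
proof (induction r arbitrary: s t)
  case (Suc r)
  then show ?case
    using abs_summable_summable[OF form_power_bound(2)[OF Suc.prems]]
    by (simp add: hs_jet_front infsum_cmult_right)
qed simp

end

lemma form_power_add_right:
  assumes "bessel p K" "bessel q L" "hs_jet s" "hs_jet t" "hs_jet t'"
  shows "form_power p q r s (\<lambda>vs. t vs + t' vs) = form_power p q r s t + form_power p q r s t'"
  using form_power_add[OF assms(2,1,4,5,3)] by (simp add: form_power_commute[of p q])

lemma form_power_scale_right:
  assumes "bessel p K" "bessel q L" "hs_jet s" "hs_jet t"
  shows "form_power p q r s (\<lambda>vs. c * t vs) = c * form_power p q r s t"
  using form_power_scale[OF assms(2,1,4,3)] by (simp add: form_power_commute[of p q])

section \<open>Pure tensors, basis tensors and density\<close>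

lemma pure_tensor_Nil: "pure_tensor [] ws = (if ws = [] then 1 else 0)"
  by (auto simp: pure_tensor_def)

lemma pure_tensor_Cons: "pure_tensor (u # us) (w # ws) = u w * pure_tensor us ws"
  by (simp add: pure_tensor_def prod.lessThan_Suc_shift del: prod.lessThan_Suc)

lemma mlf_pure_tensor:
  assumes "set us \<subseteq> dualW S"
  shows "mlf (pure_tensor us)"
proof -
  have "(\<lambda>x. pure_tensor us (xs @ x # ys)) \<in> dualW S" for xs ys
    using assms
  proof (induction us arbitrary: xs)
    case Nil
    then show ?case by (simp add: pure_tensor_Nil dualW_zero)
  next
    case (Cons u us)
    show ?case
    proof (cases xs)
      case Nil
      then show ?thesis
        using dualW_mult_fun[of u "pure_tensor us ys"] Cons.prems by (simp add: pure_tensor_Cons mult.commute)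
    next
      case (Cons x' xs')
      then show ?thesis
        using dualW_mult_fun[OF Cons.IH[of xs'], of "u x'"] Cons.prems by (simp add: pure_tensor_Cons)
    qed
  qed
  then show ?thesis by (simp add: mlf_def)
qed

lemma hs_le_pure_tensor:
  "set us \<subseteq> dualW S \<Longrightarrow> hs_le (length us) (pure_tensor us) (prod_list (map (\<lambda>u. sqrt (nu u)) us))"
proof (induction us)
  case Nil
  then show ?case by (simp add: hs_le_0_iff pure_tensor_Nil)
next
  case (Cons u us)
  let ?C = "prod_list (map (\<lambda>u. sqrt (nu u)) us)"
  have C: "hs_le (length us) (pure_tensor us) ?C" using Cons by simp
  have "hs_le (Suc (length us)) (pure_tensor (u # us)) (sqrt (nu u) * ?C)"
  proof (rule hs_le_Suc)
    show "hs_le (length us) (\<lambda>vs. pure_tensor (u # us) (eW \<alpha> # vs)) (norm (u (eW \<alpha>)) * ?C)" for \<alpha>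
      unfolding pure_tensor_Cons by (rule hs_le_scale[OF C])
    show "0 \<le> sqrt (nu u) * ?C" using hs_le_nonneg[OF C] by (simp add: nu_nonneg)
    fix Y :: "(bool \<times> nat) set" assume Y: "finite Y"
    have "(\<Sum>\<alpha>\<in>Y. (norm (u (eW \<alpha>)) * ?C)\<^sup>2) = (\<Sum>\<alpha>\<in>Y. (norm (u (eW \<alpha>)))\<^sup>2) * ?C\<^sup>2"
      by (simp add: power_mult_distrib sum_distrib_right)
    also have "\<dots> \<le> nu u * ?C\<^sup>2"
      by (intro mult_right_mono nu_finite Y) (use Cons.prems in auto)
    finally show "(\<Sum>\<alpha>\<in>Y. (norm (u (eW \<alpha>)) * ?C)\<^sup>2) \<le> (sqrt (nu u) * ?C)\<^sup>2"
      by (simp add: power_mult_distrib nu_nonneg)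
  qed
  then show ?case by simp
qed

lemma tensor_power_iff: "t \<in> tensor_power S n \<longleftrightarrow> hs_jet t \<and> (\<forall>vs. length vs \<noteq> n \<longrightarrow> t vs = 0)"
proof
  assume "t \<in> tensor_power S n"
  then show "hs_jet t \<and> (\<forall>vs. length vs \<noteq> n \<longrightarrow> t vs = 0)"
    using hs_jet_tensor_power by (simp add: tensor_power_def)
next
  assume *: "hs_jet t \<and> (\<forall>vs. length vs \<noteq> n \<longrightarrow> t vs = 0)"
  then have "t = length_part n t" by (auto simp: length_part_def)
  then show "t \<in> tensor_power S n"
    using length_part_tensor_power[of t n] * by (simp add: hs_jet_def)
qed

lemma tensor_power_add: "s \<in> tensor_power S n \<Longrightarrow> t \<in> tensor_power S n \<Longrightarrow> (\<lambda>vs. s vs + t vs) \<in> tensor_power S n"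
  by (simp add: tensor_power_iff hs_jet_add)

lemma tensor_power_scale: "t \<in> tensor_power S n \<Longrightarrow> (\<lambda>vs. c * t vs) \<in> tensor_power S n"
  by (simp add: tensor_power_iff hs_jet_scale)

lemma tensor_power_zero: "(\<lambda>_. 0) \<in> tensor_power S n"
  by (simp add: tensor_power_iff hs_jet_zero)

lemma tensor_power_sum: "(\<And>b. b \<in> Y \<Longrightarrow> T b \<in> tensor_power S n) \<Longrightarrow> (\<lambda>vs. \<Sum>b\<in>Y. T b vs) \<in> tensor_power S n"
  by (simp add: tensor_power_iff hs_jet_sum)

lemma tensor_power_diff: "s \<in> tensor_power S n \<Longrightarrow> t \<in> tensor_power S n \<Longrightarrow> (\<lambda>vs. s vs - t vs) \<in> tensor_power S n"
  using tensor_power_add[OF _ tensor_power_scale[of t n "- 1"], of s] by simp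

lemma pure_tensor_tensor_power:
  assumes "set us \<subseteq> dualW S" "length us = n"
  shows "pure_tensor us \<in> tensor_power S n"
proof -
  have "pure_tensor us = length_part n (pure_tensor us)"
    using assms(2) by (auto simp: length_part_def pure_tensor_def)
  then show ?thesis
    using length_part_tensor_power[OF mlf_pure_tensor[OF assms(1)], of n] hs_le_pure_tensor[OF assms(1)] assms(2)
    by (simp add: hs_le_iff)
qed

definition basis_tensor :: "(bool \<times> nat) list \<Rightarrow> ('h \<times> 'd) list \<Rightarrow> 'k" where
  "basis_tensor is = pure_tensor (map coordW is)"

lemma basis_tensor_tensor_power: "length is = n \<Longrightarrow> basis_tensor is \<in> tensor_power S n"
  unfolding basis_tensor_def by (rule pure_tensor_tensor_power) (auto intro: coordW_dualW)

lemma basis_tensor_eW: "length is = length js \<Longrightarrow> basis_tensor is (map eW js) = (if is = js then 1 else 0)"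
  unfolding basis_tensor_def
  by (induction "is" js rule: list_induct2) (auto simp: pure_tensor_Nil pure_tensor_Cons coordW_eW)

lemma basis_tensor_combination:
  assumes "finite N" "N \<subseteq> {is. length is = n}" "length js = n"
  shows "(\<Sum>is\<in>N. c is * basis_tensor is (map eW js)) = (if js \<in> N then c js else 0)"
proof -
  have "(\<Sum>is\<in>N. c is * basis_tensor is (map eW js)) = (\<Sum>is\<in>N. if is = js then c js else 0)"
    by (rule sum.cong[OF refl]) (use assms basis_tensor_eW in auto)
  then show ?thesis using assms(1) by simp
qed

text \<open>Basis tensors are orthonormal, so the error of a finite section is the root of a tail of
  the square sum.\<close>

lemma basis_tensor_dense:
  assumes s: "s \<in> tensor_power S n" and "0 < \<epsilon>"
  obtains N where "finite N" "N \<subseteq> {is. length is = n}"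
    "tnorm n (\<lambda>vs. s vs - (\<Sum>is\<in>N. s (map eW is) * basis_tensor is vs)) \<le> \<epsilon>"
proof -
  let ?f = "\<lambda>is. (norm (s (map eW is)))\<^sup>2"
  have sm: "?f summable_on {is. length is = n}" using s by (simp add: tensor_power_def)
  obtain N where N: "finite N" "N \<subseteq> {is. length is = n}" "dist (sum ?f N) (infsum ?f {is. length is = n}) \<le> \<epsilon>\<^sup>2"
    using has_sum_finite_approximation[OF has_sum_infsum[OF sm], of "\<epsilon>\<^sup>2"] assms(2) by auto
  have "hs_le n (\<lambda>vs. s vs - (\<Sum>is\<in>N. s (map eW is) * basis_tensor is vs)) \<epsilon>"
    unfolding hs_le_def
  proof (intro conjI allI impI)
    fix X :: "(bool \<times> nat) list set" assume X: "finite X" "X \<subseteq> {is. length is = n}"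
    have "(\<Sum>js\<in>X. (norm (s (map eW js) - (\<Sum>is\<in>N. s (map eW is) * basis_tensor is (map eW js))))\<^sup>2)
        = (\<Sum>js\<in>X. if js \<in> - N then ?f js else 0)"
      by (rule sum.cong[OF refl]) (use X basis_tensor_combination[OF N(1,2), where c = "\<lambda>is. s (map eW is)"] in auto)
    also have "\<dots> = sum ?f (X \<inter> - N)"
      using X by (simp add: sum.inter_restrict)
    also have "\<dots> = sum ?f ((X \<inter> - N) \<union> N) - sum ?f N"
      using X N by (subst sum.union_disjoint) auto
    also have "\<dots> \<le> infsum ?f {is. length is = n} - sum ?f N"
      by (intro diff_right_mono finite_sum_le_infsum[OF sm]) (use X N in auto)
    also have "\<dots> \<le> \<epsilon>\<^sup>2" using N(3) by (simp add: dist_real_def)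
    finally show "(\<Sum>js\<in>X. (norm (s (map eW js) - (\<Sum>is\<in>N. s (map eW is) * basis_tensor is (map eW js))))\<^sup>2) \<le> \<epsilon>\<^sup>2" .
  qed (use assms(2) in simp)
  then show thesis using that N(1,2) by (simp add: hs_le_iff)
qed

lemma linear_form_on_add:
  assumes "linear_form_on V f" "s \<in> V" "t \<in> V"
  shows "f (\<lambda>x. s x + t x) = f s + f t"
  using assms by (simp add: linear_form_on_def)

lemma linear_form_on_scale:
  assumes "linear_form_on V f" "t \<in> V"
  shows "f (\<lambda>x. c * t x) = c * f t"
  using assms by (simp add: linear_form_on_def)

lemma linear_form_on_zero:
  assumes "linear_form_on (tensor_power S n) f"
  shows "f (\<lambda>_. 0) = 0"
  using linear_form_on_scale[OF assms tensor_power_zero, of 0] by simp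

lemma linear_form_on_sum:
  assumes f: "linear_form_on (tensor_power S n) f" and "\<And>b. b \<in> Y \<Longrightarrow> T b \<in> tensor_power S n"
  shows "f (\<lambda>vs. \<Sum>b\<in>Y. c b * T b vs) = (\<Sum>b\<in>Y. c b * f (T b))"
  using assms(2)
proof (induction Y rule: infinite_finite_induct)
  case (insert x Y)
  have Y: "(\<lambda>vs. \<Sum>b\<in>Y. c b * T b vs) \<in> tensor_power S n"
    by (intro tensor_power_sum tensor_power_scale) (use insert in auto)
  have x: "T x \<in> tensor_power S n" using insert by simp
  show ?case
    using insert linear_form_on_add[OF f tensor_power_scale[OF x] Y] by (simp add: linear_form_on_scale[OF f x])
qed (simp_all add: linear_form_on_zero[OF f])

lemma linear_form_on_diff:
  assumes f: "linear_form_on (tensor_power S n) f" and s: "s \<in> tensor_power S n" and t: "t \<in> tensor_power S n"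
  shows "f (\<lambda>vs. s vs - t vs) = f s - f t"
  using linear_form_on_add[OF f tensor_power_diff[OF s t] t] by simp

text \<open>The difference vanishes on finite sections of s, so it is bounded by a fixed multiple of
  an arbitrarily small remainder.\<close>

lemma linear_form_eqI:
  assumes f: "linear_form_on (tensor_power S n) f" and g: "linear_form_on (tensor_power S n) g"
    and C: "\<And>s. s \<in> tensor_power S n \<Longrightarrow> norm (f s) \<le> C * tnorm n s"
    and M: "\<And>s. s \<in> tensor_power S n \<Longrightarrow> norm (g s) \<le> M * tnorm n s"
    and eq: "\<And>is. length is = n \<Longrightarrow> f (basis_tensor is) = g (basis_tensor is)"
    and s: "s \<in> tensor_power S n"
  shows "f s = g s"
proof -
  have "norm (f s - g s) \<le> 0 + \<delta>" if \<delta>: "0 < \<delta>" for \<delta>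
  proof -
    let ?K = "\<bar>C\<bar> + \<bar>M\<bar> + 1"
    have K: "0 < ?K" by linarith
    obtain N where N: "finite N" "N \<subseteq> {is. length is = n}"
      "tnorm n (\<lambda>vs. s vs - (\<Sum>is\<in>N. s (map eW is) * basis_tensor is vs)) \<le> \<delta> / ?K"
      using basis_tensor_dense[OF s divide_pos_pos[OF \<delta> K]] by blast
    let ?sN = "\<lambda>vs. \<Sum>is\<in>N. s (map eW is) * basis_tensor is vs"
    have sN: "?sN \<in> tensor_power S n"
      by (intro tensor_power_sum tensor_power_scale basis_tensor_tensor_power) (use N in auto)
    note dN = tensor_power_diff[OF s sN]
    have "f ?sN = g ?sN"
      using N(2) by (subst linear_form_on_sum[OF f] linear_form_on_sum[OF g], auto intro!: basis_tensor_tensor_power sum.cong simp: eq)+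
    then have "f s - g s = f (\<lambda>vs. s vs - ?sN vs) - g (\<lambda>vs. s vs - ?sN vs)"
      by (simp add: linear_form_on_diff[OF f s sN] linear_form_on_diff[OF g s sN])
    then have "norm (f s - g s) \<le> C * tnorm n (\<lambda>vs. s vs - ?sN vs) + M * tnorm n (\<lambda>vs. s vs - ?sN vs)"
      using order_trans[OF norm_triangle_ineq4 add_mono[OF C[OF dN] M[OF dN]]] by simp
    also have "\<dots> = (C + M) * tnorm n (\<lambda>vs. s vs - ?sN vs)" by (simp add: distrib_right)
    also have "\<dots> \<le> ?K * tnorm n (\<lambda>vs. s vs - ?sN vs)" by (rule mult_right_mono) auto
    also have "\<dots> \<le> ?K * (\<delta> / ?K)" by (rule mult_left_mono[OF N(3)]) (use K in simp)
    also have "\<dots> = \<delta>" using K by simp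
    finally show ?thesis by simp
  qed
  then have "norm (f s - g s) \<le> 0" by (rule field_le_epsilon)
  then show ?thesis by simp
qed

section \<open>The bilinear form and its powers as iterated contractions\<close>

lemma dual_part_pairing:
  assumes u: "u \<in> dualW S"
  shows "pairing S (dual_part S u) x = u (x, 0)"
proof -
  have add: "u (x + y, 0) = u (x, 0) + u (y, 0)" for x y
    using dualW_add[OF u, of "(x, 0)" "(y, 0)"] by simp
  have scale: "u (scaleH S c x, 0) = c * u (x, 0)" for c x
    using dualW_scale[OF u, of c "(x, 0)"] by (simp add: scaleW_def)
  obtain C where C: "\<And>w. norm (u w) \<le> norm w * C" using u unfolding dualW_iff by blast
  have "bounded_linear (\<lambda>x. u (x, 0))"
    by (rule bounded_linearI_K[where C = C]) (use add scale C[of "(_, 0)"] in \<open>auto simp: norm_Pair\<close>)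
  moreover have "Vector_Spaces.linear (scaleH S) (*) (\<lambda>x. u (x, 0))"
    using add scale H.vector_space_axioms vector_space_field by (simp add: Vector_Spaces.linear_iff)
  ultimately obtain \<xi> where \<xi>: "pairing S \<xi> = (\<lambda>x. u (x, 0))" by (rule dual_surj)
  have "\<forall>x. pairing S (dual_part S u) x = u (x, 0)"
    unfolding dual_part_def
  proof (rule theI)
    show "\<forall>x. pairing S \<xi> x = u (x, 0)" by (simp add: \<xi>)
    show "\<zeta> = \<xi>" if "\<forall>x. pairing S \<zeta> x = u (x, 0)" for \<zeta>
      by (rule pairing_eqI) (simp add: that \<xi>)
  qed
  then show ?thesis by blast
qed

lemma eq_of_ip_basis:
  assumes "\<And>i. ip S (e i) x = ip S (e i) y"
  shows "x = y"
proof -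
  have "((\<lambda>i::nat. 0) has_sum (norm (x - y))\<^sup>2) UNIV"
    using parseval[of "x - y"] by (simp add: ip_diff assms)
  then have "(norm (x - y))\<^sup>2 = 0"
    by (rule has_sum_unique) (rule has_sum_0_simp)
  then show ?thesis by simp
qed

text \<open>Reflexivity made explicit: the coefficients \<open>u (0, de i)\<close> are square
  summable, so the series with these coefficients converges to the representing vector.\<close>

lemma vector_part_pairing:
  assumes u: "u \<in> dualW S"
  shows "pairing S \<eta> (vector_part S u) = u (0, \<eta>)"
proof -
  let ?c = "\<lambda>i. u (0, de i)"
  have "summable (\<lambda>i. scaleH S (?c i) (e i))"
    unfolding summable_Cauchy
  proof (intro allI impI)
    fix \<epsilon> :: real assume "0 < \<epsilon>"
    have "(\<lambda>i. (norm (?c i))\<^sup>2) summable_on UNIV"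
      using infsum_bool_split(2)[OF nu_summable[OF u], of True] by (simp add: basisW_def)
    then have "summable (\<lambda>i. (norm (?c i))\<^sup>2)" by (simp add: summable_on_UNIV_nonneg_real_iff)
    then obtain N where N: "\<And>m n. m \<ge> N \<Longrightarrow> norm (\<Sum>i=m..<n. (norm (?c i))\<^sup>2) < \<epsilon>\<^sup>2"
      unfolding summable_Cauchy using \<open>0 < \<epsilon>\<close> by (meson zero_less_power)
    have "norm (\<Sum>i=m..<n. scaleH S (?c i) (e i)) < \<epsilon>" if "m \<ge> N" for m n
    proof (rule power2_less_imp_less)
      show "(norm (\<Sum>i=m..<n. scaleH S (?c i) (e i)))\<^sup>2 < \<epsilon>\<^sup>2"
        using N[OF that, of n] by (simp add: norm_basis_sum sum_nonneg)
    qed (use \<open>0 < \<epsilon>\<close> in simp)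
    then show "\<exists>N. \<forall>m\<ge>N. \<forall>n. norm (\<Sum>i=m..<n. scaleH S (?c i) (e i)) < \<epsilon>" by blast
  qed
  then have y: "(\<lambda>i. scaleH S (?c i) (e i)) sums (\<Sum>i. scaleH S (?c i) (e i))" (is "_ sums ?y") by (rule summable_sums)
  have py: "pairing S \<eta> ?y = u (0, \<eta>)" for \<eta>
  proof -
    have "(\<lambda>i. ?c i * pairing S \<eta> (e i)) sums pairing S \<eta> ?y"
      using bounded_linear.sums[OF pairing_linear(1) y, of \<eta>] by (simp add: pairing_scale)
    moreover have "((\<lambda>i. ?c i * pairing S \<eta> (e i)) has_sum u (0, \<eta>)) UNIV"
    proof -
      have "bounded_linear (\<lambda>\<eta>. u (0, \<eta>))"
        by (rule bounded_linear_compose[OF dualW_bounded[OF u]]) (intro bounded_linear_Pair bounded_linear_zero bounded_linear_ident)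
      from has_sum_bounded_linear[OF this dual_basis_expansion[of \<eta>]]
      have "((\<lambda>i. u (0, scaleD S (pairing S \<eta> (e i)) (de i))) has_sum u (0, \<eta>)) UNIV" by (simp add: o_def)
      moreover have "u (0, scaleD S c \<zeta>) = c * u (0, \<zeta>)" for c \<zeta>
        using dualW_scale[OF u, of c "(0, \<zeta>)"] by (simp add: scaleW_def)
      ultimately show ?thesis by (simp add: mult.commute)
    qed
    ultimately show ?thesis using has_sum_imp_sums sums_unique2 by blast
  qed
  have "\<forall>\<eta>. pairing S \<eta> (vector_part S u) = u (0, \<eta>)"
    unfolding vector_part_def
  proof (rule theI)
    show "\<forall>\<eta>. pairing S \<eta> ?y = u (0, \<eta>)" using py by blast
    show "z = ?y" if "\<forall>\<eta>. pairing S \<eta> z = u (0, \<eta>)" for z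
    proof (rule eq_of_ip_basis)
      show "ip S (e i) z = ip S (e i) ?y" for i
        using that py[of "de i"] by (simp add: pairing_dual_basis[symmetric])
    qed
  qed
  then show ?thesis by blast
qed

lemma pairing_operator_expansion:
  assumes u: "u \<in> dualW S" and v: "v \<in> dualW S" and X: "X \<in> bounded_operators S"
  shows "((\<lambda>j. u (X (e j), 0) * v (0, de j)) has_sum
    pairing S (dual_part S u) (X (vector_part S v))) UNIV"
proof -
  have "bounded_linear (\<lambda>x. pairing S (dual_part S u) (X x))"
    by (rule bounded_linear_compose[OF pairing_linear(1) blinfun.bounded_linear_right])
  from has_sum_bounded_linear[OF this basis_expansion[of "vector_part S v"]]
  have "((\<lambda>j. pairing S (dual_part S u) (X (scaleH S (ip S (e j) (vector_part S v)) (e j)))) has_sum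
    pairing S (dual_part S u) (X (vector_part S v))) UNIV" by (simp add: o_def)
  moreover have "pairing S (dual_part S u) (X (scaleH S (ip S (e j) (vector_part S v)) (e j)))
      = u (X (e j), 0) * v (0, de j)" for j
    using X by (simp add: bounded_operators_def pairing_scale dual_part_pairing[OF u] pairing_dual_basis[symmetric]
        vector_part_pairing[OF v] mult.commute)
  ultimately show ?thesis by simp
qed

abbreviation pA :: "('h \<Rightarrow>\<^sub>L 'h) \<Rightarrow> bool \<times> nat \<Rightarrow> 'h \<times> 'd" where "pA A \<equiv> pfam (A + id_blinfun)"
abbreviation qA :: "('h \<Rightarrow>\<^sub>L 'h) \<Rightarrow> bool \<times> nat \<Rightarrow> 'h \<times> 'd" where "qA A \<equiv> qfam (A - id_blinfun)"

context
  fixes A assumes A: "A \<in> bounded_operators S"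
begin

lemma bessel_pA: "bessel (pA A) (norm (A + id_blinfun) + 1)"
  by (rule bessel_pfam[OF bounded_operators_add[OF A bounded_operators_id]])

lemma bessel_qA: "bessel (qA A) (1 + norm (A - id_blinfun))"
  by (rule bessel_qfam[OF bounded_operators_diff[OF A bounded_operators_id]])

text \<open>The \<open>True\<close> indices give the first summand of \<open>bform\<close>, the
  \<open>False\<close> indices the second, each by expanding a vector part in the basis.\<close>

lemma bform_expansion:
  assumes u: "u \<in> dualW S" and v: "v \<in> dualW S"
  shows "((\<lambda>b. u (pA A b) * v (qA A b)) has_sum bform S A u v) UNIV"
proof -
  have "((\<lambda>b. u (pA A b) * v (qA A b)) has_sum
      pairing S (dual_part S v) ((A - id_blinfun) (vector_part S u)) +
      pairing S (dual_part S u) ((A + id_blinfun) (vector_part S v))) UNIV"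
    by (rule has_sum_bool_split)
      (use pairing_operator_expansion[OF u v bounded_operators_add[OF A bounded_operators_id]]
        pairing_operator_expansion[OF v u bounded_operators_diff[OF A bounded_operators_id]]
       in \<open>simp_all add: pfam_def qfam_def mult.commute\<close>)
  then show ?thesis by (simp add: bform_def add.commute)
qed

lemma form_power_pure_tensor:
  assumes "length us = r" "length vs = r" "set us \<subseteq> dualW S" "set vs \<subseteq> dualW S"
  shows "form_power (pA A) (qA A) r (pure_tensor us) (pure_tensor vs) = (\<Prod>k<r. bform S A (us ! k) (vs ! k))"
  using assms
proof (induction r arbitrary: us vs)
  case 0
  then show ?case by (simp add: pure_tensor_Nil)
next
  case (Suc r)
  obtain u us' v vs' where uv: "us = u # us'" "vs = v # vs'"
    using Suc.prems by (metis length_Suc_conv)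
  have hs: "hs_jet (pure_tensor us')" "hs_jet (pure_tensor vs')"
    using pure_tensor_tensor_power[of us' r] pure_tensor_tensor_power[of vs' r] Suc.prems uv by (auto simp: tensor_power_iff)
  have "form_power (pA A) (qA A) (Suc r) (pure_tensor us) (pure_tensor vs)
      = (\<Sum>\<^sub>\<infinity>b. u (pA A b) * v (qA A b) * form_power (pA A) (qA A) r (pure_tensor us') (pure_tensor vs'))"
    by (simp add: uv pure_tensor_Cons form_power_scale[OF bessel_pA bessel_qA] hs hs_jet_scale
        form_power_scale_right[OF bessel_pA bessel_qA] mult.assoc)
  also have "\<dots> = bform S A u v * form_power (pA A) (qA A) r (pure_tensor us') (pure_tensor vs')"
    by (rule infsumI, rule has_sum_cmult_left, rule bform_expansion) (use Suc.prems uv in auto)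
  also have "form_power (pA A) (qA A) r (pure_tensor us') (pure_tensor vs') = (\<Prod>k<r. bform S A (us' ! k) (vs' ! k))"
    by (rule Suc.IH) (use Suc.prems uv in auto)
  finally show ?case by (simp add: uv prod.lessThan_Suc_shift del: prod.lessThan_Suc)
qed

lemma bform_power_eq:
  assumes s: "s \<in> tensor_power S r" and t: "t \<in> tensor_power S r"
  shows "bform_power S A r s t = form_power (pA A) (qA A) r s t"
proof -
  let ?V = "tensor_power S r"
  \<comment> \<open>Extended by 0 outside the tensor power, as the definite description
    requires.\<close>
  define b0 where "b0 s t = (if s \<in> ?V \<and> t \<in> ?V then form_power (pA A) (qA A) r s t else 0)" for s t
  let ?P = "\<lambda>b. bounded_bilinear_form S r b \<and>
     (\<forall>us vs. length us = r \<and> length vs = r \<and> set us \<subseteq> dualW S \<and> set vs \<subseteq> dualW S \<longrightarrow>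
        b (pure_tensor us) (pure_tensor vs) = (\<Prod>k<r. bform S A (us ! k) (vs ! k))) \<and>
     (\<forall>s t. s \<notin> ?V \<or> t \<notin> ?V \<longrightarrow> b s t = 0)"
  have bb: "bounded_bilinear_form S r b0"
    unfolding bounded_bilinear_form_def
  proof (intro conjI ballI)
    fix t assume t: "t \<in> ?V"
    show "linear_form_on ?V (\<lambda>s. b0 s t)"
      unfolding linear_form_on_def
      using t by (simp add: b0_def tensor_power_add tensor_power_scale form_power_add[OF bessel_pA bessel_qA]
          form_power_scale[OF bessel_pA bessel_qA] hs_jet_tensor_power)
    show "linear_form_on ?V (\<lambda>s. b0 t s)"
      unfolding linear_form_on_def
      using t by (simp add: b0_def tensor_power_add tensor_power_scale form_power_add_right[OF bessel_pA bessel_qA]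
          form_power_scale_right[OF bessel_pA bessel_qA] hs_jet_tensor_power)
  next
    show "\<exists>C. \<forall>s\<in>?V. \<forall>t\<in>?V. norm (b0 s t) \<le> C * tnorm r s * tnorm r t"
      using form_power_bound(1)[OF bessel_pA bessel_qA hs_jet_tensor_power hs_jet_tensor_power]
      by (intro exI[of _ "((norm (A + id_blinfun) + 1) * (1 + norm (A - id_blinfun))) ^ r"]) (simp add: b0_def mult.assoc)
  qed
  have P0: "?P b0"
    using bb form_power_pure_tensor pure_tensor_tensor_power by (simp add: b0_def)
  have "b = b0" if b: "?P b" for b
  proof (intro ext)
    fix s t
    show "b s t = b0 s t"
    proof (cases "s \<in> ?V \<and> t \<in> ?V")
      case True
      have lin: "linear_form_on ?V (\<lambda>s. b s t)" "linear_form_on ?V (b t)" "linear_form_on ?V (\<lambda>s. b0 s t)" "linear_form_on ?V (b0 t)"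
        if "t \<in> ?V" for t
        using b bb that unfolding bounded_bilinear_form_def by blast+
      obtain C where C: "\<And>s t. s \<in> ?V \<Longrightarrow> t \<in> ?V \<Longrightarrow> norm (b s t) \<le> C * tnorm r s * tnorm r t"
        using b unfolding bounded_bilinear_form_def by blast
      obtain M where M: "\<And>s t. s \<in> ?V \<Longrightarrow> t \<in> ?V \<Longrightarrow> norm (b0 s t) \<le> M * tnorm r s * tnorm r t"
        using bb unfolding bounded_bilinear_form_def by blast
      have pure: "b (basis_tensor is) (basis_tensor js) = b0 (basis_tensor is) (basis_tensor js)"
        if "length is = r" "length js = r" for "is" js
      proof -
        have sub: "set (map coordW is) \<subseteq> dualW S" "set (map coordW js) \<subseteq> dualW S" using coordW_dualW by auto
        have "b (pure_tensor (map coordW is)) (pure_tensor (map coordW js))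
            = (\<Prod>k<r. bform S A (map coordW is ! k) (map coordW js ! k))"
          using conjunct1[OF conjunct2[OF b]] sub that by (simp only: length_map simp_thms)
        moreover have "b0 (pure_tensor (map coordW is)) (pure_tensor (map coordW js))
            = (\<Prod>k<r. bform S A (map coordW is ! k) (map coordW js ! k))"
          using conjunct1[OF conjunct2[OF P0]] sub that by (simp only: length_map simp_thms)
        ultimately show ?thesis by (simp only: basis_tensor_def)
      qed
      \<comment> \<open>Uniqueness in two stages: the first argument is fixed at a basis tensor
        while the second varies, then the first varies.\<close>
      have half: "b (basis_tensor is) t = b0 (basis_tensor is) t" if "length is = r" for "is"
      proof (rule linear_form_eqI[where f = "b (basis_tensor is)" and g = "b0 (basis_tensor is)"])
        note I = basis_tensor_tensor_power[OF that]
        show "linear_form_on ?V (b (basis_tensor is))" "linear_form_on ?V (b0 (basis_tensor is))" by (rule lin(2)[OF I] lin(4)[OF I])+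
        show "norm (b (basis_tensor is) t) \<le> (C * tnorm r (basis_tensor is)) * tnorm r t" if "t \<in> ?V" for t by (rule C[OF I that])
        show "norm (b0 (basis_tensor is) t) \<le> (M * tnorm r (basis_tensor is)) * tnorm r t" if "t \<in> ?V" for t by (rule M[OF I that])
      qed (use pure that True in auto)
      show ?thesis
      proof (rule linear_form_eqI[where f = "\<lambda>s. b s t" and g = "\<lambda>s. b0 s t"])
        show "linear_form_on ?V (\<lambda>s. b s t)" "linear_form_on ?V (\<lambda>s. b0 s t)" using lin(1,3) True by blast+
        show "norm (b s t) \<le> (C * tnorm r t) * tnorm r s" if "s \<in> ?V" for s
          using C[OF that conjunct2[OF True]] by (simp add: mult_ac)
        show "norm (b0 s t) \<le> (M * tnorm r t) * tnorm r s" if "s \<in> ?V" for s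
          using M[OF that conjunct2[OF True]] by (simp add: mult_ac)
      qed (use half True in auto)
    next
      case False
      then have "b s t = 0" using conjunct2[OF conjunct2[OF b]] by blast
      moreover have "b0 s t = 0" using False by (auto simp: b0_def)
      ultimately show ?thesis by simp
    qed
  qed
  with P0 have "bform_power S A r = b0"
    unfolding bform_power_def by (rule the_equality)
  then show ?thesis using s t by (simp add: b0_def)
qed

lemma nth_deriv_tensor_power: "F \<in> HS \<Longrightarrow> nth_deriv n F w \<in> tensor_power S n"
  unfolding nth_deriv_eq_length_part using HS_jet[of F w] by (intro length_part_tensor_power) (auto simp: hs_jet_def)

lemma cochain_eq:
  assumes F: "F \<in> HS" and G: "G \<in> HS"
  shows "cochain S A r F G = exp_op A r F G"
proof
  fix w
  show "cochain S A r F G w = exp_op A r F G w"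
  proof (cases r)
    case 0
    then show ?thesis by (simp add: cochain_def exp_op_0)
  next
    case (Suc m)
    have "cochain S A r F G w = form_power (pA A) (qA A) r (nth_deriv r F w) (nth_deriv r G w)"
      using Suc by (simp add: cochain_def bform_power_eq nth_deriv_tensor_power F G)
    also have "\<dots> = form_power (pA A) (qA A) r (deriv_form F w) (deriv_form G w)"
      by (rule form_power_cong) (simp_all add: nth_deriv_def)
    finally show ?thesis by (simp add: exp_op_eq_form_power F G)
  qed
qed

end

end

text \<open>f need not be injective: parameters with the same image are related by R, since E is
  reflexive on the image.\<close>

lemma quotient_bij:
  assumes R: "equiv A R" and E: "equiv (f ` A) E"
    and iff: "\<And>x y. x \<in> A \<Longrightarrow> y \<in> A \<Longrightarrow> (f x, f y) \<in> E \<longleftrightarrow> (x, y) \<in> R"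
  shows "\<exists>\<Phi>. bij_betw \<Phi> (A // R) (f ` A // E) \<and> (\<forall>x\<in>A. \<Phi> (R `` {x}) = E `` {f x})"
proof -
  \<comment> \<open>A union over the class avoids choosing a representative; all members contribute
    the same class of E.\<close>
  define \<Phi> where "\<Phi> C = (\<Union>x\<in>C. E `` {f x})" for C
  have \<Phi>: "\<Phi> (R `` {x}) = E `` {f x}" if "x \<in> A" for x
  proof -
    have "E `` {f y} = E `` {f x}" if "y \<in> R `` {x}" for y
    proof -
      have "y \<in> A" using equiv_type[OF R] that by auto
      then have "(f x, f y) \<in> E" using iff[OF \<open>x \<in> A\<close>, of y] that by simp
      then show ?thesis using equiv_class_eq[OF E] by blast
    qed
    moreover have "x \<in> R `` {x}" using equiv_class_self[OF R \<open>x \<in> A\<close>] .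
    ultimately show ?thesis unfolding \<Phi>_def by blast
  qed
  have "inj_on \<Phi> (A // R)"
  proof (rule inj_onI)
    fix C C' assume C: "C \<in> A // R" "C' \<in> A // R" "\<Phi> C = \<Phi> C'"
    obtain x y where xy: "x \<in> A" "C = R `` {x}" "y \<in> A" "C' = R `` {y}"
      using C by (auto elim!: quotientE)
    then have "E `` {f x} = E `` {f y}" using C(3) \<Phi> by simp
    then have "(f x, f y) \<in> E" using eq_equiv_class[OF _ E] xy by blast
    then have "(x, y) \<in> R" using iff xy by blast
    then show "C = C'" using equiv_class_eq[OF R] xy by blast
  qed
  moreover have "\<Phi> ` (A // R) = f ` A // E"
    using \<Phi> by (auto simp: quotient_def image_iff)
  ultimately show ?thesis using \<Phi> by (auto simp: bij_betw_def)
qed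

section \<open>Coefficients of formal series and star products\<close>

lemma nth_series_of: "fps_nth (series_of F) n = (if n = 0 then F else (\<lambda>_. 0))"
  by (simp add: series_of_def)

lemma nth_formal_operator:
  "fps_nth (formal_operator T f) n w = fps_nth f n w + (\<Sum>r=1..n. T r (fps_nth f (n - r)) w)"
  by (simp add: formal_operator_def)

lemma nth_formal_operator_series_of:
  fixes T :: "nat \<Rightarrow> ('w \<Rightarrow> 'k::comm_monoid_add) \<Rightarrow> 'w \<Rightarrow> 'k"
  assumes "\<And>r. 1 \<le> r \<Longrightarrow> T r (\<lambda>_. 0) = (\<lambda>_. 0)"
  shows "fps_nth (formal_operator T (series_of F)) n = (if n = 0 then F else T n F)"
proof (cases "n = 0")
  case True
  then show ?thesis by (intro ext) (simp add: nth_formal_operator nth_series_of)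
next
  case False
  have "(\<Sum>r=1..n. T r (fps_nth (series_of F) (n - r)) w) = (\<Sum>r=1..n. if r = n then T n F w else 0)" for w
    by (rule sum.cong) (auto simp: nth_series_of assms)
  then show ?thesis using False by (intro ext) (simp add: nth_formal_operator nth_series_of)
qed

context phase_space
begin

lemma exp_op_scale:
  assumes A: "A \<in> bounded_operators S" and F: "F \<in> HS" and G: "G \<in> HS"
  shows "exp_op A r (\<lambda>w. c * F w) (\<lambda>w. d * G w) w = c * d * exp_op A r F G w"
proof -
  have "deriv_form (\<lambda>w. c * H w) w = (\<lambda>vs. c * deriv_form H w vs)" if "H \<in> HS" for c H
    using deriv_form_scale[OF that] by (rule ext)
  then show ?thesis
    by (simp add: exp_op_eq_form_power HS_scale F G HS_jet hs_jet_scale form_power_scale[OF bessel_pA[OF A] bessel_qA[OF A]]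
        form_power_scale_right[OF bessel_pA[OF A] bessel_qA[OF A]] mult.assoc)
qed

lemma exp_op_zero:
  assumes A: "A \<in> bounded_operators S" and F: "F \<in> HS"
  shows "exp_op A r (\<lambda>_. 0) F = (\<lambda>_. 0)" "exp_op A r F (\<lambda>_. 0) = (\<lambda>_. 0)"
  using exp_op_scale[OF A HS_const[of 0] F, of r 0 1] exp_op_scale[OF A F HS_const[of 0], of r 1 0] by auto

lemma hs_series_series_of: "F \<in> HS \<Longrightarrow> series_of F \<in> hs_series S"
  by (simp add: hs_series_def nth_series_of HS_const)

lemma nth_star:
  assumes A: "A \<in> bounded_operators S" and f: "f \<in> hs_series S" and g: "g \<in> hs_series S"
  shows "fps_nth (star S A f g) n w
    = (\<Sum>(r, i, j)\<in>triples n. exp_op A r (fps_nth f i) (fps_nth g j) w / fact r)"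
proof -
  have "fps_nth (star S A f g) n w
      = (\<Sum>r\<le>n. \<Sum>i\<le>n - r. exp_op A r (fps_nth f i) (fps_nth g (n - r - i)) w / fact r)"
    using f g by (simp add: star_def hs_series_def cochain_eq[OF A])
  then show ?thesis by (simp add: sum_triples sum_pairs)
qed

lemma nth_star_series_of:
  assumes A: "A \<in> bounded_operators S" and F: "F \<in> HS" and G: "G \<in> HS"
  shows "fps_nth (star S A (series_of F) (series_of G)) n = (\<lambda>w. inverse (fact n) * exp_op A n F G w)"
proof
  fix w
  have "fps_nth (star S A (series_of F) (series_of G)) n w
      = (\<Sum>(r, i, j)\<in>triples n. exp_op A r (fps_nth (series_of F) i) (fps_nth (series_of G) j) w / fact r)"
    by (rule nth_star[OF A hs_series_series_of[OF F] hs_series_series_of[OF G]])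
  also have "\<dots> = (\<Sum>x\<in>triples n. if x = (n, 0, 0) then exp_op A n F G w / fact n else 0)"
  proof (rule sum.cong[OF refl], clarify)
    fix r i j assume "(r, i, j) \<in> triples n"
    then show "exp_op A r (fps_nth (series_of F) i) (fps_nth (series_of G) j) w / fact r
        = (if (r, i, j) = (n, 0, 0) then exp_op A n F G w / fact n else 0)"
      by (cases "i = 0"; cases "j = 0")
        (auto simp: nth_series_of triples_def exp_op_zero[OF A F] exp_op_zero[OF A G] exp_op_zero[OF A HS_const])
  qed
  also have "\<dots> = exp_op A n F G w / fact n"
    using finite_triples[of n] by (simp add: triples_def)
  finally show "fps_nth (star S A (series_of F) (series_of G)) n w = inverse (fact n) * exp_op A n F G w"
    by (simp add: field_simps)
qed

section \<open>Hilbert-Schmidt differences give equivalent products\<close>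

text \<open>The form on jets that represents \<open>lap D ^^ r\<close>: r pairs of slots are
  contracted with the tensor of D. It exhibits the power as a differential operator with a constant
  coefficient.\<close>

primrec contract :: "('h \<Rightarrow>\<^sub>L 'h) \<Rightarrow> nat \<Rightarrow> (('h \<times> 'd) list \<Rightarrow> 'k) \<Rightarrow> 'k" where
  "contract D 0 t = t []"
| "contract D (Suc r) t = (\<Sum>\<^sub>\<infinity>j. contract D r (\<lambda>vs. t ((0, de j) # (D (e j), 0) # vs)))"

lemma contract_cong: "(\<And>vs. length vs = 2 * r \<Longrightarrow> s vs = t vs) \<Longrightarrow> contract D r s = contract D r t"
proof (induction r arbitrary: s t)
  case (Suc r)
  have "contract D r (\<lambda>vs. s ((0, de j) # (D (e j), 0) # vs))
      = contract D r (\<lambda>vs. t ((0, de j) # (D (e j), 0) # vs))" for j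
    by (rule Suc.IH) (simp add: Suc.prems)
  then show ?case by simp
qed simp

lemma smooth_map_const:
  fixes c :: "'p \<Rightarrow> 'k"
  assumes "0 \<le> C" and "\<And>p. p \<in> P \<Longrightarrow> 0 \<le> N p" and "\<And>p. p \<in> P \<Longrightarrow> norm (c p) \<le> C * N p"
  shows "smooth_map S P N (\<lambda>_. c)"
proof -
  have lin: "Vector_Spaces.linear (scaleW S) (*) (\<lambda>_. 0 :: 'k)"
    using W.vector_space_axioms vector_space_field by (simp add: Vector_Spaces.linear_iff)
  have 1: "multilinear S n (\<lambda>vs. if vs = [] then a else 0)" for n a
    unfolding multilinear_def using lin by simp
  have 2: "norm (if vs = [] then c p else 0) \<le> C * N p * prod_list (map norm vs)" if "p \<in> P" for p and vs :: "('h \<times> 'd) list"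
    using assms(1) assms(2,3)[OF that] prod_list_norm_nonneg[of vs] by (cases vs) auto
  have d: "deriv_form (\<lambda>_. c p) w = (\<lambda>vs. if vs = [] then c p else 0)" for p and w :: "'h \<times> 'd"
    by (rule ext) (rule deriv_form_const)
  have 3: "norm ((if vs = [] then c p else 0) - (if vs = [] then c p else 0) - (if h # vs = [] then c p else 0))
      \<le> \<epsilon> * norm h * N p * prod_list (map norm vs)" if "p \<in> P" "0 < \<epsilon>" for p h \<epsilon> and vs :: "('h \<times> 'd) list"
    using assms(2)[OF that(1)] that(2) prod_list_norm_nonneg[of vs] by simp
  show ?thesis
    unfolding smooth_map_def d
  proof (intro allI conjI impI)
    show "\<exists>C. \<forall>p\<in>P. \<forall>vs :: ('h \<times> 'd) list. length vs = n \<longrightarrow>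
        norm (if vs = [] then c p else 0) \<le> C * N p * prod_list (map norm vs)" for n
      using 2 by blast
    show "\<exists>\<delta>>0. \<forall>h. norm h < \<delta> \<longrightarrow> (\<forall>p\<in>P. \<forall>vs :: ('h \<times> 'd) list. length vs = n \<longrightarrow>
        norm ((if vs = [] then c p else 0) - (if vs = [] then c p else 0) - (if h # vs = [] then c p else 0))
          \<le> \<epsilon> * norm h * N p * prod_list (map norm vs))" if "0 < \<epsilon>" for n \<epsilon>
      using 3[OF _ that] zero_less_one by blast
  qed (use 1 in blast)
qed

context
  fixes D assumes D: "D \<in> hilbert_schmidt_operators S"
begin

lemma contract_bound:
  assumes "hs_jet t"
  shows "norm (contract D r t) \<le> hs_norm D ^ r * tnorm (2 * r) t"
    and "(\<lambda>j. norm (contract D r (\<lambda>vs. t ((0, de j) # (D (e j), 0) # vs)))) summable_on UNIV"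
proof -
  let ?f = "\<lambda>t j vs. t ((0, de j) # (D (e j), 0) # vs)"
  have jet: "hs_jet (?f t j)" if "hs_jet t" for t j
    by (rule hs_jet_front[OF hs_jet_front[OF that]])
  have front: "(\<Sum>j\<in>Y. norm (contract D r (?f t j))) \<le> hs_norm D ^ Suc r * tnorm (2 * Suc r) t"
    if Y: "finite Y" and t: "hs_jet t" and IH: "\<forall>t. hs_jet t \<longrightarrow> norm (contract D r t) \<le> hs_norm D ^ r * tnorm (2 * r) t" for Y r t
  proof -
    have "(\<Sum>j\<in>Y. norm (contract D r (?f t j))) \<le> (\<Sum>j\<in>Y. hs_norm D ^ r * tnorm (2 * r) (?f t j))"
      by (rule sum_mono) (rule IH[rule_format, OF jet[OF t]])
    also have "\<dots> = hs_norm D ^ r * (\<Sum>j\<in>Y. tnorm (2 * r) (?f t j))"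
      by (simp add: sum_distrib_left)
    also have "\<dots> \<le> hs_norm D ^ r * (hs_norm D * tnorm (Suc (Suc (2 * r))) t)"
      by (intro mult_left_mono sum_tnorm_contract_le[OF D t Y] zero_le_power hs_norm_nonneg)
    finally show ?thesis by (simp add: mult_ac)
  qed
  have sm: "(\<lambda>j. norm (contract D r (?f t j))) summable_on UNIV"
    if t: "hs_jet t" and IH: "\<forall>t. hs_jet t \<longrightarrow> norm (contract D r t) \<le> hs_norm D ^ r * tnorm (2 * r) t" for r t
  proof (rule nonneg_bdd_above_summable_on)
    show "bdd_above (sum (\<lambda>j. norm (contract D r (?f t j))) ` {F. F \<subseteq> UNIV \<and> finite F})"
      by (rule bdd_aboveI[of _ "hs_norm D ^ Suc r * tnorm (2 * Suc r) t"]) (use front[OF _ t IH] in auto)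
  qed auto
  have bound: "norm (contract D r t) \<le> hs_norm D ^ r * tnorm (2 * r) t" if "hs_jet t" for r t
    using that
  proof (induction r arbitrary: t)
    case 0
    then show ?case by (simp add: tensor_norm_def)
  next
    case (Suc r)
    have IH: "\<forall>t. hs_jet t \<longrightarrow> norm (contract D r t) \<le> hs_norm D ^ r * tnorm (2 * r) t"
      using Suc.IH by blast
    have "norm (\<Sum>\<^sub>\<infinity>j. contract D r (?f t j)) \<le> hs_norm D ^ Suc r * tnorm (2 * Suc r) t"
    proof (rule has_sum_norm_le)
      show "((\<lambda>j. contract D r (?f t j)) has_sum (\<Sum>\<^sub>\<infinity>j. contract D r (?f t j))) UNIV"
        by (rule has_sum_infsum[OF abs_summable_summable[OF sm[OF Suc.prems IH]]])
      show "norm (\<Sum>j\<in>Y. contract D r (?f t j)) \<le> hs_norm D ^ Suc r * tnorm (2 * Suc r) t" if "finite Y" for Y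
        by (rule order_trans[OF norm_sum front[OF that Suc.prems IH]])
    qed
    then show ?case by simp
  qed
  show "norm (contract D r t) \<le> hs_norm D ^ r * tnorm (2 * r) t" by (rule bound[OF assms])
  show "(\<lambda>j. norm (contract D r (?f t j))) summable_on UNIV" by (rule sm[OF assms]) (use bound in blast)
qed

lemma hs_jet_front2: "hs_jet t \<Longrightarrow> hs_jet (\<lambda>vs. t (u # v # vs))"
  by (rule hs_jet_front[OF hs_jet_front])

lemma contract_add:
  "hs_jet s \<Longrightarrow> hs_jet t \<Longrightarrow> contract D r (\<lambda>vs. s vs + t vs) = contract D r s + contract D r t"
proof (induction r arbitrary: s t)
  case (Suc r)
  then show ?case
    using abs_summable_summable[OF contract_bound(2)[OF Suc.prems(1)]] abs_summable_summable[OF contract_bound(2)[OF Suc.prems(2)]]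
    by (simp add: hs_jet_front2 infsum_add)
qed simp

lemma contract_scale:
  "hs_jet t \<Longrightarrow> contract D r (\<lambda>vs. c * t vs) = c * contract D r t"
proof (induction r arbitrary: t)
  case (Suc r)
  then show ?case
    using abs_summable_summable[OF contract_bound(2)[OF Suc.prems]]
    by (simp add: hs_jet_front2 infsum_cmult_right)
qed simp

lemma lap_power_eq_contract:
  "F \<in> HS \<Longrightarrow> (lap D ^^ r) F w = contract D r (deriv_form F w)"
proof (induction r arbitrary: F)
  case (Suc r)
  have "(lap D ^^ Suc r) F w = (lap D ^^ r) (lap D F) w" by (simp add: funpow_swap1)
  also have "\<dots> = (\<Sum>\<^sub>\<infinity>j. (lap D ^^ r) (dird (D (e j), 0) (dird (0, de j) F)) w)"
    unfolding lap_def[of D F] conjunct2[OF lap_power_series[OF D hs_summable_lap[OF D Suc.prems]]] ..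
  also have "\<dots> = contract D (Suc r) (deriv_form F w)"
    by (simp add: Suc.IH dird_HS Suc.prems deriv_form_dird_dird[OF D])
  finally show ?case .
qed simp

lemma differential_operator_lap_power:
  "differential_operator S (\<lambda>F w. inverse (fact r) * (lap D ^^ r) F w)"
proof -
  define a where "a n (w :: 'h \<times> 'd) t = (if n = 2 * r then inverse (fact r) * contract D r t else 0)" for n w t
  have "linear_form_on (tensor_power S n) (a n w)" for n w
    unfolding linear_form_on_def a_def
    by (auto simp: contract_add contract_scale hs_jet_tensor_power algebra_simps)
  moreover have "smooth_map S (tensor_power S n) (tnorm n) (a n)" for n
  proof -
    have "smooth_map S (tensor_power S n) (tnorm n) (\<lambda>_ t. if n = 2 * r then inverse (fact r) * contract D r t else 0)"
    proof (rule smooth_map_const[where C = "norm (inverse (fact r) :: 'k) * hs_norm D ^ r"])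
      fix t assume "t \<in> tensor_power S n"
      then have "norm (inverse (fact r) * contract D r t) \<le> norm (inverse (fact r) :: 'k) * (hs_norm D ^ r * tnorm (2 * r) t)"
        unfolding norm_mult by (intro mult_left_mono contract_bound(1) hs_jet_tensor_power) auto
      then show "norm (if n = 2 * r then inverse (fact r) * contract D r t else 0) \<le> norm (inverse (fact r) :: 'k) * hs_norm D ^ r * tnorm n t"
        by (auto simp: mult.assoc)
    qed auto
    then show ?thesis by (simp add: a_def[abs_def])
  qed
  moreover have "inverse (fact r) * (lap D ^^ r) F w = (\<Sum>n\<le>2 * r. a n w (nth_deriv n F w))" if "F \<in> HS" for F w
  proof -
    have "(\<Sum>n\<le>2 * r. a n w (nth_deriv n F w)) = inverse (fact r) * contract D r (nth_deriv (2 * r) F w)"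
      by (simp add: a_def)
    also have "contract D r (nth_deriv (2 * r) F w) = contract D r (deriv_form F w)"
      by (rule contract_cong) (simp add: nth_deriv_def)
    finally show ?thesis by (simp add: lap_power_eq_contract that)
  qed
  moreover have "(\<lambda>w. inverse (fact r) * (lap D ^^ r) F w) \<in> HS" if "F \<in> HS" for F
    by (intro HS_scale lap_power_HS[OF D] that)
  ultimately show ?thesis
    unfolding differential_operator_def
    by (intro conjI exI[of _ a] exI[of _ "2 * r"]) auto
qed

lemma lap_power_zero: "(lap D ^^ r) (\<lambda>_. 0) = (\<lambda>_. 0)"
  by (induction r) (simp_all add: lap_const[OF D])

lemma lap_power_const: "1 \<le> r \<Longrightarrow> (lap D ^^ r) (\<lambda>_. c) = (\<lambda>_. 0)"
  by (cases r) (simp_all add: funpow_swap1 lap_const[OF D] lap_power_zero)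

lemma lap_power_scale: "F \<in> HS \<Longrightarrow> (lap D ^^ r) (\<lambda>w. c * F w) = (\<lambda>w. c * (lap D ^^ r) F w)"
  by (induction r) (simp_all add: lap_scale[OF D] lap_power_HS[OF D])

end

lemma equivalent_of_hilbert_schmidt:
  assumes A: "A \<in> bounded_operators S" and B: "B \<in> bounded_operators S" and D: "A - B \<in> hilbert_schmidt_operators S"
  shows "equivalent_products S (star S A) (star S B)"
proof -
  define T where "T r F w = inverse (fact r) * (lap (A - B) ^^ r) F w" for r and F :: "'h \<times> 'd \<Rightarrow> 'k" and w
  have T_HS: "T r F \<in> HS" if "F \<in> HS" for r F
    using HS_scale[OF lap_power_HS[OF D that], of "inverse (fact r)" r] by (simp add: T_def[abs_def])
  \<comment> \<open>\<open>formal_operator\<close> does not use \<open>T 0\<close>; with the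
    identity in this place its leading term is the summand \<open>r = 0\<close>.\<close>
  have T0: "T 0 F = F" for F by (simp add: T_def[abs_def])
  have T_const: "T r (\<lambda>_. c) = (\<lambda>_. 0)" if "1 \<le> r" for r c
    by (simp add: T_def[abs_def] lap_power_const[OF D that])
  have nth: "fps_nth (formal_operator T (series_of F)) n = T n F" for F n
    using nth_formal_operator_series_of[of T F n] T_const by (simp add: T0)
  have "differential_operator S (T r) \<and> vanishes_on_constants (T r)" if "1 \<le> r" for r
    using differential_operator_lap_power[OF D, of r] T_const[OF that]
    by (simp add: T_def[abs_def] vanishes_on_constants_def)
  moreover have "star S A (formal_operator T (series_of F)) (formal_operator T (series_of G))
      = formal_operator T (star S B (series_of F) (series_of G))" if F: "F \<in> HS" and G: "G \<in> HS" for F G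
  proof (rule fps_ext, rule ext)
    fix n w
    have "fps_nth (star S A (formal_operator T (series_of F)) (formal_operator T (series_of G))) n w
        = (\<Sum>(r, i, j)\<in>triples n. exp_op A r (T i F) (T j G) w / fact r)"
      by (subst nth_star[OF A]) (auto simp: hs_series_def nth T_HS F G)
    also have "\<dots> = (\<Sum>(r, i, j)\<in>triples n. inverse (fact r * fact i * fact j)
        * exp_op A r ((lap (A - B) ^^ i) F) ((lap (A - B) ^^ j) G) w)"
    proof (intro sum.cong refl, clarify)
      fix r i j
      have "exp_op A r (T i F) (T j G) w
          = inverse (fact i) * inverse (fact j) * exp_op A r ((lap (A - B) ^^ i) F) ((lap (A - B) ^^ j) G) w"
        unfolding T_def[abs_def] by (rule exp_op_scale[OF A lap_power_HS[OF D F] lap_power_HS[OF D G]])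
      then show "exp_op A r (T i F) (T j G) w / fact r = inverse (fact r * fact i * fact j)
        * exp_op A r ((lap (A - B) ^^ i) F) ((lap (A - B) ^^ j) G) w"
        by (simp add: field_simps)
    qed
    also have "\<dots> = (\<Sum>(i, m)\<in>pairs n. inverse (fact i * fact m) * (lap (A - B) ^^ i) (exp_op B m F G) w)"
      by (rule lap_exp_intertwine[OF A B D F G, symmetric])
    also have "\<dots> = (\<Sum>r\<le>n. T r (\<lambda>w. inverse (fact (n - r)) * exp_op B (n - r) F G w) w)"
      unfolding sum_pairs T_def
      by (intro sum.cong refl) (simp add: lap_power_scale[OF D exp_op_HS[OF B F G]] mult_ac)
    also have "\<dots> = T 0 (\<lambda>w. inverse (fact n) * exp_op B n F G w) w
        + (\<Sum>r=1..n. T r (\<lambda>w. inverse (fact (n - r)) * exp_op B (n - r) F G w) w)"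
      by (simp add: atMost_atLeast0 sum.atLeast_Suc_atMost)
    also have "\<dots> = fps_nth (formal_operator T (star S B (series_of F) (series_of G))) n w"
      by (simp add: nth_formal_operator nth_star_series_of[OF B F G] T0)
    finally show "fps_nth (star S A (formal_operator T (series_of F)) (formal_operator T (series_of G))) n w
        = fps_nth (formal_operator T (star S B (series_of F) (series_of G))) n w" .
  qed
  ultimately show ?thesis unfolding equivalent_products_def by blast
qed

section \<open>Equivalent products have a Hilbert-Schmidt difference\<close>

lemma leibniz_zero: "leibniz (\<lambda>_. 0) t vs = 0" "leibniz s (\<lambda>_. 0) vs = 0"
  by (induction vs arbitrary: s t) simp_all

lemma affine_jet_front: "(\<lambda>vs. affine_jet c u (v # vs)) = affine_jet (u v) (\<lambda>_. 0)"
  by (rule ext) (auto simp: affine_jet_def split: list.splits)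

lemma affine_jet_zero: "affine_jet 0 (\<lambda>_. 0) = (\<lambda>_. 0)"
  by (rule ext) (auto simp: affine_jet_def split: list.splits)

text \<open>At a common zero of two linear functions only the second derivative of their product
  survives, so a differential operator acts on the product there only through its coefficient of
  order 2.\<close>

lemma leibniz_affine_jet:
  "leibniz (affine_jet 0 u) (affine_jet 0 v) vs = (case vs of [x, y] \<Rightarrow> u x * v y + v x * u y | _ \<Rightarrow> 0)"
proof -
  have 1: "leibniz (affine_jet c (\<lambda>_. 0)) (affine_jet d (\<lambda>_. 0)) vs = (if vs = [] then c * d else 0)" for c d vs
    by (cases vs) (simp_all add: affine_jet_front affine_jet_zero leibniz_zero affine_jet_def[of _ _ "[]"])
  have 2: "leibniz (affine_jet c (\<lambda>_. 0)) (affine_jet 0 v) vs = (case vs of [y] \<Rightarrow> c * v y | _ \<Rightarrow> 0)" for c v vs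
    by (cases vs) (auto simp: affine_jet_front affine_jet_zero leibniz_zero affine_jet_def[of _ _ "[]"] 1 split: list.splits)
  show ?thesis
    by (cases vs)
      (auto simp: affine_jet_front leibniz_commute[of "affine_jet 0 u"] 2 affine_jet_def[of _ _ "[]"] mult.commute split: list.splits)
qed

text \<open>Orthonormality of basis tensors; f labels them injectively by an arbitrary finite
  set.\<close>

lemma hs_le_basis_tensor_combination:
  assumes "finite X" "inj_on f X" "\<And>x. x \<in> X \<Longrightarrow> length (f x) = n"
  shows "hs_le n (\<lambda>vs. \<Sum>x\<in>X. c x * basis_tensor (f x) vs) (sqrt (\<Sum>x\<in>X. (norm (c x))\<^sup>2))"
  unfolding hs_le_def
proof (intro conjI allI impI)
  let ?g = "inv_into X f"
  fix Z :: "(bool \<times> nat) list set" assume Z: "finite Z" "Z \<subseteq> {is. length is = n}"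
  have "(\<Sum>js\<in>Z. (norm (\<Sum>x\<in>X. c x * basis_tensor (f x) (map eW js)))\<^sup>2)
      = (\<Sum>js\<in>Z. if js \<in> f ` X then (norm (c (?g js)))\<^sup>2 else 0)"
  proof (rule sum.cong[OF refl])
    fix js assume js: "js \<in> Z"
    have "(\<Sum>x\<in>X. c x * basis_tensor (f x) (map eW js)) = (\<Sum>is\<in>f ` X. c (?g is) * basis_tensor is (map eW js))"
      by (subst sum.reindex[OF assms(2)]) (simp add: assms(2))
    also have "\<dots> = (if js \<in> f ` X then c (?g js) else 0)"
      by (rule basis_tensor_combination) (use assms Z js in auto)
    finally show "(norm (\<Sum>x\<in>X. c x * basis_tensor (f x) (map eW js)))\<^sup>2 = (if js \<in> f ` X then (norm (c (?g js)))\<^sup>2 else 0)"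
      by simp
  qed
  also have "\<dots> = (\<Sum>js\<in>Z \<inter> f ` X. (norm (c (?g js)))\<^sup>2)"
    using Z(1) by (simp add: sum.inter_restrict)
  also have "\<dots> \<le> (\<Sum>js\<in>f ` X. (norm (c (?g js)))\<^sup>2)"
    by (rule sum_mono2) (use assms(1) in auto)
  also have "\<dots> = (\<Sum>x\<in>X. (norm (c x))\<^sup>2)"
    by (subst sum.reindex[OF assms(2)]) (simp add: assms(2))
  finally show "(\<Sum>js\<in>Z. (norm (\<Sum>x\<in>X. c x * basis_tensor (f x) (map eW js)))\<^sup>2) \<le> (sqrt (\<Sum>x\<in>X. (norm (c x))\<^sup>2))\<^sup>2"
    by (simp add: sum_nonneg)
qed (simp add: sum_nonneg)

text \<open>
  In first order of \<open>\<hbar>\<close>, evaluated at \<open>0\<close> on products of two coordinates, an equivalence expresses the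
  matrix of \<open>A - B\<close> by a form that is bounded in the Hilbert-Schmidt norm.
\<close>

lemma hilbert_schmidt_of_equivalent:
  assumes A: "A \<in> bounded_operators S" and B: "B \<in> bounded_operators S"
    and eq: "equivalent_products S (star S A) (star S B)"
  shows "A - B \<in> hilbert_schmidt_operators S"
proof -
  let ?D = "A - B"
  let ?d = "\<lambda>i j. ip S (e i) (?D (e j))"
  let ?u = "\<lambda>i. coordW (False, i)" and ?v = "\<lambda>j. coordW (True, j)"
  \<comment> \<open>The second derivative at 0 of the product of \<open>?u i\<close> and
    \<open>?v j\<close>, an unnormalised symmetric tensor.\<close>
  let ?\<theta> = "\<lambda>i j vs. basis_tensor [(False, i), (True, j)] vs + basis_tensor [(True, j), (False, i)] vs"
  note bD = bounded_operators_diff[OF A B]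
  obtain T where T: "\<And>r. 1 \<le> r \<Longrightarrow> differential_operator S (T r) \<and> vanishes_on_constants (T r)"
    and TS: "\<And>F G. F \<in> HS \<Longrightarrow> G \<in> HS \<Longrightarrow> star S A (formal_operator T (series_of F)) (formal_operator T (series_of G))
               = formal_operator T (star S B (series_of F) (series_of G))"
    using eq unfolding equivalent_products_def by blast
  have T1: "differential_operator S (T 1)" and Tz: "\<And>r. 1 \<le> r \<Longrightarrow> T r (\<lambda>_. 0) = (\<lambda>_. 0)"
    using T[of 1] T unfolding vanishes_on_constants_def by simp_all
  have T_HS: "T r F \<in> HS" if "1 \<le> r" "F \<in> HS" for r F
    using T[OF that(1)] that(2) unfolding differential_operator_def by blast
  note nth = nth_formal_operator_series_of[of T, OF Tz]
  obtain a N where lin: "\<And>n w. n \<le> N \<Longrightarrow> linear_form_on (tensor_power S n) (a n w)"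
    and sm: "\<And>n. n \<le> N \<Longrightarrow> smooth_map S (tensor_power S n) (tnorm n) (a n)"
    and Ta: "\<And>F w. F \<in> HS \<Longrightarrow> T 1 F w = (\<Sum>n\<le>N. a n w (nth_deriv n F w))"
    using T1 unfolding differential_operator_def by blast
  \<comment> \<open>If the order bound N is below 2, the second order part is 0, and the identity
    for \<open>?d\<close> below says that the matrix of A - B vanishes.\<close>
  define h where "h t = (if 2 \<le> N then a 2 0 t else 0)" for t
  have h_lin: "linear_form_on (tensor_power S 2) h"
    using lin[of 2 0] by (auto simp: h_def[abs_def] linear_form_on_def)
  obtain C where C: "\<And>t. t \<in> tensor_power S 2 \<Longrightarrow> norm (h t) \<le> C * tnorm 2 t"
  proof (cases "2 \<le> N")
    case True
    \<comment> \<open>Order 0 of smoothness at the point 0 is boundedness of the coefficient in the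
      tensor norm.\<close>
    have "\<exists>C. \<forall>p\<in>tensor_power S 2. \<forall>vs. length vs = 0 \<longrightarrow>
           norm (deriv_form (\<lambda>x. a 2 x p) 0 vs) \<le> C * tnorm 2 p * prod_list (map norm vs)"
      using sm[OF True] unfolding smooth_map_def by blast
    then show thesis using that True by (auto simp: h_def)
  next
    case False
    then show thesis using that[of 0] by (simp add: h_def)
  qed
  have u: "?u i \<in> HS" and v: "?v j \<in> HS" for i j by (intro HS_linear coordW_dualW)+
  have uv0: "?u i 0 = 0" "?v j 0 = 0" for i j
    using dualW_scale[OF coordW_dualW, of _ 0 0] by simp_all
  have \<theta>: "?\<theta> i j \<in> tensor_power S 2" for i j
    by (intro tensor_power_add basis_tensor_tensor_power) simp_all
  have d: "?d i j = h (?\<theta> i j)" for i j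
  proof -
    have der: "nth_deriv n (pmult (?u i) (?v j)) 0 = (if n = 2 then ?\<theta> i j else (\<lambda>_. 0))" for n
    proof
      fix vs
      have "deriv_form (pmult (?u i) (?v j)) 0 vs = (case vs of [x, y] \<Rightarrow> ?u i x * ?v j y + ?v j x * ?u i y | _ \<Rightarrow> 0)"
        by (simp add: deriv_form_mult u v deriv_form_linear coordW_dualW uv0 leibniz_affine_jet)
      also have "\<dots> = ?\<theta> i j vs"
        by (auto simp: basis_tensor_def pure_tensor_Cons pure_tensor_Nil split: list.splits) (simp_all add: pure_tensor_def)
      finally have "deriv_form (pmult (?u i) (?v j)) 0 vs = ?\<theta> i j vs" .
      moreover have "?\<theta> i j vs = 0" if "length vs \<noteq> 2"
        using \<theta>[of i j] that by (simp add: tensor_power_iff)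
      ultimately show "nth_deriv n (pmult (?u i) (?v j)) 0 vs = (if n = 2 then ?\<theta> i j else (\<lambda>_. 0)) vs"
        by (auto simp: nth_deriv_def)
    qed
    have "T 1 (pmult (?u i) (?v j)) 0 = (\<Sum>n\<le>N. if n = 2 then a 2 0 (?\<theta> i j) else 0)"
      unfolding Ta[OF HS_mult[OF u v]]
      by (rule sum.cong[OF refl]) (use linear_form_on_zero[OF lin] in \<open>auto simp: der\<close>)
    then have T1h: "T 1 (pmult (?u i) (?v j)) 0 = h (?\<theta> i j)" by (simp add: h_def)
    have tr: "triples (Suc 0) = {(1, 0, 0), (0, 1, 0), (0, 0, 1)}" by (auto simp: triples_def)
    \<comment> \<open>Two of the three terms are \<open>T 1\<close> of one coordinate times the
      other coordinate; they vanish because coordinates vanish at 0.\<close>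
    have "fps_nth (star S A (formal_operator T (series_of (?u i))) (formal_operator T (series_of (?v j)))) 1 0
        = exp_op A 1 (?u i) (?v j) 0"
      by (subst nth_star[OF A]) (auto simp: hs_series_def nth T_HS u v tr exp_op_0 uv0)
    moreover have "fps_nth (formal_operator T (star S B (series_of (?u i)) (series_of (?v j)))) 1 0
        = exp_op B 1 (?u i) (?v j) 0 + T 1 (pmult (?u i) (?v j)) 0"
      by (simp add: nth_formal_operator nth_star_series_of[OF B u v] exp_op_0)
    ultimately have "exp_op A 1 (?u i) (?v j) 0 = exp_op B 1 (?u i) (?v j) 0 + h (?\<theta> i j)"
      using TS[OF u v] T1h by simp
    moreover have "exp_op A 1 (?u i) (?v j) 0 = exp_op B 1 (?u i) (?v j) 0 + ins ?D ?D pmult (?u i) (?v j) 0"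
    proof -
      have sp: "A + id_blinfun = (B + id_blinfun) + ?D" "A - id_blinfun = (B - id_blinfun) + ?D" by simp_all
      have "ins (A + id_blinfun) (A - id_blinfun) pmult (?u i) (?v j) 0
          = ins (B + id_blinfun) (B - id_blinfun) pmult (?u i) (?v j) 0 + ins ?D ?D pmult (?u i) (?v j) 0"
        by (subst sp(1), subst sp(2))
          (rule ins_add[OF bidiff_pmult bounded_operators_add[OF B bounded_operators_id] bD
            bounded_operators_diff[OF B bounded_operators_id] bD u v])
      then show ?thesis by (simp add: exp_op_def)
    qed
    moreover have "ins ?D ?D pmult (?u i) (?v j) 0 = ?d i j"
    proof -
      have dl: "dird x w 0 = w x" if "w \<in> dualW S" for x w
        by (simp add: dird_def deriv_form_linear[OF that] affine_jet_def)
      have "ins ?D ?D pmult (?u i) (?v j) 0 = (\<Sum>\<^sub>\<infinity>b. ?u i (pfam ?D b) * ?v j (qfam ?D b))"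
        by (simp add: insert_pair_def dl coordW_dualW)
      \<comment> \<open>For \<open>False\<close> indices \<open>?u i\<close> is evaluated at a
        vector of the dual summand and gives 0; among the \<open>True\<close> ones
        \<open>?v j\<close> sees only \<open>de j\<close>.\<close>
      also have "\<dots> = (\<Sum>\<^sub>\<infinity>b\<in>{(True, j)}. ?u i (pfam ?D b) * ?v j (qfam ?D b))"
      proof (rule infsum_cong_neutral)
        fix b assume "b \<in> UNIV - {(True, j)}"
        then show "?u i (pfam ?D b) * ?v j (qfam ?D b) = 0"
          by (cases b; cases "fst b") (auto simp: coordW_def pfam_def qfam_def ip_zero pairing_dual_basis ip_basis)
      qed auto
      also have "\<dots> = ?d i j"
        by (simp add: coordW_def pfam_def qfam_def pairing_dual_basis ip_basis)
      finally show ?thesis .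
    qed
    ultimately show ?thesis by simp
  qed
  have key: "(\<Sum>(j, i)\<in>X. (norm (?d i j))\<^sup>2) \<le> (2 * \<bar>C\<bar>)\<^sup>2" if X: "finite X" for X
  proof -
    define s where "s = (\<Sum>x\<in>X. (norm (?d (snd x) (fst x)))\<^sup>2)"
    let ?c = "\<lambda>x. kconj (?d (snd x) (fst x))"
    let ?f = "\<lambda>x :: nat \<times> nat. [(False, snd x), (True, fst x)]" and ?g = "\<lambda>x :: nat \<times> nat. [(True, fst x), (False, snd x)]"
    have s0: "0 \<le> s" by (simp add: s_def sum_nonneg)
    \<comment> \<open>Each half of the symmetrised tensors is an injectively labelled orthonormal
      family; the triangle inequality over the two halves gives the factor 2.\<close>
    have "hs_le 2 (\<lambda>vs. (\<Sum>x\<in>X. ?c x * basis_tensor (?f x) vs) + (\<Sum>x\<in>X. ?c x * basis_tensor (?g x) vs))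
        (sqrt (\<Sum>x\<in>X. (norm (?c x))\<^sup>2) + sqrt (\<Sum>x\<in>X. (norm (?c x))\<^sup>2))"
      by (intro hs_le_add hs_le_basis_tensor_combination X) (auto simp: inj_on_def prod_eq_iff)
    then have t: "tnorm 2 (\<lambda>vs. \<Sum>x\<in>X. ?c x * ?\<theta> (snd x) (fst x) vs) \<le> 2 * sqrt s"
      by (simp add: hs_le_iff s_def norm_kconj sum.distrib distrib_left)
    \<comment> \<open>Conjugated matrix entries as coefficients make h of the combination the square
      sum itself.\<close>
    have "of_real s = (\<Sum>x\<in>X. ?c x * h (?\<theta> (snd x) (fst x)))"
      by (simp add: s_def d[symmetric] mult.commute[of "kconj _"] mult_kconj_of_real)
    also have "\<dots> = h (\<lambda>vs. \<Sum>x\<in>X. ?c x * ?\<theta> (snd x) (fst x) vs)"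
      by (rule linear_form_on_sum[OF h_lin \<theta>, symmetric])
    finally have hs: "h (\<lambda>vs. \<Sum>x\<in>X. ?c x * ?\<theta> (snd x) (fst x) vs) = of_real s" by simp
    have "s = norm (h (\<lambda>vs. \<Sum>x\<in>X. ?c x * ?\<theta> (snd x) (fst x) vs))" using s0 by (simp add: hs)
    also have "\<dots> \<le> C * tnorm 2 (\<lambda>vs. \<Sum>x\<in>X. ?c x * ?\<theta> (snd x) (fst x) vs)"
      by (intro C tensor_power_sum tensor_power_scale \<theta>)
    also have "\<dots> \<le> \<bar>C\<bar> * tnorm 2 (\<lambda>vs. \<Sum>x\<in>X. ?c x * ?\<theta> (snd x) (fst x) vs)"
      by (rule mult_right_mono) auto
    also have "\<dots> \<le> \<bar>C\<bar> * (2 * sqrt s)" by (rule mult_left_mono[OF t]) simp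
    finally have "s \<le> (2 * \<bar>C\<bar>) * sqrt s" by (simp add: mult_ac)
    then have "s \<le> (2 * \<bar>C\<bar>)\<^sup>2" by (rule le_square_of_le_mult_sqrt[OF s0, rotated]) simp
    then show ?thesis by (simp add: s_def case_prod_unfold)
  qed
  have "summable (\<lambda>j. (norm (?D (e j)))\<^sup>2)"
  proof (rule bounded_imp_summable)
    fix n
    \<comment> \<open>Parseval turns the norms of the columns into matrix entries, and
      \<open>key\<close> covers the finite rectangle \<open>{..n} \<times> X\<close>.\<close>
    have "(\<Sum>j\<le>n. (norm (?D (e j)))\<^sup>2) = (\<Sum>j\<le>n. \<Sum>\<^sub>\<infinity>i. (norm (?d i j))\<^sup>2)"
      by (rule sum.cong[OF refl]) (rule infsumI[symmetric, OF parseval])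
    also have "\<dots> \<le> (2 * \<bar>C\<bar>)\<^sup>2"
    proof (rule sum_infsum_le_of_finite)
      show "(\<lambda>i. (norm (?d i j))\<^sup>2) summable_on UNIV" for j
        using parseval[of "?D (e j)"] by (rule has_sum_imp_summable)
      show "(\<Sum>j\<le>n. \<Sum>i\<in>X. (norm (?d i j))\<^sup>2) \<le> (2 * \<bar>C\<bar>)\<^sup>2" if "finite X" for X
        using key[of "{..n} \<times> X"] that by (simp add: sum.cartesian_product)
    qed simp
    finally show "(\<Sum>j\<le>n. (norm (?D (e j)))\<^sup>2) \<le> (2 * \<bar>C\<bar>)\<^sup>2" .
  qed simp
  then show ?thesis using bD by (simp add: hilbert_schmidt_operators_def)
qed

section \<open>The equivalence relations and the parametrization of classes\<close>

lemma hilbert_schmidt_zero: "0 \<in> hilbert_schmidt_operators S"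
  by (simp add: hilbert_schmidt_operators_def bounded_operators_def)

lemma hilbert_schmidt_uminus: "X \<in> hilbert_schmidt_operators S \<Longrightarrow> - X \<in> hilbert_schmidt_operators S"
  by (simp add: hilbert_schmidt_operators_def bounded_operators_def blinfun.minus_left H.scale_minus_right)

lemma hilbert_schmidt_minus_commute:
  "A - B \<in> hilbert_schmidt_operators S \<Longrightarrow> B - A \<in> hilbert_schmidt_operators S"
  using hilbert_schmidt_uminus[of "A - B"] by simp

lemma hilbert_schmidt_add:
  assumes X: "X \<in> hilbert_schmidt_operators S" and Y: "Y \<in> hilbert_schmidt_operators S"
  shows "X + Y \<in> hilbert_schmidt_operators S"
proof -
  have g: "summable (\<lambda>i. 2 * ((norm (X (e i)))\<^sup>2 + (norm (Y (e i)))\<^sup>2))"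
    using X Y unfolding hilbert_schmidt_operators_def by (intro summable_mult summable_add) auto
  have le: "norm ((norm ((X + Y) (e i)))\<^sup>2) \<le> 2 * ((norm (X (e i)))\<^sup>2 + (norm (Y (e i)))\<^sup>2)" for i
  proof -
    have "(norm ((X + Y) (e i)))\<^sup>2 \<le> (norm (X (e i)) + norm (Y (e i)))\<^sup>2"
      by (intro power_mono) (simp_all add: blinfun.add_left norm_triangle_ineq)
    also have "\<dots> \<le> 2 * ((norm (X (e i)))\<^sup>2 + (norm (Y (e i)))\<^sup>2)"
      using sum_squares_bound[of "norm (X (e i))" "norm (Y (e i))"] by (simp add: power2_sum)
    finally show ?thesis by simp
  qed
  have "summable (\<lambda>i. (norm ((X + Y) (e i)))\<^sup>2)"
    by (rule summable_comparison_test'[OF g le])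
  then show ?thesis
    using bounded_operators_add[OF hs_bounded[OF X] hs_bounded[OF Y]] by (simp add: hilbert_schmidt_operators_def)
qed

lemma equivalent_iff:
  "A \<in> bounded_operators S \<Longrightarrow> B \<in> bounded_operators S \<Longrightarrow>
    equivalent_products S (star S A) (star S B) \<longleftrightarrow> A - B \<in> hilbert_schmidt_operators S"
  by (rule iffI[OF hilbert_schmidt_of_equivalent equivalent_of_hilbert_schmidt])

lemma hs_congruence_trans:
  assumes "A - B \<in> hilbert_schmidt_operators S" "B - C \<in> hilbert_schmidt_operators S"
  shows "A - C \<in> hilbert_schmidt_operators S"
  using hilbert_schmidt_add[OF assms] by simp

lemma equiv_hs_congruence: "equiv (bounded_operators S) (hs_congruence S)"
proof (rule equivI)
  show "refl_on (bounded_operators S) (hs_congruence S)"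
    by (auto simp: refl_on_def hs_congruence_def hilbert_schmidt_zero)
  show "sym (hs_congruence S)"
    by (auto simp: sym_def hs_congruence_def intro: hilbert_schmidt_minus_commute)
  show "trans (hs_congruence S)"
    by (auto simp: trans_def hs_congruence_def intro: hs_congruence_trans)
qed (auto simp: hs_congruence_def)

lemma star_equivalence_iff:
  "A \<in> bounded_operators S \<Longrightarrow> B \<in> bounded_operators S \<Longrightarrow>
    (star S A, star S B) \<in> equivalence_rel S \<longleftrightarrow> (A, B) \<in> hs_congruence S"
  by (simp add: equivalence_rel_def star_products_def hs_congruence_def equivalent_iff)

text \<open>Transported from \<open>hs_congruence\<close> along \<open>star S\<close> by the
  criterion, instead of inverting and composing formal operators.\<close>

lemma equiv_equivalence_rel: "equiv (star_products S) (equivalence_rel S)"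
proof (rule equivI)
  note R = equiv_hs_congruence[unfolded equiv_def]
  show "refl_on (star_products S) (equivalence_rel S)"
    using R by (auto simp: refl_on_def star_products_def star_equivalence_iff)
  show sub: "equivalence_rel S \<subseteq> star_products S \<times> star_products S"
    by (auto simp: equivalence_rel_def)
  show "sym (equivalence_rel S)"
  proof (rule symI)
    fix x y assume xy: "(x, y) \<in> equivalence_rel S"
    obtain A B where "A \<in> bounded_operators S" "x = star S A" "B \<in> bounded_operators S" "y = star S B"
      using sub xy unfolding star_products_def by blast
    then show "(y, x) \<in> equivalence_rel S"
      using xy R symD[of "hs_congruence S" A B] by (simp add: star_equivalence_iff)
  qed
  show "trans (equivalence_rel S)"
  proof (rule transI)
    fix x y z assume xy: "(x, y) \<in> equivalence_rel S" and yz: "(y, z) \<in> equivalence_rel S"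
    obtain A B C where "A \<in> bounded_operators S" "x = star S A" "B \<in> bounded_operators S" "y = star S B"
        "C \<in> bounded_operators S" "z = star S C"
      using sub xy yz unfolding star_products_def by blast
    then show "(x, z) \<in> equivalence_rel S"
      using xy yz R transD[of "hs_congruence S" A B C] by (simp add: star_equivalence_iff)
  qed
qed

end

theorem theorem2:
  fixes S :: "('k::real_or_complex, 'h::banach, 'd::banach) phase_data"
  assumes "hilbert_space S" and "infinite_dimensional S" and "separable S"
    and "dual_space S" and "orthonormal_basis S"
  shows "(\<forall>A\<in>bounded_operators S. \<forall>B\<in>bounded_operators S.
            equivalent_products S (star S A) (star S B) \<longleftrightarrow> A - B \<in> hilbert_schmidt_operators S)
       \<and> equiv (bounded_operators S) (hs_congruence S)
       \<and> equiv (star_products S) (equivalence_rel S)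
       \<and> (\<exists>\<Phi>. bij_betw \<Phi> (bounded_operators S // hs_congruence S)
                           (star_products S // equivalence_rel S)
             \<and> (\<forall>A\<in>bounded_operators S.
                   \<Phi> (hs_congruence S `` {A}) = equivalence_rel S `` {star S A}))"
proof -
  interpret phase_space S
    using assms by unfold_locales
  note E = equiv_equivalence_rel
  have "\<exists>\<Phi>. bij_betw \<Phi> (bounded_operators S // hs_congruence S) (star S ` bounded_operators S // equivalence_rel S)
      \<and> (\<forall>A\<in>bounded_operators S. \<Phi> (hs_congruence S `` {A}) = equivalence_rel S `` {star S A})"
    by (rule quotient_bij[OF equiv_hs_congruence E[unfolded star_products_def] star_equivalence_iff])
  then show ?thesis
    using equivalent_iff equiv_hs_congruence E by (simp add: star_products_def)
qed

end
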